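(* For each integer $d \geq 9$ there is $\epsilon_d>0$ such that for each $p \in (p_c^b(d), p_c^b(d)+\epsilon_d)$ the following holds: there is a parameter $\tilde p=\tilde p(p)\in[0,1]$ with $\tilde{p}>p^s_c(d)$ such that, under $\mathbb{P}^b_p$, $\mathcal{X}_p(d)$ (identified with its random vertex set, i.e. with the $\{0,1\}$-valued family of indicators $(\mathbf 1_{\{x\in \mathcal{X}_p(d)\}})_{x\in\mathbb{Z}^d}$) stochastically dominates site percolation on $\mathbb{Z}^d$ with parameter $\tilde{p}$. In particular, $p_{\mathrm{fin}}^b(d)>p_c^b(d)$ for each $d\ge 9$.
   Context: $\mathbb{Z}^d$ is viewed as a graph with vertex set $V(\mathbb{Z}^d)$ and set of nearest-neighbor edges $E(\mathbb{Z}^d)$. In bond (respectively site) percolation with parameter $p\in[0,1]$, each edge (respectively vertex) is open with probability $p$ and closed with probability $1-p$, independently; $\mathbb{P}^b_p$ (respectively $\mathbb{P}^s_p$) denotes the resulting product measure on $\{0,1\}^{E(\mathbb{Z}^d)}$ (respectively $\{0,1\}^{V(\mathbb{Z}^d)}$), with $1$ meaning open. Open clusters are connected components of the open subgraph (for site percolation, of the subgraph induced by open vertices). The critical probabilities are $$p_c^b(d):=\inf \{p\in [0,1]: \mathbb{P}^b_p(\text{there is an infinite open cluster})>0\},$$ $$p_c^s(d):=\inf \{p\in [0,1]: \mathbb{P}^s_p(\text{there is an infinite open cluster})>0\}.$$ For $p>p_c^b(d)$ there is almost surely a unique infinite open cluster in bond percolation. $\mathcal{X}_p(d)$ is the (random)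 subgraph of $\mathbb{Z}^d$ obtained, under $\mathbb{P}^b_p$, after removing all vertices belonging to the infinite open cluster (nothing is removed if there is none), and $$p_{\mathrm{fin}}^b(d):=\sup\{p\in[0,1]: \mathbb{P}^b_p(\mathcal{X}_p(d) \text{ has an infinite connected component})>0\}.$$ Stochastic domination: for families $Y=(Y_x)_{x\in S}$, $Z=(Z_x)_{x\in S}$ of $\{0,1\}$-valued random variables indexed by a countable set $S$, $Y$ stochastically dominates $Z$ if $\mathbb{E} f(Y)\ge \mathbb{E} f(Z)$ for every bounded measurable function $f:\{0,1\}^S\to\mathbb{R}$ that is increasing for the coordinatewise order. *)

theory Defs
  imports "HOL-Probability.Probability"
begin

definition Zd :: "nat \<Rightarrow> (nat \<Rightarrow> int) set" where
  "Zd d = {..<d} \<rightarrow>\<^sub>E UNIV"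

definition Zd_edges :: "nat \<Rightarrow> (nat \<Rightarrow> int) set set" where
  "Zd_edges d = {{x, y} | x y. x \<in> Zd d \<and> y \<in> Zd d \<and> (\<Sum>i<d. \<bar>x i - y i\<bar>) = 1}"

(* Edges of E with an endpoint outside V are ignored, so if E is the edge set of a larger
   graph these are the components of its subgraph induced by V. *)
definition components_of :: "'a set \<Rightarrow> 'a set set \<Rightarrow> 'a set set" where
  "components_of V E =
     V // {(x, y) \<in> V \<times> V. (x, y) \<in> {(u, v). u \<in> V \<and> v \<in> V \<and> {u, v} \<in> E}\<^sup>*}"

(* Configurations are Boolean-valued, True meaning open. *)
definition bond_measure :: "nat \<Rightarrow> real \<Rightarrow> ((nat \<Rightarrow> int) set \<Rightarrow> bool) measure" where
  "bond_measure d p = Pi\<^sub>M (Zd_edges d) (\<lambda>_. measure_pmf (bernoulli_pmf p))"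

definition site_measure :: "nat \<Rightarrow> real \<Rightarrow> ((nat \<Rightarrow> int) \<Rightarrow> bool) measure" where
  "site_measure d p = Pi\<^sub>M (Zd d) (\<lambda>_. measure_pmf (bernoulli_pmf p))"

definition bond_clusters :: "nat \<Rightarrow> ((nat \<Rightarrow> int) set \<Rightarrow> bool) \<Rightarrow> (nat \<Rightarrow> int) set set" where
  "bond_clusters d \<omega> = components_of (Zd d) {e \<in> Zd_edges d. \<omega> e}"

definition site_clusters :: "nat \<Rightarrow> ((nat \<Rightarrow> int) \<Rightarrow> bool) \<Rightarrow> (nat \<Rightarrow> int) set set" where
  "site_clusters d \<eta> = components_of {x \<in> Zd d. \<eta> x} (Zd_edges d)"

definition pc_bond :: "nat \<Rightarrow> real" where
  "pc_bond d = Inf {p \<in> {0..1}.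
     measure (bond_measure d p)
       {\<omega> \<in> space (bond_measure d p). \<exists>C \<in> bond_clusters d \<omega>. infinite C} > 0}"

definition pc_site :: "nat \<Rightarrow> real" where
  "pc_site d = Inf {p \<in> {0..1}.
     measure (site_measure d p)
       {\<eta> \<in> space (site_measure d p). \<exists>C \<in> site_clusters d \<eta>. infinite C} > 0}"

(* The vertex set of X_p(d). On the null event that there are several infinite open
   clusters, the vertices of all of them are removed. *)
definition X_verts :: "nat \<Rightarrow> ((nat \<Rightarrow> int) set \<Rightarrow> bool) \<Rightarrow> (nat \<Rightarrow> int) set" where
  "X_verts d \<omega> = Zd d - \<Union> {C \<in> bond_clusters d \<omega>. infinite C}"

(* X_p(d) keeps closed edges as well: it is the subgraph of the full lattice induced by
   its vertex set. *)
definition pfin_bond :: "nat \<Rightarrow> real" where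
  "pfin_bond d = Sup {p \<in> {0..1}.
     measure (bond_measure d p)
       {\<omega> \<in> space (bond_measure d p).
          \<exists>C \<in> components_of (X_verts d \<omega>) (Zd_edges d). infinite C} > 0}"

(* Y (on M) dominates Z (on N). Measurability of both families is part of the notion, so
   that the expectations below are never integrals of nonmeasurable functions. *)
definition stochastically_dominates ::
    "'i set \<Rightarrow> 'a measure \<Rightarrow> ('i \<Rightarrow> 'a \<Rightarrow> bool) \<Rightarrow> 'b measure \<Rightarrow> ('i \<Rightarrow> 'b \<Rightarrow> bool) \<Rightarrow> bool" where
  "stochastically_dominates S M Y N Z \<longleftrightarrow>
     (\<forall>x\<in>S. Y x \<in> measurable M (count_space UNIV)) \<and>
     (\<forall>x\<in>S. Z x \<in> measurable N (count_space UNIV)) \<and>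
     (\<forall>f :: ('i \<Rightarrow> bool) \<Rightarrow> real.
        f \<in> borel_measurable (Pi\<^sub>M S (\<lambda>_. count_space UNIV)) \<longrightarrow>
        bounded (f ` (S \<rightarrow>\<^sub>E UNIV)) \<longrightarrow>
        mono_on (S \<rightarrow>\<^sub>E UNIV) f \<longrightarrow>
        (\<integral>\<eta>. f (\<lambda>x\<in>S. Z x \<eta>) \<partial>N) \<le> (\<integral>\<omega>. f (\<lambda>x\<in>S. Y x \<omega>) \<partial>M))"

end

theory Submission
  imports Defs
begin

text \<open>
  Replace every edge by two independent arcs, each open with probability p. For any finite set of
  sources the set of vertices reached along open arcs has the same law as the open cluster of the
  sources in bond percolation, because both laws obey the same recursion; letting the sources
  recede to infinity, the vertices off the infinite clusters have the same joint law as the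
  vertices with a finite in-cluster. A vertex all of whose \<open>2 * d\<close> incoming arcs are closed has a finite
  in-cluster, and these events are independent. Hence X dominates site percolation with parameter
  \<open>(1 - p) ^ (2 * d)\<close>, and it remains to show \<open>pc_site d < (1 - pc_bond d) ^ (2 * d)\<close>.

  Both thresholds are bounded by second moments of weighted counts of open oriented paths: two
  independent oriented walks with k directions share few vertices or edges, as measured by the
  collision probabilities, i.e. the sums of squares of the multinomial weights. In dimension 9 oriented
  paths do not suffice for bonds; there the paths use seven oriented directions and, before each oriented
  step, an optional step in one of the four directions of the remaining two coordinates.
\<close>

section \<open>Product measures on Boolean configurations\<close>

text \<open>In bond percolation the events that two neighbouring vertices have all their edges
  closed share an edge, so they are dependent; the incoming arcs of distinct vertices are disjoint,
  which is what the doubling buys. Statements about several vertices at once survive the doubling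
  because the in-clusters of a finite set \<open>F\<close> all stay in a cube exactly when a single
  exploration, started from the shell around that cube, misses \<open>F\<close>; and an exploration
  examines each edge of its final boundary in the outgoing direction only.

  The final comparison leaves little room. Oriented second moments bound the bond threshold by
  roughly 1/d, where \<open>(1 - p) ^ (2 * d)\<close> is about exp(-2) = 0.135. In dimension 9 the
  site bound is 0.1293, while the oriented bond bound 0.1132 yields only 0.1151. Lateral steps lower
  the bond bound to 0.107, which yields 0.1304. For this reason the collision sums are evaluated
  exactly over a long initial range and only their tails are estimated.\<close>

abbreviation bern :: "real \<Rightarrow> bool measure" where
  "bern p \<equiv> measure_pmf (bernoulli_pmf p)"

lemma space_PiM_bern [simp]: "space (Pi\<^sub>M I (\<lambda>_. bern p)) = I \<rightarrow>\<^sub>E UNIV"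
  by (simp add: space_PiM)

lemma prob_space_PiM_bern: "prob_space (Pi\<^sub>M I (\<lambda>_. bern p))"
  by (intro prob_space_PiM measure_pmf.prob_space_axioms)

lemma sets_PiM_bern: "sets (Pi\<^sub>M I (\<lambda>_. bern p)) = sets (Pi\<^sub>M I (\<lambda>_. count_space UNIV))"
  by (intro sets_PiM_cong) auto

lemma cylinder_eq_prod_emb:
  assumes "J \<subseteq> I"
  shows "{\<omega> \<in> I \<rightarrow>\<^sub>E UNIV. \<forall>i\<in>J. \<omega> i = \<eta> i}
        = prod_emb I (\<lambda>_. bern p) J (\<Pi>\<^sub>E i\<in>J. {\<eta> i})"
  using assms by (auto simp: prod_emb_def PiE_iff extensional_def restrict_def)

lemma measure_cylinder:
  assumes "finite J" "J \<subseteq> I" "0 \<le> p" "p \<le> 1"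
  shows "measure (Pi\<^sub>M I (\<lambda>_. bern p)) {\<omega> \<in> I \<rightarrow>\<^sub>E UNIV. \<forall>i\<in>J. \<omega> i = \<eta> i}
           = (\<Prod>i\<in>J. if \<eta> i then p else 1 - p)"
proof -
  interpret product_prob_space "\<lambda>_::'a. bern p" I
    by (intro product_prob_spaceI measure_pmf.prob_space_axioms)
  have "measure (Pi\<^sub>M I (\<lambda>_. bern p)) (prod_emb I (\<lambda>_. bern p) J (\<Pi>\<^sub>E i\<in>J. {\<eta> i}))
        = (\<Prod>i\<in>J. measure (bern p) {\<eta> i})"
    by (rule measure_PiM_emb) (use assms in auto)
  moreover have "measure (bern p) {b} = (if b then p else 1 - p)" for b
    using assms by (cases b) (auto simp: measure_pmf_single)
  ultimately show ?thesis using cylinder_eq_prod_emb[OF assms(2), of \<eta> p] by simp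
qed

lemma sets_cylinder:
  assumes "finite J" "J \<subseteq> I"
  shows "{\<omega> \<in> I \<rightarrow>\<^sub>E UNIV. \<forall>i\<in>J. \<omega> i = \<eta> i} \<in> sets (Pi\<^sub>M I (\<lambda>_. bern p))"
  unfolding cylinder_eq_prod_emb[OF assms(2), of \<eta> p] by (rule sets_PiM_I) (use assms in auto)

text \<open>The free conjunct \<open>R\<close> lets one partition into cylinders serve both for
  \<open>P\<close> alone and for \<open>P\<close> together with a condition on other
  coordinates.\<close>

lemma finitely_determined_decomp:
  assumes "J \<subseteq> I"
    and det: "\<And>\<omega> \<omega>'. \<forall>i\<in>J. \<omega> i = \<omega>' i \<Longrightarrow> P \<omega> = P \<omega>'"
  shows "{\<omega> \<in> I \<rightarrow>\<^sub>E UNIV. P \<omega> \<and> R \<omega>}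
           = (\<Union>\<eta>\<in>{\<eta> \<in> J \<rightarrow>\<^sub>E UNIV. P \<eta>}. {\<omega> \<in> I \<rightarrow>\<^sub>E UNIV. (\<forall>i\<in>J. \<omega> i = \<eta> i) \<and> R \<omega>})"
proof (intro equalityI subsetI)
  fix \<omega> assume a: "\<omega> \<in> {\<omega> \<in> I \<rightarrow>\<^sub>E UNIV. P \<omega> \<and> R \<omega>}"
  have "P (restrict \<omega> J)" using det[of \<omega> "restrict \<omega> J"] a by auto
  then show "\<omega> \<in> (\<Union>\<eta>\<in>{\<eta> \<in> J \<rightarrow>\<^sub>E UNIV. P \<eta>}. {\<omega> \<in> I \<rightarrow>\<^sub>E UNIV. (\<forall>i\<in>J. \<omega> i = \<eta> i) \<and> R \<omega>})"
    using a by (intro UN_I[of "restrict \<omega> J"]) auto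
next
  fix \<omega> assume "\<omega> \<in> (\<Union>\<eta>\<in>{\<eta> \<in> J \<rightarrow>\<^sub>E UNIV. P \<eta>}. {\<omega> \<in> I \<rightarrow>\<^sub>E UNIV. (\<forall>i\<in>J. \<omega> i = \<eta> i) \<and> R \<omega>})"
  then show "\<omega> \<in> {\<omega> \<in> I \<rightarrow>\<^sub>E UNIV. P \<omega> \<and> R \<omega>}" using det by blast
qed

lemma finite_PiE_bool: "finite J \<Longrightarrow> finite {\<eta> \<in> J \<rightarrow>\<^sub>E (UNIV :: bool set). P \<eta>}"
  by (rule finite_subset[of _ "J \<rightarrow>\<^sub>E UNIV"]) (simp_all add: finite_PiE Collect_restrict)

lemma disjoint_family_cylinders:
  "disjoint_family_on (\<lambda>\<eta>. {\<omega> \<in> I \<rightarrow>\<^sub>E UNIV. (\<forall>i\<in>J. \<omega> i = \<eta> i) \<and> R \<omega>}) {\<eta> \<in> J \<rightarrow>\<^sub>E UNIV. P \<eta>}"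
  unfolding disjoint_family_on_def
proof (intro ballI impI)
  fix \<eta> \<eta>' assume "\<eta> \<in> {\<eta> \<in> J \<rightarrow>\<^sub>E UNIV. P \<eta>}" "\<eta>' \<in> {\<eta> \<in> J \<rightarrow>\<^sub>E UNIV. P \<eta>}" "\<eta> \<noteq> \<eta>'"
  then obtain i where "i \<in> J" "\<eta> i \<noteq> \<eta>' i"
    using PiE_ext[of \<eta> J "\<lambda>_. UNIV" \<eta>'] by blast
  then show "{\<omega> \<in> I \<rightarrow>\<^sub>E UNIV. (\<forall>i\<in>J. \<omega> i = \<eta> i) \<and> R \<omega>}
           \<inter> {\<omega> \<in> I \<rightarrow>\<^sub>E UNIV. (\<forall>i\<in>J. \<omega> i = \<eta>' i) \<and> R \<omega>} = {}"
    by auto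
qed

lemma sets_finitely_determined:
  assumes J: "finite J" "J \<subseteq> I"
    and det: "\<And>\<omega> \<omega>'. \<forall>i\<in>J. \<omega> i = \<omega>' i \<Longrightarrow> P \<omega> = P \<omega>'"
  shows "{\<omega> \<in> I \<rightarrow>\<^sub>E UNIV. P \<omega>} \<in> sets (Pi\<^sub>M I (\<lambda>_. bern p))"
proof -
  have "{\<omega> \<in> I \<rightarrow>\<^sub>E UNIV. P \<omega> \<and> True}
      = (\<Union>\<eta>\<in>{\<eta> \<in> J \<rightarrow>\<^sub>E UNIV. P \<eta>}. {\<omega> \<in> I \<rightarrow>\<^sub>E UNIV. (\<forall>i\<in>J. \<omega> i = \<eta> i) \<and> True})"
    by (rule finitely_determined_decomp[OF J(2) det])
  also have "\<dots> \<in> sets (Pi\<^sub>M I (\<lambda>_. bern p))"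
    unfolding simp_thms by (intro sets.finite_UN finite_PiE_bool J sets_cylinder)
  finally show ?thesis unfolding simp_thms .
qed

text \<open>Independence of disjoint coordinate sets, in the form used by the exploration. On each
  cylinder over \<open>J\<close> the two conditions form a single cylinder over
  \<open>J \<union> K\<close>, whose probability is a product.\<close>

lemma prob_determined_and_closed:
  assumes J: "finite J" "J \<subseteq> I" and K: "finite K" "K \<subseteq> I" "J \<inter> K = {}"
    and p: "0 \<le> p" "p \<le> 1"
    and det: "\<And>\<omega> \<omega>'. \<forall>i\<in>J. \<omega> i = \<omega>' i \<Longrightarrow> P \<omega> = P \<omega>'"
  shows "measure (Pi\<^sub>M I (\<lambda>_. bern p)) {\<omega> \<in> I \<rightarrow>\<^sub>E UNIV. P \<omega> \<and> (\<forall>i\<in>K. \<not> \<omega> i)}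
         = measure (Pi\<^sub>M I (\<lambda>_. bern p)) {\<omega> \<in> I \<rightarrow>\<^sub>E UNIV. P \<omega>} * (1 - p) ^ card K"
proof -
  let ?M = "Pi\<^sub>M I (\<lambda>_. bern p)"
  interpret prob_space ?M by (rule prob_space_PiM_bern)
  have eq: "{\<omega> \<in> I \<rightarrow>\<^sub>E UNIV. (\<forall>i\<in>J. \<omega> i = \<eta> i) \<and> (\<forall>i\<in>K. \<not> \<omega> i)}
            = {\<omega> \<in> I \<rightarrow>\<^sub>E UNIV. \<forall>i\<in>J \<union> K. \<omega> i = (if i \<in> J then \<eta> i else False)}" for \<eta>
    using K(3) by auto
  have m: "measure ?M {\<omega> \<in> I \<rightarrow>\<^sub>E UNIV. (\<forall>i\<in>J. \<omega> i = \<eta> i) \<and> (\<forall>i\<in>K. \<not> \<omega> i)}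
        = measure ?M {\<omega> \<in> I \<rightarrow>\<^sub>E UNIV. \<forall>i\<in>J. \<omega> i = \<eta> i} * (1 - p) ^ card K" for \<eta>
  proof -
    have "measure ?M {\<omega> \<in> I \<rightarrow>\<^sub>E UNIV. (\<forall>i\<in>J. \<omega> i = \<eta> i) \<and> (\<forall>i\<in>K. \<not> \<omega> i)}
        = (\<Prod>i\<in>J \<union> K. if (if i \<in> J then \<eta> i else False) then p else 1 - p)"
      unfolding eq using J K p by (intro measure_cylinder) auto
    also have "\<dots> = (\<Prod>i\<in>J. if \<eta> i then p else 1 - p) * (\<Prod>i\<in>K. 1 - p)"
    proof -
      have "(\<Prod>i\<in>K. if (if i \<in> J then \<eta> i else False) then p else 1 - p) = (\<Prod>i\<in>K. 1 - p)"
        using K by (intro prod.cong) auto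
      then show ?thesis using J K by (subst prod.union_disjoint) (auto intro!: prod.cong)
    qed
    also have "(\<Prod>i\<in>J. if \<eta> i then p else 1 - p) = measure ?M {\<omega> \<in> I \<rightarrow>\<^sub>E UNIV. \<forall>i\<in>J. \<omega> i = \<eta> i}"
      using J p by (intro measure_cylinder[symmetric]) auto
    finally show ?thesis by simp
  qed
  let ?S = "{\<eta> \<in> J \<rightarrow>\<^sub>E UNIV. P \<eta>}"
  have s: "{\<omega> \<in> I \<rightarrow>\<^sub>E UNIV. (\<forall>i\<in>J. \<omega> i = \<eta> i) \<and> (\<forall>i\<in>K. \<not> \<omega> i)} \<in> sets ?M" for \<eta>
    unfolding eq using J K by (intro sets_cylinder) auto
  have U: "{\<omega> \<in> I \<rightarrow>\<^sub>E UNIV. P \<omega> \<and> R \<omega>}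
           = (\<Union>\<eta>\<in>?S. {\<omega> \<in> I \<rightarrow>\<^sub>E UNIV. (\<forall>i\<in>J. \<omega> i = \<eta> i) \<and> R \<omega>})" for R
    by (rule finitely_determined_decomp[OF J(2) det])
  have "measure ?M {\<omega> \<in> I \<rightarrow>\<^sub>E UNIV. P \<omega> \<and> (\<forall>i\<in>K. \<not> \<omega> i)}
      = (\<Sum>\<eta>\<in>?S. measure ?M {\<omega> \<in> I \<rightarrow>\<^sub>E UNIV. (\<forall>i\<in>J. \<omega> i = \<eta> i) \<and> (\<forall>i\<in>K. \<not> \<omega> i)})"
    unfolding U
    by (rule finite_measure_finite_Union[OF finite_PiE_bool[OF J(1)] _ disjoint_family_cylinders]) (use s in blast)
  also have "\<dots> = (\<Sum>\<eta>\<in>?S. measure ?M {\<omega> \<in> I \<rightarrow>\<^sub>E UNIV. \<forall>i\<in>J. \<omega> i = \<eta> i}) * (1 - p) ^ card K"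
    by (simp add: m sum_distrib_right)
  also have "(\<Sum>\<eta>\<in>?S. measure ?M {\<omega> \<in> I \<rightarrow>\<^sub>E UNIV. \<forall>i\<in>J. \<omega> i = \<eta> i})
      = measure ?M (\<Union>\<eta>\<in>?S. {\<omega> \<in> I \<rightarrow>\<^sub>E UNIV. (\<forall>i\<in>J. \<omega> i = \<eta> i) \<and> True})"
    unfolding simp_thms
    by (rule finite_measure_finite_Union[OF finite_PiE_bool[OF J(1)] _
          disjoint_family_cylinders[where R="\<lambda>_. True", unfolded simp_thms], symmetric])
      (use sets_cylinder[OF J] in blast)
  also have "(\<Union>\<eta>\<in>?S. {\<omega> \<in> I \<rightarrow>\<^sub>E UNIV. (\<forall>i\<in>J. \<omega> i = \<eta> i) \<and> True}) = {\<omega> \<in> I \<rightarrow>\<^sub>E UNIV. P \<omega>}"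
    using U[of "\<lambda>_. True"] by simp
  finally show ?thesis .
qed

text \<open>The events that all of a finite set is open form an intersection-stable family. They
  generate the whole sigma-algebra because, for a Boolean coordinate, being closed is the complement
  of being open. Laws of random sets can therefore be compared through inclusion probabilities
  alone.\<close>

lemma measure_eqI_PiM_bool:
  fixes S :: "'a set"
  assumes N: "prob_space N1" "prob_space N2"
    and s: "sets N1 = sets (Pi\<^sub>M S (\<lambda>_. count_space (UNIV :: bool set)))"
      "sets N2 = sets (Pi\<^sub>M S (\<lambda>_. count_space (UNIV :: bool set)))"
    and eq: "\<And>F. finite F \<Longrightarrow> F \<subseteq> S \<Longrightarrow>
       measure N1 {\<eta> \<in> S \<rightarrow>\<^sub>E UNIV. \<forall>x\<in>F. \<eta> x} = measure N2 {\<eta> \<in> S \<rightarrow>\<^sub>E UNIV. \<forall>x\<in>F. \<eta> x}"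
  shows "N1 = N2"
proof -
  interpret N1: prob_space N1 by fact
  interpret N2: prob_space N2 by fact
  let ?\<Omega> = "S \<rightarrow>\<^sub>E (UNIV :: bool set)"
  let ?E = "{{\<eta> \<in> ?\<Omega>. \<forall>x\<in>F. \<eta> x} | F. finite F \<and> F \<subseteq> S}"
  have sub: "?E \<subseteq> Pow ?\<Omega>" by auto
  interpret sa: sigma_algebra ?\<Omega> "sigma_sets ?\<Omega> ?E"
    by (rule sigma_algebra_sigma_sets) (rule sub)
  have gen: "sets (Pi\<^sub>M S (\<lambda>_. count_space (UNIV :: bool set))) = sigma_sets ?\<Omega> ?E"
  proof (rule antisym)
    show "sets (Pi\<^sub>M S (\<lambda>_. count_space (UNIV :: bool set))) \<subseteq> sigma_sets ?\<Omega> ?E"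
      unfolding sets_PiM_single space_count_space
    proof (rule sa.sigma_sets_subset, safe)
      fix A :: "bool set" and i assume i: "i \<in> S"
      have t: "{\<eta> \<in> ?\<Omega>. \<eta> i} \<in> sigma_sets ?\<Omega> ?E"
        using i by (intro sigma_sets.Basic CollectI exI[of _ "{i}"]) simp
      have if_in: "(if b then X else {}) \<in> sigma_sets ?\<Omega> ?E" if "X \<in> sigma_sets ?\<Omega> ?E" for b X
        using that sa.empty_sets by (cases b) (simp_all only: if_True if_False)
      have "{f \<in> ?\<Omega>. f i \<in> A} = (if True \<in> A then {\<eta> \<in> ?\<Omega>. \<eta> i} else {})
            \<union> (if False \<in> A then ?\<Omega> - {\<eta> \<in> ?\<Omega>. \<eta> i} else {})"
      proof (rule set_eqI)
        fix f show "f \<in> {f \<in> ?\<Omega>. f i \<in> A} \<longleftrightarrow> f \<in> (if True \<in> A then {\<eta> \<in> ?\<Omega>. \<eta> i} else {})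
            \<union> (if False \<in> A then ?\<Omega> - {\<eta> \<in> ?\<Omega>. \<eta> i} else {})"
          by (cases "f i") simp_all
      qed
      also have "\<dots> \<in> sigma_sets ?\<Omega> ?E"
        by (intro sa.Un if_in t sa.compl_sets)
      finally show "{f \<in> ?\<Omega>. f i \<in> A} \<in> sigma_sets ?\<Omega> ?E" .
    qed
    show "sigma_sets ?\<Omega> ?E \<subseteq> sets (Pi\<^sub>M S (\<lambda>_. count_space (UNIV :: bool set)))"
    proof (rule sets.sigma_sets_subset'[of _ "Pi\<^sub>M S (\<lambda>_. count_space UNIV)" ?\<Omega>])
      show "?E \<subseteq> sets (Pi\<^sub>M S (\<lambda>_. count_space (UNIV :: bool set)))"
      proof safe
        fix F assume "finite F" "F \<subseteq> S"
        then show "{\<eta> \<in> ?\<Omega>. \<forall>x\<in>F. \<eta> x} \<in> sets (Pi\<^sub>M S (\<lambda>_. count_space (UNIV :: bool set)))"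
          using sets_cylinder[of F S "\<lambda>_. True"] unfolding sets_PiM_bern simp_thms by blast
      qed
      have "space (Pi\<^sub>M S (\<lambda>_. count_space (UNIV :: bool set))) \<in> sets (Pi\<^sub>M S (\<lambda>_. count_space UNIV))"
        by (rule sets.top)
      then show "?\<Omega> \<in> sets (Pi\<^sub>M S (\<lambda>_. count_space (UNIV :: bool set)))"
        unfolding space_PiM space_count_space .
    qed
  qed
  show ?thesis
  proof (rule measure_eqI_generator_eq[where E="?E" and \<Omega>="?\<Omega>" and A="\<lambda>_. ?\<Omega>"])
    show "Int_stable ?E"
      unfolding Int_stable_def
    proof safe
      fix F G assume "finite F" "F \<subseteq> S" "finite G" "G \<subseteq> S"
      then show "\<exists>H. {\<eta> \<in> ?\<Omega>. \<forall>x\<in>F. \<eta> x} \<inter> {\<eta> \<in> ?\<Omega>. \<forall>x\<in>G. \<eta> x} = {\<eta> \<in> ?\<Omega>. \<forall>x\<in>H. \<eta> x} \<and> finite H \<and> H \<subseteq> S"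
        by (intro exI[of _ "F \<union> G"]) auto
    qed
    show "?E \<subseteq> Pow ?\<Omega>" by (rule sub)
    show "emeasure N1 X = emeasure N2 X" if "X \<in> ?E" for X
      using that by (elim CollectE exE conjE) (simp only: N1.emeasure_eq_measure N2.emeasure_eq_measure eq)
    show "sets N1 = sigma_sets ?\<Omega> ?E" "sets N2 = sigma_sets ?\<Omega> ?E" by (simp_all only: s gen)
    show "range (\<lambda>_. ?\<Omega>) \<subseteq> ?E"
      by (intro image_subsetI CollectI exI[of _ "{}"]) simp
  qed simp_all
qed

text \<open>No Cauchy--Schwarz is needed: expand the expectation of the square of Z/C minus the indicator
  that Z is positive.\<close>

lemma second_moment_bound:
  fixes \<mu> :: "'g \<Rightarrow> real" and A :: "'g \<Rightarrow> 'i set"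
  assumes \<Gamma>: "finite \<Gamma>" and \<mu>: "\<And>g. g \<in> \<Gamma> \<Longrightarrow> 0 \<le> \<mu> g" "(\<Sum>g\<in>\<Gamma>. \<mu> g) = 1"
    and A: "\<And>g. g \<in> \<Gamma> \<Longrightarrow> finite (A g)" "\<And>g. g \<in> \<Gamma> \<Longrightarrow> A g \<subseteq> I"
    and p: "0 < p" "p \<le> 1"
    and C: "0 < C" "(\<Sum>g\<in>\<Gamma>. \<Sum>h\<in>\<Gamma>. \<mu> g * \<mu> h * (1/p) ^ card (A g \<inter> A h)) \<le> C"
  shows "1 / C \<le> measure (Pi\<^sub>M I (\<lambda>_. bern p)) {\<omega> \<in> I \<rightarrow>\<^sub>E UNIV. \<exists>g\<in>\<Gamma>. \<forall>i\<in>A g. \<omega> i}"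
proof -
  let ?M = "Pi\<^sub>M I (\<lambda>_. bern p)"
  interpret prob_space ?M by (rule prob_space_PiM_bern)
  have cyl: "measure ?M {\<omega> \<in> I \<rightarrow>\<^sub>E UNIV. \<forall>i\<in>J. \<omega> i} = p ^ card J"
       "{\<omega> \<in> I \<rightarrow>\<^sub>E UNIV. \<forall>i\<in>J. \<omega> i} \<in> sets ?M" if "finite J" "J \<subseteq> I" for J
    using measure_cylinder[of J I p "\<lambda>_. True"] sets_cylinder[of J I "\<lambda>_. True"] that p by auto
  define Op where "Op g = {\<omega> \<in> I \<rightarrow>\<^sub>E UNIV. \<forall>i\<in>A g. \<omega> i}" for g
  have Op_Int [simp]: "Op g \<inter> (I \<rightarrow>\<^sub>E UNIV) = Op g" "Op g \<inter> (Op h \<inter> (I \<rightarrow>\<^sub>E UNIV)) = Op g \<inter> Op h"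
    "Op g \<inter> Op h \<inter> (I \<rightarrow>\<^sub>E UNIV) = Op g \<inter> Op h" for g h
    by (auto simp: Op_def)
  define S where "S = {\<omega> \<in> I \<rightarrow>\<^sub>E UNIV. \<exists>g\<in>\<Gamma>. \<forall>i\<in>A g. \<omega> i}"
  have SU: "S = (\<Union>g\<in>\<Gamma>. Op g)" by (auto simp: S_def Op_def)
  have Os: "Op g \<in> sets ?M" if "g \<in> \<Gamma>" for g unfolding Op_def using A that by (intro cyl) auto
  have Om: "measure ?M (Op g) = p ^ card (A g)" if "g \<in> \<Gamma>" for g
    unfolding Op_def using A that by (intro cyl) auto
  \<comment> \<open>A coordinate common to both events is paid for once instead of twice, so it
    raises the joint probability above the product by a factor 1/p.\<close>
  have OOm: "measure ?M (Op g \<inter> Op h) = p ^ card (A g) * p ^ card (A h) * (1/p) ^ card (A g \<inter> A h)"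
    if "g \<in> \<Gamma>" "h \<in> \<Gamma>" for g h
  proof -
    have "Op g \<inter> Op h = {\<omega> \<in> I \<rightarrow>\<^sub>E UNIV. \<forall>i\<in>A g \<union> A h. \<omega> i}" by (auto simp: Op_def)
    then have "measure ?M (Op g \<inter> Op h) = p ^ card (A g \<union> A h)"
      using cyl(1)[of "A g \<union> A h"] A that by auto
    moreover have "p ^ card (A g) * p ^ card (A h) = p ^ card (A g \<union> A h) * p ^ card (A g \<inter> A h)"
      using card_Un_Int[OF A(1)[OF that(1)] A(1)[OF that(2)]] by (simp flip: power_add)
    ultimately show ?thesis using p by (simp add: power_one_over)
  qed
  have S_Int [simp]: "S \<inter> (I \<rightarrow>\<^sub>E UNIV) = S" by (auto simp: S_def)
  have Ss: "S \<in> sets ?M" unfolding SU using \<Gamma> Os by auto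
  \<comment> \<open>Dividing each weight by the probability of its event gives \<open>Z\<close> mean
    1 and turns its second moment into the double sum bounded by \<open>C\<close>.\<close>
  define c where "c g = \<mu> g / p ^ card (A g)" for g
  define Z where "Z \<omega> = (\<Sum>g\<in>\<Gamma>. c g * indicator (Op g) \<omega>)" for \<omega>
  have c1: "(\<Sum>g\<in>\<Gamma>. c g * measure ?M (Op g)) = 1"
    using \<mu>(2) p by (simp add: c_def Om)
  have ZS: "Z \<omega> * indicator S \<omega> = Z \<omega>" for \<omega>
    unfolding Z_def SU by (auto simp: indicator_def sum_distrib_right intro!: sum.cong)
  have EZ: "integrable ?M Z" "(\<integral>\<omega>. Z \<omega> \<partial>?M) = 1"
  proof -
    show "integrable ?M Z" unfolding Z_def using Os by (auto intro!: integrable_real_indicator simp: emeasure_eq_measure)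
    have "(\<integral>\<omega>. Z \<omega> \<partial>?M) = (\<Sum>g\<in>\<Gamma>. c g * measure ?M (Op g))"
      unfolding Z_def using Os by (subst Bochner_Integration.integral_sum)
        (auto intro!: integrable_real_indicator sum.cong simp: emeasure_eq_measure)
    then show "(\<integral>\<omega>. Z \<omega> \<partial>?M) = 1" using c1 by simp
  qed
  have Z2: "Z \<omega> ^ 2 = (\<Sum>g\<in>\<Gamma>. \<Sum>h\<in>\<Gamma>. c g * c h * indicator (Op g \<inter> Op h) \<omega>)" for \<omega>
    by (simp add: Z_def power2_eq_square sum_product indicator_inter_arith algebra_simps)
  have EZ2: "integrable ?M (\<lambda>\<omega>. Z \<omega> ^ 2)" "(\<integral>\<omega>. Z \<omega> ^ 2 \<partial>?M) \<le> C"
  proof -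
    show "integrable ?M (\<lambda>\<omega>. Z \<omega> ^ 2)" unfolding Z2 using Os
      by (auto intro!: Bochner_Integration.integrable_sum integrable_mult_right integrable_real_indicator simp: emeasure_eq_measure)
    have "(\<integral>\<omega>. Z \<omega> ^ 2 \<partial>?M) = (\<Sum>g\<in>\<Gamma>. \<Sum>h\<in>\<Gamma>. c g * c h * measure ?M (Op g \<inter> Op h))"
      unfolding Z2 using Os
      by (subst Bochner_Integration.integral_sum, force intro!: Bochner_Integration.integrable_sum integrable_mult_right integrable_real_indicator simp: emeasure_eq_measure,
          intro sum.cong refl, subst Bochner_Integration.integral_sum)
        (auto intro!: integrable_mult_right integrable_real_indicator sum.cong simp: emeasure_eq_measure)
    also have "\<dots> = (\<Sum>g\<in>\<Gamma>. \<Sum>h\<in>\<Gamma>. \<mu> g * \<mu> h * (1/p) ^ card (A g \<inter> A h))"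
      using p by (intro sum.cong refl) (simp add: OOm c_def)
    finally show "(\<integral>\<omega>. Z \<omega> ^ 2 \<partial>?M) \<le> C" using C by simp
  qed
  have iS: "integrable ?M (indicator S :: _ \<Rightarrow> real)"
    using Ss by (auto intro!: integrable_real_indicator simp: emeasure_eq_measure)
  have "0 \<le> (\<integral>\<omega>. (Z \<omega> / C - indicator S \<omega>) ^ 2 \<partial>?M)"
    by (rule Bochner_Integration.integral_nonneg) simp
  also have "(\<lambda>\<omega>. (Z \<omega> / C - indicator S \<omega>) ^ 2)
      = (\<lambda>\<omega>. Z \<omega> ^ 2 / C ^ 2 - 2 / C * Z \<omega> + indicator S \<omega>)"
  proof
    fix \<omega>
    have "(indicator S \<omega> :: real) ^ 2 = indicator S \<omega>" by (simp add: indicator_def)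
    moreover have "2 / C * Z \<omega> = 2 / C * (Z \<omega> * indicator S \<omega>)" by (simp only: ZS)
    ultimately show "(Z \<omega> / C - indicator S \<omega>) ^ 2 = Z \<omega> ^ 2 / C ^ 2 - 2 / C * Z \<omega> + indicator S \<omega>"
      by (simp add: power2_diff power_divide)
  qed
  also have "(\<integral>\<omega>. Z \<omega> ^ 2 / C ^ 2 - 2 / C * Z \<omega> + indicator S \<omega> \<partial>?M)
      = (\<integral>\<omega>. Z \<omega> ^ 2 \<partial>?M) / C ^ 2 - 2 / C + measure ?M S"
    using EZ EZ2(1) iS Ss by simp
  also have "\<dots> \<le> C / C ^ 2 - 2 / C + measure ?M S"
    using EZ2(2) by (simp add: divide_right_mono)
  also have "\<dots> = measure ?M S - 1 / C" using C(1) by (simp add: power2_eq_square field_simps)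
  finally show ?thesis by (simp add: S_def)
qed

section \<open>Clusters and exploration of the lattice\<close>

definition arcs :: "nat \<Rightarrow> ((nat \<Rightarrow> int) \<times> (nat \<Rightarrow> int)) set" where
  "arcs d = {(x, y). {x, y} \<in> Zd_edges d}"

text \<open>\<open>idx\<close> names the Boolean variable that governs an arc. Mapping an arc to its
  undirected edge gives bond percolation; the identity gives independent orientations.\<close>

definition rel :: "('b \<Rightarrow> 'i) \<Rightarrow> 'b set \<Rightarrow> ('i \<Rightarrow> bool) \<Rightarrow> 'b set" where
  "rel idx D \<omega> = {a \<in> D. \<omega> (idx a)}"

definition cube :: "nat \<Rightarrow> nat \<Rightarrow> (nat \<Rightarrow> int) set" where
  "cube d n = {..<d} \<rightarrow>\<^sub>E {- int n..int n}"

text \<open>Predecessors are used because they are controlled by incoming arcs; for the symmetric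
  relation of bond percolation they form the cluster itself.\<close>

definition fin_pts :: "nat \<Rightarrow> ((nat \<Rightarrow> int) \<times> (nat \<Rightarrow> int)) set \<Rightarrow> (nat \<Rightarrow> int) set" where
  "fin_pts d r = {x \<in> Zd d. finite {y. (y, x) \<in> r\<^sup>*}}"

text \<open>Paths are confined to \<open>W\<close>, so that the explored set depends only on the
  variables of arcs inside \<open>W\<close>.\<close>

definition reach :: "'v set \<Rightarrow> ('v \<times> 'v) set \<Rightarrow> 'v set \<Rightarrow> 'v set" where
  "reach B r W = {v \<in> W. \<exists>b\<in>B. (b, v) \<in> (r \<inter> W \<times> W)\<^sup>*}"

lemma edge_iff:
  "{x, y} \<in> Zd_edges d \<longleftrightarrow> x \<in> Zd d \<and> y \<in> Zd d \<and> (\<Sum>i<d. \<bar>x i - y i\<bar>) = 1"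
proof -
  have s: "(\<Sum>i<d. \<bar>y i - x i\<bar>) = (\<Sum>i<d. \<bar>x i - y i\<bar>)"
    by (simp add: abs_minus_commute)
  show ?thesis by (auto simp: Zd_edges_def doubleton_eq_iff s)
qed

lemma arcs_iff: "(x, y) \<in> arcs d \<longleftrightarrow> x \<in> Zd d \<and> y \<in> Zd d \<and> (\<Sum>i<d. \<bar>x i - y i\<bar>) = 1"
  by (simp add: arcs_def edge_iff)

lemma arcs_subset: "arcs d \<subseteq> Zd d \<times> Zd d" by (auto simp: arcs_iff)

lemma arcs_sym: "(x, y) \<in> arcs d \<Longrightarrow> (y, x) \<in> arcs d"
  by (simp add: arcs_def insert_commute)

lemma edges_image: "(\<lambda>(x, y). {x, y}) ` arcs d = Zd_edges d"
proof
  show "Zd_edges d \<subseteq> (\<lambda>(x, y). {x, y}) ` arcs d"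
  proof
    fix e assume e: "e \<in> Zd_edges d"
    then obtain x y where "e = {x, y}" unfolding Zd_edges_def by blast
    then show "e \<in> (\<lambda>(x, y). {x, y}) ` arcs d"
      using e by (intro image_eqI[of _ _ "(x, y)"]) (simp_all add: arcs_def)
  qed
qed (auto simp: arcs_def)

lemma countable_Zd: "countable (Zd d)"
  unfolding Zd_def by (intro countable_PiE) auto

lemma finite_cube: "finite (cube d n)"
  unfolding cube_def by (intro finite_PiE) auto

lemma cube_mono: "m \<le> n \<Longrightarrow> cube d m \<subseteq> cube d n"
  unfolding cube_def by (intro PiE_mono) auto

lemma finite_subset_cube:
  assumes "finite F" "F \<subseteq> Zd d"
  shows "\<exists>n. F \<subseteq> cube d n"
  using assms
proof (induction F rule: finite_induct)
  case (insert x F)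
  then obtain n where n: "F \<subseteq> cube d n" by auto
  define m where "m = (\<Sum>i<d. nat \<bar>x i\<bar>)"
  have "\<bar>x i\<bar> \<le> int m" if "i < d" for i
  proof -
    have "nat \<bar>x i\<bar> \<le> m" unfolding m_def using that by (intro member_le_sum) auto
    then show ?thesis by linarith
  qed
  then have "x \<in> cube d m"
    using insert.prems by (fastforce simp: cube_def Zd_def PiE_iff abs_le_iff)
  then show ?case using n cube_mono[of n "max m n" d] cube_mono[of m "max m n" d]
    by (intro exI[of _ "max m n"]) auto
qed auto

lemma arc_cube:
  assumes "(x, y) \<in> arcs d" "y \<in> cube d n"
  shows "x \<in> cube d (Suc n)"
proof -
  have x: "x \<in> Zd d" and s: "(\<Sum>i<d. \<bar>x i - y i\<bar>) = 1" using assms(1) by (auto simp: arcs_iff)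
  have "x i \<in> {- int (Suc n)..int (Suc n)}" if i: "i < d" for i
  proof -
    have "\<bar>x i - y i\<bar> \<le> (\<Sum>i<d. \<bar>x i - y i\<bar>)" using i by (intro member_le_sum) auto
    moreover have "y i \<in> {- int n..int n}" using assms(2) i by (auto simp: cube_def PiE_iff)
    ultimately show ?thesis using s by auto
  qed
  then show ?thesis using x by (auto simp: cube_def Zd_def PiE_iff)
qed

lemma components_of_iff:
  "C \<in> components_of V E \<longleftrightarrow>
     (\<exists>x\<in>V. C = {y. (x, y) \<in> {(u, v). u \<in> V \<and> v \<in> V \<and> {u, v} \<in> E}\<^sup>*})"
proof -
  let ?R = "{(u, v). u \<in> V \<and> v \<in> V \<and> {u, v} \<in> E}"
  have "(x, y) \<in> ?R\<^sup>* \<Longrightarrow> x \<in> V \<Longrightarrow> y \<in> V" for x y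
    by (induction rule: rtrancl_induct) auto
  then have "{(x, y) \<in> V \<times> V. (x, y) \<in> ?R\<^sup>*} `` {x} = {y. (x, y) \<in> ?R\<^sup>*}" if "x \<in> V" for x
    using that by blast
  then show ?thesis unfolding components_of_def quotient_def by blast
qed

text \<open>When both orientations share a variable the open relation is symmetric, so a cluster
  coincides with the set of predecessors of any of its points. This is the form that can be compared
  with independent arcs.\<close>

lemma X_verts_eq: "X_verts d \<omega> = fin_pts d (rel (\<lambda>(x, y). {x, y}) (arcs d) \<omega>)"
proof -
  let ?r = "rel (\<lambda>(x, y). {x, y}) (arcs d) \<omega>"
  have r: "{(u, v). u \<in> Zd d \<and> v \<in> Zd d \<and> {u, v} \<in> {e \<in> Zd_edges d. \<omega> e}} = ?r"
    by (auto simp: rel_def arcs_def edge_iff)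
  have "sym ?r" by (auto simp: sym_def rel_def insert_commute arcs_sym)
  then have s: "sym (?r\<^sup>*)" by (rule sym_rtrancl)
  have c: "C \<in> bond_clusters d \<omega> \<longleftrightarrow> (\<exists>x\<in>Zd d. C = {y. (x, y) \<in> ?r\<^sup>*})" for C
    unfolding bond_clusters_def components_of_iff r ..
  have eq: "{y. (x, y) \<in> ?r\<^sup>*} = {y. (y, x) \<in> ?r\<^sup>*}" for x using s by (auto simp: sym_def)
  have eqv: "{y. (z, y) \<in> ?r\<^sup>*} = {y. (x, y) \<in> ?r\<^sup>*}" if "(z, x) \<in> ?r\<^sup>*" for z x
    using that s by (auto simp: sym_def intro: rtrancl_trans)
  have "x \<in> \<Union>{C \<in> bond_clusters d \<omega>. infinite C} \<longleftrightarrow> infinite {y. (y, x) \<in> ?r\<^sup>*}" if x: "x \<in> Zd d" for x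
  proof
    assume "x \<in> \<Union>{C \<in> bond_clusters d \<omega>. infinite C}"
    then obtain z where "(z, x) \<in> ?r\<^sup>*" "infinite {y. (z, y) \<in> ?r\<^sup>*}" by (auto simp: c)
    then show "infinite {y. (y, x) \<in> ?r\<^sup>*}" using eqv eq by metis
  next
    assume "infinite {y. (y, x) \<in> ?r\<^sup>*}"
    then show "x \<in> \<Union>{C \<in> bond_clusters d \<omega>. infinite C}"
      using x eq[of x] by (intro UnionI[of "{y. (x, y) \<in> ?r\<^sup>*}"]) (auto simp: c)
  qed
  then show ?thesis unfolding X_verts_def fin_pts_def by blast
qed

lemma sets_rtrancl:
  assumes C: "countable C" and sub: "\<And>\<omega>. r \<omega> \<subseteq> C \<times> C"
    and m: "\<And>u v. {\<omega> \<in> space M. (u, v) \<in> r \<omega>} \<in> sets M"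
  shows "{\<omega> \<in> space M. (u, v) \<in> (r \<omega>)\<^sup>*} \<in> sets M"
proof -
  have p: "{\<omega> \<in> space M. (u, v) \<in> r \<omega> ^^ n} \<in> sets M" for n v
  proof (induction n arbitrary: v)
    case 0
    then show ?case by (cases "u = v") auto
  next
    case (Suc n)
    have "(u, v) \<in> r \<omega> ^^ Suc n \<longleftrightarrow> (\<exists>z\<in>C. (u, z) \<in> r \<omega> ^^ n \<and> (z, v) \<in> r \<omega>)" for \<omega>
      using sub[of \<omega>] by auto
    then show ?case
      by (simp only:) (intro sets.sets_Collect_countable_Ex' sets.sets_Collect_conj Suc m C)
  qed
  show ?thesis unfolding rtrancl_power
    by (intro sets.sets_Collect_countable_Ex p)
qed

lemma sets_rel:
  "{\<omega> \<in> I \<rightarrow>\<^sub>E UNIV. a \<in> rel idx D \<omega>} \<in> sets (Pi\<^sub>M I (\<lambda>_. bern p))" if "idx ` D \<subseteq> I"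
proof (cases "a \<in> D")
  case True
  have "{\<omega> \<in> I \<rightarrow>\<^sub>E UNIV. \<forall>i\<in>{idx a}. \<omega> i = True} \<in> sets (Pi\<^sub>M I (\<lambda>_. bern p))"
    by (rule sets_cylinder[where \<eta>="\<lambda>_. True"]) (use True that in auto)
  then show ?thesis using True by (simp add: rel_def)
qed (simp add: rel_def)

lemma sets_rel_rtrancl:
  assumes "idx ` D \<subseteq> I" "D \<subseteq> C \<times> C" "countable C"
  shows "{\<omega> \<in> I \<rightarrow>\<^sub>E UNIV. (u, v) \<in> (rel idx D \<omega>)\<^sup>*} \<in> sets (Pi\<^sub>M I (\<lambda>_. bern p))"
proof -
  have "{\<omega> \<in> space (Pi\<^sub>M I (\<lambda>_. bern p)). (u, v) \<in> (rel idx D \<omega>)\<^sup>*} \<in> sets (Pi\<^sub>M I (\<lambda>_. bern p))"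
  proof (rule sets_rtrancl[OF assms(3)])
    show "rel idx D \<omega> \<subseteq> C \<times> C" for \<omega> using assms(2) by (auto simp: rel_def)
  qed (simp add: sets_rel[OF assms(1)])
  then show ?thesis by simp
qed

text \<open>Splits the event that exploration stops at \<open>W\<close> into two conditions on
  different arcs: \<open>W\<close> is filled using arcs inside it, and every arc leaving
  \<open>W\<close> is closed. Arcs entering \<open>W\<close> from outside are never
  consulted.\<close>

lemma reach_eq_iff:
  assumes "B \<subseteq> W" "W \<subseteq> V"
  shows "reach B r V = W \<longleftrightarrow> reach B r W = W \<and> (\<forall>u\<in>W. \<forall>v\<in>V - W. (u, v) \<notin> r)"
proof
  assume W: "reach B r V = W"
  have "(u, v) \<notin> r" if "u \<in> W" "v \<in> V - W" for u v
  proof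
    assume "(u, v) \<in> r"
    moreover have "u \<in> reach B r V" using that(1) W by simp
    then obtain b where "b \<in> B" "(b, u) \<in> (r \<inter> V \<times> V)\<^sup>*" "u \<in> V"
      unfolding reach_def by blast
    ultimately have "v \<in> reach B r V"
      using that(2) by (auto simp: reach_def intro: rtrancl_into_rtrancl)
    then show False using that W by auto
  qed
  moreover have "v \<in> reach B r W" if "v \<in> W" for v
  proof -
    have "v \<in> reach B r V" using that W by simp
    then obtain b where b: "b \<in> B" "(b, v) \<in> (r \<inter> V \<times> V)\<^sup>*"
      unfolding reach_def by blast
    have "(b, v) \<in> (r \<inter> W \<times> W)\<^sup>*" using b(2)
    proof (induction rule: rtrancl_induct)
      case (step y z)
      have "y \<in> W" "z \<in> W" using step W b(1) assms
        unfolding W[symmetric] by (auto simp: reach_def intro: rtrancl_into_rtrancl)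
      then show ?case using step by (auto intro: rtrancl_into_rtrancl)
    qed auto
    then show ?thesis using b that by (auto simp: reach_def)
  qed
  ultimately show "reach B r W = W \<and> (\<forall>u\<in>W. \<forall>v\<in>V - W. (u, v) \<notin> r)"
    by (auto simp: reach_def)
next
  assume a: "reach B r W = W \<and> (\<forall>u\<in>W. \<forall>v\<in>V - W. (u, v) \<notin> r)"
  have "(r \<inter> W \<times> W)\<^sup>* \<subseteq> (r \<inter> V \<times> V)\<^sup>*" using assms by (intro rtrancl_mono) auto
  then have "reach B r W \<subseteq> reach B r V" using assms by (auto simp: reach_def)
  moreover have "v \<in> W" if "b \<in> B" "(b, v) \<in> (r \<inter> V \<times> V)\<^sup>*" for b v
    using that(2) by (induction rule: rtrancl_induct) (use a assms that in auto)
  ultimately show "reach B r V = W" using a by (auto simp: reach_def)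
qed

section \<open>The law of an explored set\<close>

lemma reach_subset: "reach B r W \<subseteq> W" by (auto simp: reach_def)

lemma reach_superset: "B \<subseteq> W \<Longrightarrow> B \<subseteq> reach B r W" by (auto simp: reach_def)

text \<open>The assumption permits a common variable only for arcs with the same pair of endpoints.
  Both the shared and the independent orientations are instances.\<close>

locale arc_index =
  fixes idx :: "'v \<times> 'v \<Rightarrow> 'i" and D :: "('v \<times> 'v) set" and p :: real
  assumes idx: "\<And>u v u' v'. (u, v) \<in> D \<Longrightarrow> (u', v') \<in> D \<Longrightarrow> idx (u, v) = idx (u', v') \<Longrightarrow> {u, v} = {u', v'}"
    and p: "0 \<le> p" "p \<le> 1"
begin

abbreviation "I \<equiv> idx ` D"
abbreviation "M \<equiv> Pi\<^sub>M I (\<lambda>_. bern p)"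

definition full :: "'v set \<Rightarrow> 'v set \<Rightarrow> real" where
  "full B W = measure M {\<omega> \<in> I \<rightarrow>\<^sub>E UNIV. reach B (rel idx D \<omega>) W = W}"

lemma reach_determined:
  assumes "\<forall>i\<in>idx ` (D \<inter> W \<times> W). \<omega> i = \<omega>' i"
  shows "reach B (rel idx D \<omega>) W = reach B (rel idx D \<omega>') W"
proof -
  have "rel idx D \<omega> \<inter> W \<times> W = rel idx D \<omega>' \<inter> W \<times> W"
    using assms by (auto simp: rel_def)
  then show ?thesis by (simp add: reach_def)
qed

lemma sets_reach:
  assumes "finite W"
  shows "{\<omega> \<in> I \<rightarrow>\<^sub>E UNIV. P (reach B (rel idx D \<omega>) W)} \<in> sets M"
proof (rule sets_finitely_determined)
  show "finite (idx ` (D \<inter> W \<times> W))" using assms by blast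
  show "idx ` (D \<inter> W \<times> W) \<subseteq> I" by blast
  show "P (reach B (rel idx D \<omega>) W) = P (reach B (rel idx D \<omega>') W)"
    if "\<forall>i\<in>idx ` (D \<inter> W \<times> W). \<omega> i = \<omega>' i" for \<omega> \<omega>'
    using reach_determined[OF that] by simp
qed

text \<open>The reverse of an arc leaving \<open>W\<close> enters \<open>W\<close>. Hence two arcs
  leaving \<open>W\<close> never share a variable, and none shares one with an arc inside
  \<open>W\<close>: each contributes its own independent factor \<open>1 - p\<close>, however the
  orientations are coupled.\<close>

lemma prob_reach_eq:
  assumes V: "finite V" "B \<subseteq> W" "W \<subseteq> V"
  shows "measure M {\<omega> \<in> I \<rightarrow>\<^sub>E UNIV. reach B (rel idx D \<omega>) V = W}
       = full B W * (1 - p) ^ card (D \<inter> W \<times> (V - W))"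
proof -
  have fW: "finite W" using V finite_subset by auto
  let ?J = "idx ` (D \<inter> W \<times> W)" and ?K = "idx ` (D \<inter> W \<times> (V - W))"
  have inj: "inj_on idx (D \<inter> W \<times> (V - W))"
  proof (rule inj_onI, clarify)
    fix u v u' v' assume a: "(u, v) \<in> D" "(u', v') \<in> D" "idx (u, v) = idx (u', v')"
      "u \<in> W" "u' \<in> W" "v \<notin> W" "v' \<notin> W"
    show "u = u' \<and> v = v'" using idx[OF a(1,2,3)] a(4-) by (auto simp: doubleton_eq_iff)
  qed
  have disj: "?J \<inter> ?K = {}"
  proof (rule ccontr)
    assume "?J \<inter> ?K \<noteq> {}"
    then obtain u v u' v' where a: "(u, v) \<in> D" "(u', v') \<in> D" "idx (u, v) = idx (u', v')"
      "u \<in> W" "v \<in> W" "v' \<notin> W" by auto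
    show False using idx[OF a(1,2,3)] a(4-) by (auto simp: doubleton_eq_iff)
  qed
  have iff: "reach B (rel idx D \<omega>) V = W
      \<longleftrightarrow> reach B (rel idx D \<omega>) W = W \<and> (\<forall>i\<in>?K. \<not> \<omega> i)" for \<omega>
    unfolding reach_eq_iff[OF V(2,3)] by (auto simp: rel_def)
  have "measure M {\<omega> \<in> I \<rightarrow>\<^sub>E UNIV. reach B (rel idx D \<omega>) V = W}
      = measure M {\<omega> \<in> I \<rightarrow>\<^sub>E UNIV. reach B (rel idx D \<omega>) W = W} * (1 - p) ^ card ?K"
    unfolding iff
  proof (rule prob_determined_and_closed[where J="?J"])
    show "finite ?J" "finite ?K" using fW V(1) by blast+
    show "(reach B (rel idx D \<omega>) W = W) = (reach B (rel idx D \<omega>') W = W)"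
      if "\<forall>i\<in>?J. \<omega> i = \<omega>' i" for \<omega> \<omega>'
      using reach_determined[OF that] by simp
  qed (use disj p in auto)
  then show ?thesis using inj by (simp add: full_def card_image)
qed

lemma prob_reach:
  assumes V: "finite V" "B \<subseteq> V"
  shows "measure M {\<omega> \<in> I \<rightarrow>\<^sub>E UNIV. P (reach B (rel idx D \<omega>) V)}
       = (\<Sum>W | B \<subseteq> W \<and> W \<subseteq> V \<and> P W. full B W * (1 - p) ^ card (D \<inter> W \<times> (V - W)))"
proof -
  interpret prob_space M by (rule prob_space_PiM_bern)
  let ?S = "{W. B \<subseteq> W \<and> W \<subseteq> V \<and> P W}"
  have fS: "finite ?S" using V(1) by (auto intro: finite_subset[of _ "Pow V"])
  have U: "{\<omega> \<in> I \<rightarrow>\<^sub>E UNIV. P (reach B (rel idx D \<omega>) V)}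
      = (\<Union>W\<in>?S. {\<omega> \<in> I \<rightarrow>\<^sub>E UNIV. reach B (rel idx D \<omega>) V = W})"
    using reach_subset[of B] reach_superset[OF V(2)] by auto
  have "measure M (\<Union>W\<in>?S. {\<omega> \<in> I \<rightarrow>\<^sub>E UNIV. reach B (rel idx D \<omega>) V = W})
      = (\<Sum>W\<in>?S. measure M {\<omega> \<in> I \<rightarrow>\<^sub>E UNIV. reach B (rel idx D \<omega>) V = W})"
    using sets_reach[OF V(1)] by (intro finite_measure_finite_Union fS)
      (auto simp: disjoint_family_on_def)
  also have "\<dots> = (\<Sum>W\<in>?S. full B W * (1 - p) ^ card (D \<inter> W \<times> (V - W)))"
    by (intro sum.cong prob_reach_eq V) auto
  finally show ?thesis unfolding U .
qed

text \<open>Total probability over the final explored set, solved for the term \<open>W = V\<close>.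
  Only proper subsets remain on the right and \<open>idx\<close> enters only through
  \<open>full\<close>, so the recursion determines \<open>full\<close> independently of
  \<open>idx\<close>.\<close>

lemma full_rec:
  assumes V: "finite V" "B \<subseteq> V"
  shows "full B V = 1 - (\<Sum>W | B \<subseteq> W \<and> W \<subset> V. full B W * (1 - p) ^ card (D \<inter> W \<times> (V - W)))"
proof -
  interpret prob_space M by (rule prob_space_PiM_bern)
  have "1 = measure M {\<omega> \<in> I \<rightarrow>\<^sub>E UNIV. True}" using prob_space by simp
  also have "\<dots> = (\<Sum>W | B \<subseteq> W \<and> W \<subseteq> V \<and> True. full B W * (1 - p) ^ card (D \<inter> W \<times> (V - W)))"
    using prob_reach[OF V, of "\<lambda>_. True"] .
  also have "{W. B \<subseteq> W \<and> W \<subseteq> V \<and> True} = insert V {W. B \<subseteq> W \<and> W \<subset> V}" using V by auto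
  also have "(\<Sum>W\<in>\<dots>. full B W * (1 - p) ^ card (D \<inter> W \<times> (V - W)))
     = full B V + (\<Sum>W | B \<subseteq> W \<and> W \<subset> V. full B W * (1 - p) ^ card (D \<inter> W \<times> (V - W)))"
    using V by (subst sum.insert) (auto intro: finite_subset[of _ "Pow V"])
  finally show ?thesis by simp
qed

end

lemma full_eq:
  assumes "arc_index idx D p" "arc_index idx' D p" "finite V" "B \<subseteq> V"
  shows "arc_index.full idx D p B V = arc_index.full idx' D p B V"
  using assms(3,4)
proof (induction V rule: finite_psubset_induct)
  case (psubset V)
  have "arc_index.full idx D p B W = arc_index.full idx' D p B W" if "B \<subseteq> W" "W \<subset> V" for W
    using psubset.IH[of W] that by auto
  then have "(\<Sum>W | B \<subseteq> W \<and> W \<subset> V. arc_index.full idx D p B W * (1 - p) ^ card (D \<inter> W \<times> (V - W)))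
    = (\<Sum>W | B \<subseteq> W \<and> W \<subset> V. arc_index.full idx' D p B W * (1 - p) ^ card (D \<inter> W \<times> (V - W)))"
    by (intro sum.cong) auto
  then show ?case
    using psubset.hyps psubset.prems
    by (simp add: arc_index.full_rec[OF assms(1)] arc_index.full_rec[OF assms(2)])
qed

text \<open>Both sides of this identity obey the same recursion over subsets of V, because in either
  model the arcs leaving a set are closed independently of those inside it. In particular, whether
  the two orientations of an edge share one variable or have independent ones is irrelevant.\<close>

lemma prob_reach_idx_eq:
  assumes "arc_index idx D p" "arc_index idx' D p" "finite V" "B \<subseteq> V"
  shows "measure (Pi\<^sub>M (idx ` D) (\<lambda>_. bern p)) {\<omega> \<in> idx ` D \<rightarrow>\<^sub>E UNIV. P (reach B (rel idx D \<omega>) V)}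
       = measure (Pi\<^sub>M (idx' ` D) (\<lambda>_. bern p)) {\<omega> \<in> idx' ` D \<rightarrow>\<^sub>E UNIV. P (reach B (rel idx' D \<omega>) V)}"
  unfolding arc_index.prob_reach[OF assms(1,3,4)] arc_index.prob_reach[OF assms(2,3,4)]
  using assms by (intro sum.cong refl arg_cong2[where f="(*)"] full_eq) (auto intro: finite_subset)

text \<open>An arc changes each coordinate by at most one, so a path into the cube from outside
  passes through the shell; from its last shell vertex on it stays in the larger cube. An unbounded
  backward search is thereby replaced by a forward exploration of a finite set.\<close>

lemma escape_iff:
  assumes r: "r \<subseteq> arcs d" and x: "x \<in> cube d n"
  shows "{y. (y, x) \<in> r\<^sup>*} \<subseteq> cube d n \<longleftrightarrow> x \<notin> reach (cube d (Suc n) - cube d n) r (cube d (Suc n))"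
proof -
  let ?V = "cube d (Suc n)" and ?B = "cube d (Suc n) - cube d n"
  have V: "cube d n \<subseteq> ?V" by (rule cube_mono) simp
  have "x \<in> reach ?B r ?V" if y: "y \<notin> cube d n" and yx: "(y, x) \<in> r\<^sup>*" for y
  proof -
    have "z \<in> cube d n \<longrightarrow> (\<exists>b\<in>?B. (b, z) \<in> (r \<inter> ?V \<times> ?V)\<^sup>*)" if "(y, z) \<in> r\<^sup>*" for z
      using that
    proof (induction rule: rtrancl_induct)
      case base
      then show ?case using y by simp
    next
      case (step u z)
      show ?case
      proof
        assume z: "z \<in> cube d n"
        have u: "u \<in> ?V" using arc_cube[of u z d n] z step(2) r by auto
        have uz: "(u, z) \<in> r \<inter> ?V \<times> ?V" using u z V step(2) by auto
        show "\<exists>b\<in>?B. (b, z) \<in> (r \<inter> ?V \<times> ?V)\<^sup>*"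
        proof (cases "u \<in> cube d n")
          case True
          then obtain b where "b \<in> ?B" "(b, u) \<in> (r \<inter> ?V \<times> ?V)\<^sup>*" using step(3) by blast
          then show ?thesis using uz by (meson rtrancl_into_rtrancl)
        next
          case False
          then show ?thesis using u uz by (intro bexI[of _ u]) auto
        qed
      qed
    qed
    then show ?thesis using yx x V unfolding reach_def by blast
  qed
  moreover have "\<exists>y. y \<notin> cube d n \<and> (y, x) \<in> r\<^sup>*" if "x \<in> reach ?B r ?V"
  proof -
    have "(r \<inter> ?V \<times> ?V)\<^sup>* \<subseteq> r\<^sup>*" by (rule rtrancl_mono) simp
    then show ?thesis using that unfolding reach_def by blast
  qed
  ultimately show ?thesis by blast
qed

lemma rel_subset: "rel idx D \<omega> \<subseteq> D" by (auto simp: rel_def)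

lemma pred_in_Zd: "r \<subseteq> arcs d \<Longrightarrow> x \<in> Zd d \<Longrightarrow> {y. (y, x) \<in> r\<^sup>*} \<subseteq> Zd d"
proof
  fix y assume "r \<subseteq> arcs d" "x \<in> Zd d" "y \<in> {y. (y, x) \<in> r\<^sup>*}"
  then have "(y, x) \<in> r\<^sup>*" "x \<in> Zd d" by auto
  then show "y \<in> Zd d"
    by (induction rule: converse_rtrancl_induct) (use \<open>r \<subseteq> arcs d\<close> arcs_subset in auto)
qed

lemma fin_pts_subset_iff:
  assumes r: "r \<subseteq> arcs d" and F: "finite F" "F \<subseteq> Zd d"
  shows "F \<subseteq> fin_pts d r \<longleftrightarrow> (\<exists>n. \<forall>x\<in>F. {y. (y, x) \<in> r\<^sup>*} \<subseteq> cube d n)"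
proof
  assume "F \<subseteq> fin_pts d r"
  then have "finite (\<Union>x\<in>F. {y. (y, x) \<in> r\<^sup>*})" using F(1) by (auto simp: fin_pts_def)
  moreover have "(\<Union>x\<in>F. {y. (y, x) \<in> r\<^sup>*}) \<subseteq> Zd d" using pred_in_Zd[OF r] F(2) by blast
  ultimately show "\<exists>n. \<forall>x\<in>F. {y. (y, x) \<in> r\<^sup>*} \<subseteq> cube d n"
    using finite_subset_cube[of "\<Union>x\<in>F. {y. (y, x) \<in> r\<^sup>*}" d] unfolding UN_subset_iff by blast
next
  assume "\<exists>n. \<forall>x\<in>F. {y. (y, x) \<in> r\<^sup>*} \<subseteq> cube d n"
  then show "F \<subseteq> fin_pts d r" using F(2) finite_subset[OF _ finite_cube] unfolding fin_pts_def by blast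
qed

lemma sets_pred_in_cube:
  fixes idx :: "_ \<Rightarrow> 'i"
  shows "{\<omega> \<in> idx ` arcs d \<rightarrow>\<^sub>E UNIV. {y. (y, x) \<in> (rel idx (arcs d) \<omega>)\<^sup>*} \<subseteq> cube d n}
    \<in> sets (Pi\<^sub>M (idx ` arcs d) (\<lambda>_. bern p))"
proof (cases "x \<in> Zd d")
  case True
  let ?M = "Pi\<^sub>M (idx ` arcs d) (\<lambda>_. bern p)"
  have "{y. (y, x) \<in> (rel idx (arcs d) \<omega>)\<^sup>*} \<subseteq> cube d n
     \<longleftrightarrow> (\<forall>y\<in>Zd d - cube d n. (y, x) \<notin> (rel idx (arcs d) \<omega>)\<^sup>*)" for \<omega>
    using pred_in_Zd[OF rel_subset True] by blast
  moreover have "{\<omega> \<in> space ?M. \<forall>y\<in>Zd d - cube d n. (y, x) \<notin> (rel idx (arcs d) \<omega>)\<^sup>*} \<in> sets ?M"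
    by (intro sets.sets_Collect_countable_All' sets.sets_Collect_neg countable_Diff countable_Zd)
      (simp add: sets_rel_rtrancl[OF subset_refl arcs_subset countable_Zd])
  ultimately show ?thesis by simp
next
  case False
  have "{y. (y, x) \<in> (rel idx (arcs d) \<omega>)\<^sup>*} = {x}" for \<omega>
  proof -
    have "y = x" if "(y, x) \<in> (rel idx (arcs d) \<omega>)\<^sup>*" for y
      using that
    proof (cases rule: rtranclE)
      case (step z)
      then have "(z, x) \<in> arcs d" by (simp add: rel_def)
      then show ?thesis using False by (simp add: arcs_iff)
    qed
    then show ?thesis by auto
  qed
  then show ?thesis using sets.top[of "Pi\<^sub>M (idx ` arcs d) (\<lambda>_. bern p)"] by (cases "x \<in> cube d n") auto
qed

lemma sets_fin_pts_subset:
  assumes F: "finite F" "F \<subseteq> Zd d"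
  shows "{\<omega> \<in> idx ` arcs d \<rightarrow>\<^sub>E UNIV. F \<subseteq> fin_pts d (rel idx (arcs d) \<omega>)}
    \<in> sets (Pi\<^sub>M (idx ` arcs d) (\<lambda>_. bern p))"
proof -
  let ?M = "Pi\<^sub>M (idx ` arcs d) (\<lambda>_. bern p)"
  have "{\<omega> \<in> space ?M. \<exists>n. \<forall>x\<in>F. {y. (y, x) \<in> (rel idx (arcs d) \<omega>)\<^sup>*} \<subseteq> cube d n} \<in> sets ?M"
    using sets_pred_in_cube[of idx d _ _ p] F(1)
    by (intro sets.sets_Collect_countable_Ex sets.sets_Collect_finite_All) simp_all
  then show ?thesis by (simp add: fin_pts_subset_iff[OF rel_subset F])
qed

text \<open>The events that all in-clusters of \<open>F\<close> stay inside the nth cube increase to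
  the event that they are finite, since finitely many finite sets fit into one cube.\<close>

lemma tendsto_prob_fin_pts:
  assumes F: "finite F" "F \<subseteq> Zd d"
  shows "(\<lambda>n. measure (Pi\<^sub>M (idx ` arcs d) (\<lambda>_. bern p))
            {\<omega> \<in> idx ` arcs d \<rightarrow>\<^sub>E UNIV.
               reach (cube d (Suc n) - cube d n) (rel idx (arcs d) \<omega>) (cube d (Suc n)) \<inter> F = {}})
     \<longlonglongrightarrow> measure (Pi\<^sub>M (idx ` arcs d) (\<lambda>_. bern p))
            {\<omega> \<in> idx ` arcs d \<rightarrow>\<^sub>E UNIV. F \<subseteq> fin_pts d (rel idx (arcs d) \<omega>)}"
proof -
  let ?M = "Pi\<^sub>M (idx ` arcs d) (\<lambda>_. bern p)"
  interpret prob_space ?M by (rule prob_space_PiM_bern)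
  define A where "A n = {\<omega> \<in> space ?M. \<forall>x\<in>F. {y. (y, x) \<in> (rel idx (arcs d) \<omega>)\<^sup>*} \<subseteq> cube d n}" for n
  have As: "range A \<subseteq> sets ?M"
    unfolding A_def using sets_pred_in_cube[of idx d _ _ p] F(1)
    by (intro image_subsetI sets.sets_Collect_finite_All) simp_all
  have "incseq A"
    unfolding A_def incseq_def using cube_mono by blast
  then have "(\<lambda>n. measure ?M (A n)) \<longlonglongrightarrow> measure ?M (\<Union>n. A n)"
    using As by (intro finite_Lim_measure_incseq) auto
  also have "(\<Union>n. A n) = {\<omega> \<in> idx ` arcs d \<rightarrow>\<^sub>E UNIV. F \<subseteq> fin_pts d (rel idx (arcs d) \<omega>)}"
    unfolding A_def by (auto simp: fin_pts_subset_iff[OF rel_subset F])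
  finally have lim: "(\<lambda>n. measure ?M (A n)) \<longlonglongrightarrow>
     measure ?M {\<omega> \<in> idx ` arcs d \<rightarrow>\<^sub>E UNIV. F \<subseteq> fin_pts d (rel idx (arcs d) \<omega>)}" .
  obtain m where m: "F \<subseteq> cube d m" using finite_subset_cube[OF F] by auto
  \<comment> \<open>The shell test applies to vertices inside the cube, so the identity starts with
    the first cube that contains \<open>F\<close>.\<close>
  have "A n = {\<omega> \<in> idx ` arcs d \<rightarrow>\<^sub>E UNIV.
               reach (cube d (Suc n) - cube d n) (rel idx (arcs d) \<omega>) (cube d (Suc n)) \<inter> F = {}}"
    if "n \<ge> m" for n
  proof -
    have "F \<subseteq> cube d n" using m cube_mono[OF that] by blast
    then have "(\<forall>x\<in>F. {y. (y, x) \<in> (rel idx (arcs d) \<omega>)\<^sup>*} \<subseteq> cube d n)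
      \<longleftrightarrow> reach (cube d (Suc n) - cube d n) (rel idx (arcs d) \<omega>) (cube d (Suc n)) \<inter> F = {}" for \<omega>
      using escape_iff[OF rel_subset[of idx "arcs d" \<omega>], of _ n] by blast
    then show ?thesis unfolding A_def by simp
  qed
  then have "\<forall>\<^sub>F n in sequentially. measure ?M (A n) = measure ?M {\<omega> \<in> idx ` arcs d \<rightarrow>\<^sub>E UNIV.
               reach (cube d (Suc n) - cube d n) (rel idx (arcs d) \<omega>) (cube d (Suc n)) \<inter> F = {}}"
    by (intro eventually_sequentiallyI[of m]) simp
  from Lim_transform_eventually[OF lim this] show ?thesis .
qed

text \<open>For every cube the two exploration probabilities agree, hence so do their limits. Using
  the shell as a common source set handles all vertices of \<open>F\<close> in one exploration and
  so yields their joint law.\<close>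

lemma prob_fin_pts_idx_eq:
  assumes "arc_index idx (arcs d) p" "arc_index idx' (arcs d) p" and F: "finite F" "F \<subseteq> Zd d"
  shows "measure (Pi\<^sub>M (idx ` arcs d) (\<lambda>_. bern p))
            {\<omega> \<in> idx ` arcs d \<rightarrow>\<^sub>E UNIV. F \<subseteq> fin_pts d (rel idx (arcs d) \<omega>)}
       = measure (Pi\<^sub>M (idx' ` arcs d) (\<lambda>_. bern p))
            {\<omega> \<in> idx' ` arcs d \<rightarrow>\<^sub>E UNIV. F \<subseteq> fin_pts d (rel idx' (arcs d) \<omega>)}"
proof (rule LIMSEQ_unique[OF tendsto_prob_fin_pts[OF F, where p=p]])
  show "(\<lambda>n. measure (Pi\<^sub>M (idx ` arcs d) (\<lambda>_. bern p))
            {\<omega> \<in> idx ` arcs d \<rightarrow>\<^sub>E UNIV.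
               reach (cube d (Suc n) - cube d n) (rel idx (arcs d) \<omega>) (cube d (Suc n)) \<inter> F = {}})
     \<longlonglongrightarrow> measure (Pi\<^sub>M (idx' ` arcs d) (\<lambda>_. bern p))
            {\<omega> \<in> idx' ` arcs d \<rightarrow>\<^sub>E UNIV. F \<subseteq> fin_pts d (rel idx' (arcs d) \<omega>)}"
    using tendsto_prob_fin_pts[OF F, of idx' p]
      prob_reach_idx_eq[OF assms(1,2) finite_cube Diff_subset, where P="\<lambda>R. R \<inter> F = {}"]
    by simp
qed

section \<open>Shielded vertices and domination of site percolation\<close>

lemma card_in_arcs:
  assumes x: "x \<in> Zd d"
  shows "finite {a \<in> arcs d. snd a = x}" "card {a \<in> arcs d. snd a = x} = 2 * d"
proof -
  let ?f = "\<lambda>(i, s :: int). (x(i := x i + s), x)"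
  have "{a \<in> arcs d. snd a = x} = ?f ` ({..<d} \<times> {-1, 1})"
  proof (intro equalityI subsetI)
    fix a assume "a \<in> {a \<in> arcs d. snd a = x}"
    then obtain y where a: "a = (y, x)" and y: "y \<in> Zd d" "(\<Sum>i<d. \<bar>y i - x i\<bar>) = 1"
      by (cases a) (auto simp: arcs_iff)
    \<comment> \<open>Passing to naturals makes a sum equal to 1 force exactly one nonzero
      summand.\<close>
    have "int (\<Sum>i<d. nat \<bar>y i - x i\<bar>) = 1" using y(2) by simp
    then have "(\<Sum>i<d. nat \<bar>y i - x i\<bar>) = Suc 0" by linarith
    then obtain i where i: "i < d" "nat \<bar>y i - x i\<bar> = Suc 0"
      "\<And>j. j < d \<Longrightarrow> i \<noteq> j \<Longrightarrow> nat \<bar>y j - x j\<bar> = 0"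
      by (subst (asm) sum_eq_Suc0_iff) auto
    have "y = x(i := x i + (y i - x i))"
    proof
      fix j show "y j = (x(i := x i + (y i - x i))) j"
        using i(3)[of j] x y(1) by (cases "j < d"; cases "j = i") (auto simp: Zd_def PiE_iff extensional_def)
    qed
    moreover have "y i - x i \<in> {-1, 1}" using i(2) by auto
    ultimately show "a \<in> ?f ` ({..<d} \<times> {-1, 1})"
      using i(1) a by (intro image_eqI[of _ _ "(i, y i - x i)"]) auto
  next
    fix a assume "a \<in> ?f ` ({..<d} \<times> {-1, 1})"
    then obtain z where z: "z \<in> {..<d} \<times> {-1, 1}" "a = ?f z" by blast
    obtain i s where "z = (i, s)" by (cases z)
    then have a: "a = (x(i := x i + s), x)" "i < d" "s \<in> {-1, 1}" using z by auto
    then have "\<bar>s\<bar> = 1" by auto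
    have "(\<Sum>j<d. \<bar>(x(i := x i + s)) j - x j\<bar>) = (\<Sum>j<d. if j = i then 1 else 0)"
      using \<open>\<bar>s\<bar> = 1\<close> by (intro sum.cong) auto
    also have "\<dots> = 1" using a(2) by simp
    finally show "a \<in> {a \<in> arcs d. snd a = x}"
      using a x by (auto simp: arcs_iff Zd_def PiE_iff extensional_def)
  qed
  moreover have "inj_on ?f ({..<d} \<times> {-1, 1})"
  proof (rule inj_onI, clarify)
    fix i s j t :: int and i' j' :: nat
    assume s: "s \<in> {-1, 1}" "t \<in> {-1, 1}" and eq: "x(i' := x i' + s) = x(j' := x j' + t)"
    have "i' = j'"
    proof (rule ccontr)
      assume "i' \<noteq> j'"
      then show False using fun_cong[OF eq, of i'] s by auto
    qed
    then show "i' = j' \<and> s = t" using fun_cong[OF eq, of i'] by auto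
  qed
  ultimately show "finite {a \<in> arcs d. snd a = x}" "card {a \<in> arcs d. snd a = x} = 2 * d"
    by (simp_all add: card_image)
qed

lemma arc_index_edges: "0 \<le> p \<Longrightarrow> p \<le> 1 \<Longrightarrow> arc_index (\<lambda>(x, y). {x, y}) (arcs d) p"
  by unfold_locales auto

lemma arc_index_id: "0 \<le> p \<Longrightarrow> p \<le> 1 \<Longrightarrow> arc_index (\<lambda>a. a) (arcs d) p"
  by unfold_locales auto

definition shielded :: "nat \<Rightarrow> ((nat \<Rightarrow> int) \<times> (nat \<Rightarrow> int) \<Rightarrow> bool) \<Rightarrow> (nat \<Rightarrow> int) \<Rightarrow> bool" where
  "shielded d \<omega> x \<longleftrightarrow> (\<forall>a\<in>arcs d. snd a = x \<longrightarrow> \<not> \<omega> a)"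

lemma shielded_in_fin_pts:
  assumes "x \<in> Zd d" "shielded d \<omega> x"
  shows "x \<in> fin_pts d (rel (\<lambda>a. a) (arcs d) \<omega>)"
proof -
  have "y = x" if "(y, x) \<in> (rel (\<lambda>a. a) (arcs d) \<omega>)\<^sup>*" for y
    using that by (cases rule: rtranclE) (use assms(2) in \<open>auto simp: rel_def shielded_def\<close>)
  then have "{y. (y, x) \<in> (rel (\<lambda>a. a) (arcs d) \<omega>)\<^sup>*} \<subseteq> {x}" by auto
  then show ?thesis using assms(1) finite_subset by (auto simp: fin_pts_def)
qed

text \<open>Every arc has a single head, so the sets of incoming arcs of distinct vertices are
  disjoint and their sizes add up. This gives the independence that isolation in bond percolation
  lacks.\<close>

lemma shielded_cylinder:
  fixes F :: "(nat \<Rightarrow> int) set"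
  assumes F: "finite F" "F \<subseteq> Zd d" and p: "0 \<le> p" "p \<le> 1"
  shows "{\<omega> \<in> arcs d \<rightarrow>\<^sub>E UNIV. \<forall>x\<in>F. shielded d \<omega> x} \<in> sets (Pi\<^sub>M (arcs d) (\<lambda>_. bern p))"
    "measure (Pi\<^sub>M (arcs d) (\<lambda>_. bern p)) {\<omega> \<in> arcs d \<rightarrow>\<^sub>E UNIV. \<forall>x\<in>F. shielded d \<omega> x}
      = ((1 - p) ^ (2 * d)) ^ card F"
proof -
  let ?K = "\<Union>x\<in>F. {a \<in> arcs d. snd a = x}"
  have fK: "finite ?K" using F card_in_arcs by (intro finite_UN_I) auto
  have eq: "{\<omega> \<in> arcs d \<rightarrow>\<^sub>E UNIV. \<forall>x\<in>F. shielded d \<omega> x} = {\<omega> \<in> arcs d \<rightarrow>\<^sub>E UNIV. \<forall>i\<in>?K. \<omega> i = False}"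
    by (auto simp: shielded_def)
  show "{\<omega> \<in> arcs d \<rightarrow>\<^sub>E UNIV. \<forall>x\<in>F. shielded d \<omega> x} \<in> sets (Pi\<^sub>M (arcs d) (\<lambda>_. bern p))"
    unfolding eq by (rule sets_cylinder[OF fK]) auto
  have "card ?K = (\<Sum>x\<in>F. card {a \<in> arcs d. snd a = x})"
    using F card_in_arcs by (intro card_UN_disjoint) auto
  also have "\<dots> = (\<Sum>x\<in>F. 2 * d)" using F(2) card_in_arcs(2) by (intro sum.cong) auto
  finally have c: "card ?K = 2 * d * card F" by simp
  show "measure (Pi\<^sub>M (arcs d) (\<lambda>_. bern p)) {\<omega> \<in> arcs d \<rightarrow>\<^sub>E UNIV. \<forall>x\<in>F. shielded d \<omega> x}
      = ((1 - p) ^ (2 * d)) ^ card F"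
    unfolding eq using measure_cylinder[OF fK _ p, of "arcs d" "\<lambda>_. False"] c
    by (auto simp: power_mult)
qed

lemma measurable_family:
  assumes "\<And>x. x \<in> S \<Longrightarrow> {\<omega> \<in> space M. Y x \<omega>} \<in> sets M"
  shows "(\<lambda>\<omega>. \<lambda>x\<in>S. Y x \<omega>) \<in> measurable M (Pi\<^sub>M S (\<lambda>_. count_space (UNIV :: bool set)))"
proof (rule measurable_restrict)
  fix x assume "x \<in> S"
  then show "Y x \<in> measurable M (count_space UNIV)"
    using assms[of x] by (simp add: pred_def)
qed

lemma measure_distr_family:
  assumes m: "\<And>x. x \<in> S \<Longrightarrow> {\<omega> \<in> space M. Y x \<omega>} \<in> sets M" and F: "finite F" "F \<subseteq> S"
  shows "measure (distr M (Pi\<^sub>M S (\<lambda>_. count_space (UNIV :: bool set))) (\<lambda>\<omega>. \<lambda>x\<in>S. Y x \<omega>))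
       {\<eta> \<in> S \<rightarrow>\<^sub>E UNIV. \<forall>x\<in>F. \<eta> x} = measure M {\<omega> \<in> space M. \<forall>x\<in>F. Y x \<omega>}"
proof -
  have "{\<eta> \<in> S \<rightarrow>\<^sub>E UNIV. \<forall>x\<in>F. \<eta> x} \<in> sets (Pi\<^sub>M S (\<lambda>_. count_space (UNIV :: bool set)))"
    using sets_cylinder[OF F, of "\<lambda>_. True"] unfolding sets_PiM_bern by simp
  then have "measure (distr M (Pi\<^sub>M S (\<lambda>_. count_space (UNIV :: bool set))) (\<lambda>\<omega>. \<lambda>x\<in>S. Y x \<omega>))
       {\<eta> \<in> S \<rightarrow>\<^sub>E UNIV. \<forall>x\<in>F. \<eta> x}
    = measure M ((\<lambda>\<omega>. \<lambda>x\<in>S. Y x \<omega>) -` {\<eta> \<in> S \<rightarrow>\<^sub>E UNIV. \<forall>x\<in>F. \<eta> x} \<inter> space M)"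
    by (intro measure_distr measurable_family m)
  also have "(\<lambda>\<omega>. \<lambda>x\<in>S. Y x \<omega>) -` {\<eta> \<in> S \<rightarrow>\<^sub>E UNIV. \<forall>x\<in>F. \<eta> x} \<inter> space M
      = {\<omega> \<in> space M. \<forall>x\<in>F. Y x \<omega>}"
    using F(2) by auto
  finally show ?thesis .
qed

lemma distr_family_eqI:
  fixes Y :: "'i \<Rightarrow> 'a \<Rightarrow> bool" and Z :: "'i \<Rightarrow> 'b \<Rightarrow> bool"
  assumes "prob_space M" "prob_space N"
    and "\<And>x. x \<in> S \<Longrightarrow> {\<omega> \<in> space M. Y x \<omega>} \<in> sets M"
    and "\<And>x. x \<in> S \<Longrightarrow> {\<omega> \<in> space N. Z x \<omega>} \<in> sets N"
    and "\<And>F. finite F \<Longrightarrow> F \<subseteq> S \<Longrightarrow>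
      measure M {\<omega> \<in> space M. \<forall>x\<in>F. Y x \<omega>} = measure N {\<omega> \<in> space N. \<forall>x\<in>F. Z x \<omega>}"
  shows "distr M (Pi\<^sub>M S (\<lambda>_. count_space UNIV)) (\<lambda>\<omega>. \<lambda>x\<in>S. Y x \<omega>)
       = distr N (Pi\<^sub>M S (\<lambda>_. count_space UNIV)) (\<lambda>\<omega>. \<lambda>x\<in>S. Z x \<omega>)"
proof (rule measure_eqI_PiM_bool[where S=S])
  show "prob_space (distr M (Pi\<^sub>M S (\<lambda>_. count_space UNIV)) (\<lambda>\<omega>. \<lambda>x\<in>S. Y x \<omega>))"
    by (intro prob_space.prob_space_distr assms measurable_family)
  show "prob_space (distr N (Pi\<^sub>M S (\<lambda>_. count_space UNIV)) (\<lambda>\<omega>. \<lambda>x\<in>S. Z x \<omega>))"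
    by (intro prob_space.prob_space_distr assms measurable_family)
qed (simp_all add: measure_distr_family assms)

lemma sets_X_verts:
  assumes F: "finite F" "F \<subseteq> Zd d"
  shows "{\<omega> \<in> space (bond_measure d p). \<forall>x\<in>F. x \<in> X_verts d \<omega>} \<in> sets (bond_measure d p)"
  using sets_fin_pts_subset[OF F, of "\<lambda>(x, y). {x, y}" p]
  by (simp add: bond_measure_def edges_image X_verts_eq subset_eq)

text \<open>A coupling on the space of independent arcs: the vertices of X have the law of
  \<open>U\<close>, site percolation has the law of \<open>shielded\<close>, and a shielded vertex
  satisfies \<open>U\<close> pointwise.\<close>

theorem X_dominates_site:
  assumes p: "0 \<le> p" "p \<le> 1"
  shows "stochastically_dominates (Zd d) (bond_measure d p) (\<lambda>x \<omega>. x \<in> X_verts d \<omega>)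
           (site_measure d ((1 - p) ^ (2 * d))) (\<lambda>x \<eta>. \<eta> x)"
proof -
  let ?S = "Zd d" and ?q = "(1 - p) ^ (2 * d)"
  let ?P = "Pi\<^sub>M ?S (\<lambda>_. count_space (UNIV :: bool set))"
  let ?B = "bond_measure d p" and ?T = "site_measure d ?q"
  define Q where "Q = Pi\<^sub>M (arcs d) (\<lambda>_. bern p)"
  define U where "U x \<omega> \<longleftrightarrow> x \<in> fin_pts d (rel (\<lambda>a. a) (arcs d) \<omega>)" for x \<omega>
  have q: "0 \<le> ?q" "?q \<le> 1" using p by (auto intro: power_le_one)
  have ps: "prob_space Q" "prob_space ?B" "prob_space ?T"
    by (simp_all add: Q_def bond_measure_def site_measure_def prob_space_PiM_bern)
  interpret Q: prob_space Q by fact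
  have mX: "{\<omega> \<in> space ?B. x \<in> X_verts d \<omega>} \<in> sets ?B" if "x \<in> ?S" for x
    using sets_X_verts[of "{x}" d p] that by simp
  have mU: "{\<omega> \<in> space Q. U x \<omega>} \<in> sets Q" if "x \<in> ?S" for x
    using sets_fin_pts_subset[of "{x}" d "\<lambda>a. a" p] that by (simp add: Q_def U_def)
  have mE: "{\<omega> \<in> space Q. shielded d \<omega> x} \<in> sets Q" if "x \<in> ?S" for x
    using shielded_cylinder(1)[of "{x}" d p] that p by (simp add: Q_def)
  have mT: "{\<omega> \<in> space ?T. \<omega> x} \<in> sets ?T" if "x \<in> ?S" for x
    using sets_cylinder[of "{x}" ?S "\<lambda>_. True" ?q] that by (simp add: site_measure_def)
  have law1: "distr ?B ?P (\<lambda>\<omega>. \<lambda>x\<in>?S. x \<in> X_verts d \<omega>) = distr Q ?P (\<lambda>\<omega>. \<lambda>x\<in>?S. U x \<omega>)"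
  proof (rule distr_family_eqI[OF ps(2,1) mX mU])
    fix F assume F: "finite F" "F \<subseteq> ?S"
    show "measure ?B {\<omega> \<in> space ?B. \<forall>x\<in>F. x \<in> X_verts d \<omega>} = measure Q {\<omega> \<in> space Q. \<forall>x\<in>F. U x \<omega>}"
      using prob_fin_pts_idx_eq[OF arc_index_edges[OF p] arc_index_id[OF p] F]
      by (simp add: bond_measure_def edges_image X_verts_eq subset_eq Q_def U_def)
  qed
  have law2: "distr ?T ?P (\<lambda>\<omega>. \<lambda>x\<in>?S. \<omega> x) = distr Q ?P (\<lambda>\<omega>. \<lambda>x\<in>?S. shielded d \<omega> x)"
  proof (rule distr_family_eqI[OF ps(3,1) mT mE])
    fix F assume F: "finite F" "F \<subseteq> ?S"
    have "measure ?T {\<omega> \<in> space ?T. \<forall>x\<in>F. \<omega> x} = ?q ^ card F"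
      using measure_cylinder[OF F q, of "\<lambda>_. True"] by (simp add: site_measure_def)
    then show "measure ?T {\<omega> \<in> space ?T. \<forall>x\<in>F. \<omega> x} = measure Q {\<omega> \<in> space Q. \<forall>x\<in>F. shielded d \<omega> x}"
      using shielded_cylinder(2)[OF F p] by (simp add: Q_def)
  qed
  show ?thesis
    unfolding stochastically_dominates_def
  proof (intro conjI ballI allI impI)
    show "(\<lambda>\<omega>. x \<in> X_verts d \<omega>) \<in> measurable ?B (count_space UNIV)" if "x \<in> ?S" for x
      using mX[OF that] by (simp add: pred_def)
    show "(\<lambda>\<eta>. \<eta> x) \<in> measurable ?T (count_space UNIV)" if "x \<in> ?S" for x
      using mT[OF that] by (simp add: pred_def)
  next
    fix f :: "((nat \<Rightarrow> int) \<Rightarrow> bool) \<Rightarrow> real"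
    assume f: "f \<in> borel_measurable ?P" and bd: "bounded (f ` (?S \<rightarrow>\<^sub>E UNIV))"
      and mono: "mono_on (?S \<rightarrow>\<^sub>E UNIV) f"
    obtain K where K: "\<And>\<eta>. \<eta> \<in> ?S \<rightarrow>\<^sub>E UNIV \<Longrightarrow> \<bar>f \<eta>\<bar> \<le> K"
      using bd by (auto simp: bounded_iff)
    have int: "integrable Q (\<lambda>\<omega>. f (\<lambda>x\<in>?S. Y x \<omega>))"
      if "\<And>x. x \<in> ?S \<Longrightarrow> {\<omega> \<in> space Q. Y x \<omega>} \<in> sets Q" for Y
    proof (rule Q.integrable_const_bound)
      show "AE \<omega> in Q. norm (f (\<lambda>x\<in>?S. Y x \<omega>)) \<le> K" using K by (auto intro!: AE_I2)
      show "(\<lambda>\<omega>. f (\<lambda>x\<in>?S. Y x \<omega>)) \<in> borel_measurable Q"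
        using measurable_compose[OF measurable_family f] that by blast
    qed
    have "(\<integral>\<eta>. f (\<lambda>x\<in>?S. \<eta> x) \<partial>?T) = (\<integral>\<eta>. f \<eta> \<partial>distr ?T ?P (\<lambda>\<omega>. \<lambda>x\<in>?S. \<omega> x))"
      by (rule integral_distr[symmetric, OF measurable_family[OF mT] f])
    also have "\<dots> = (\<integral>\<omega>. f (\<lambda>x\<in>?S. shielded d \<omega> x) \<partial>Q)"
      unfolding law2 by (rule integral_distr[OF measurable_family[OF mE] f])
    also have "\<dots> \<le> (\<integral>\<omega>. f (\<lambda>x\<in>?S. U x \<omega>) \<partial>Q)"
    proof (rule integral_mono[OF int[OF mE] int[OF mU]])
      fix \<omega>
      show "f (\<lambda>x\<in>?S. shielded d \<omega> x) \<le> f (\<lambda>x\<in>?S. U x \<omega>)"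
        by (rule mono_onD[OF mono])
          (auto simp: le_fun_def U_def intro: shielded_in_fin_pts)
    qed
    also have "\<dots> = (\<integral>\<eta>. f \<eta> \<partial>distr ?B ?P (\<lambda>\<omega>. \<lambda>x\<in>?S. x \<in> X_verts d \<omega>))"
      unfolding law1 by (rule integral_distr[symmetric, OF measurable_family[OF mU] f])
    also have "\<dots> = (\<integral>\<omega>. f (\<lambda>x\<in>?S. x \<in> X_verts d \<omega>) \<partial>?B)"
      by (rule integral_distr[OF measurable_family[OF mX] f])
    finally show "(\<integral>\<eta>. f (\<lambda>x\<in>?S. \<eta> x) \<partial>?T) \<le> (\<integral>\<omega>. f (\<lambda>x\<in>?S. x \<in> X_verts d \<omega>) \<partial>?B)" .
  qed
qed

section \<open>Layered random walks and the second moment\<close>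

definition inf_comp :: "nat \<Rightarrow> ((nat \<Rightarrow> int) \<times> (nat \<Rightarrow> int)) set \<Rightarrow> bool" where
  "inf_comp d r \<longleftrightarrow> (\<exists>x\<in>Zd d. infinite {y. (x, y) \<in> r\<^sup>*})"

lemma inf_comp_mono:
  assumes "r \<subseteq> r'" "inf_comp d r"
  shows "inf_comp d r'"
proof -
  have "r\<^sup>* \<subseteq> r'\<^sup>*" using assms(1) by (rule rtrancl_mono)
  then have "{y. (x, y) \<in> r\<^sup>*} \<subseteq> {y. (x, y) \<in> r'\<^sup>*}" for x by blast
  then show ?thesis using assms(2) infinite_super unfolding inf_comp_def by blast
qed

lemma infinite_bond_cluster_iff:
  "(\<exists>C\<in>bond_clusters d \<omega>. infinite C) \<longleftrightarrow> inf_comp d (rel (\<lambda>(x, y). {x, y}) (arcs d) \<omega>)"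
proof -
  have r: "{(u, v). u \<in> Zd d \<and> v \<in> Zd d \<and> {u, v} \<in> {e \<in> Zd_edges d. \<omega> e}}
      = rel (\<lambda>(x, y). {x, y}) (arcs d) \<omega>"
    by (auto simp: rel_def arcs_def edge_iff)
  show ?thesis unfolding bond_clusters_def Bex_def components_of_iff r inf_comp_def by blast
qed

lemma infinite_component_iff:
  assumes "V \<subseteq> Zd d"
  shows "(\<exists>C\<in>components_of V (Zd_edges d). infinite C)
     \<longleftrightarrow> inf_comp d {(u, v) \<in> arcs d. u \<in> V \<and> v \<in> V}"
proof -
  let ?r = "{(u, v) \<in> arcs d. u \<in> V \<and> v \<in> V}"
  have r: "{(u, v). u \<in> V \<and> v \<in> V \<and> {u, v} \<in> Zd_edges d} = ?r"
    by (auto simp: arcs_def)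
  \<comment> \<open>Starting points outside \<open>V\<close> reach only themselves, so letting the
    start range over the whole lattice adds no infinite set.\<close>
  have "x \<in> V" if inf: "infinite {y. (x, y) \<in> ?r\<^sup>*}" for x
  proof (rule ccontr)
    assume x: "x \<notin> V"
    have "y = x" if "(x, y) \<in> ?r\<^sup>*" for y
      using that
    proof (cases rule: converse_rtranclE)
      case (step z)
      then show ?thesis using x by simp
    qed simp
    then have "{y. (x, y) \<in> ?r\<^sup>*} \<subseteq> {x}" by blast
    then show False using inf finite_subset by blast
  qed
  then show ?thesis unfolding Bex_def components_of_iff r inf_comp_def using assms by blast
qed

lemma succ_in_Zd: "r \<subseteq> arcs d \<Longrightarrow> x \<in> Zd d \<Longrightarrow> {y. (x, y) \<in> r\<^sup>*} \<subseteq> Zd d"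
proof
  fix y assume "r \<subseteq> arcs d" "x \<in> Zd d" "y \<in> {y. (x, y) \<in> r\<^sup>*}"
  then have "(x, y) \<in> r\<^sup>*" "x \<in> Zd d" by auto
  then show "y \<in> Zd d"
    by (induction rule: rtrancl_induct) (use \<open>r \<subseteq> arcs d\<close> arcs_subset in auto)
qed

lemma sets_succ:
  assumes r: "\<And>\<omega>. r \<omega> \<subseteq> arcs d"
    and m: "\<And>u v. {\<omega> \<in> space M. (u, v) \<in> r \<omega>} \<in> sets M"
  shows "{\<omega> \<in> space M. (x, y) \<in> (r \<omega>)\<^sup>*} \<in> sets M"
  by (rule sets_rtrancl[OF countable_Zd _ m]) (use r arcs_subset in blast)

lemma sets_inf_comp:
  assumes r: "\<And>\<omega>. r \<omega> \<subseteq> arcs d"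
    and m: "\<And>u v. {\<omega> \<in> space M. (u, v) \<in> r \<omega>} \<in> sets M"
  shows "{\<omega> \<in> space M. inf_comp d (r \<omega>)} \<in> sets M"
proof -
  have "infinite {y. (x, y) \<in> (r \<omega>)\<^sup>*} \<longleftrightarrow> (\<forall>n. \<exists>y\<in>Zd d - cube d n. (x, y) \<in> (r \<omega>)\<^sup>*)"
    if x: "x \<in> Zd d" for x \<omega>
  proof
    assume inf: "infinite {y. (x, y) \<in> (r \<omega>)\<^sup>*}"
    show "\<forall>n. \<exists>y\<in>Zd d - cube d n. (x, y) \<in> (r \<omega>)\<^sup>*"
    proof
      fix n
      have "\<not> {y. (x, y) \<in> (r \<omega>)\<^sup>*} \<subseteq> cube d n" using inf finite_cube finite_subset by blast
      then show "\<exists>y\<in>Zd d - cube d n. (x, y) \<in> (r \<omega>)\<^sup>*" using succ_in_Zd[OF r x] by blast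
    qed
  next
    assume "\<forall>n. \<exists>y\<in>Zd d - cube d n. (x, y) \<in> (r \<omega>)\<^sup>*"
    then have "\<not> {y. (x, y) \<in> (r \<omega>)\<^sup>*} \<subseteq> cube d n" for n by blast
    then show "infinite {y. (x, y) \<in> (r \<omega>)\<^sup>*}" using finite_subset_cube succ_in_Zd[OF r x] by blast
  qed
  then have "inf_comp d (r \<omega>) \<longleftrightarrow> (\<exists>x\<in>Zd d. \<forall>n. \<exists>y\<in>Zd d - cube d n. (x, y) \<in> (r \<omega>)\<^sup>*)" for \<omega>
    unfolding inf_comp_def by blast
  then show ?thesis
    by (simp only:) (intro sets.sets_Collect_countable_Ex' sets.sets_Collect_countable_All
        sets_succ[OF r m] countable_Zd countable_Diff)
qed

text \<open>The events that level n is reached from \<open>R\<close> decrease in n, so a bound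
  uniform in n passes to their intersection. There the finitely many starts reach unbounded levels,
  hence one of them reaches infinitely many vertices.\<close>

lemma inf_comp_prob_pos:
  assumes M: "prob_space M" and r: "\<And>\<omega>. r \<omega> \<subseteq> arcs d"
    and m: "\<And>u v. {\<omega> \<in> space M. (u, v) \<in> r \<omega>} \<in> sets M"
    and R: "finite R" "R \<subseteq> Zd d" and c: "0 < c"
    and E: "\<And>n. \<exists>S\<in>sets M. c \<le> measure M S \<and>
       (\<forall>\<omega>\<in>S. \<exists>x\<in>R. \<exists>y. (x, y) \<in> (r \<omega>)\<^sup>* \<and> (n::nat) \<le> lev y)"
  shows "0 < measure M {\<omega> \<in> space M. inf_comp d (r \<omega>)}"
proof -
  interpret prob_space M by fact
  define A where "A n = {\<omega> \<in> space M. \<exists>x\<in>R. \<exists>y\<in>{y \<in> Zd d. n \<le> lev y}. (x, y) \<in> (r \<omega>)\<^sup>*}" for n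
  have cz: "countable {y \<in> Zd d. n \<le> lev y}" for n
    by (rule countable_subset[OF _ countable_Zd]) auto
  have As: "A n \<in> sets M" for n
    unfolding A_def
    by (intro sets.sets_Collect_countable_Ex' sets_succ[OF r m] countable_finite[OF R(1)] cz)
  have "c \<le> measure M (A n)" for n
  proof -
    obtain S where S: "S \<in> sets M" "c \<le> measure M S"
      "\<And>\<omega>. \<omega> \<in> S \<Longrightarrow> \<exists>x\<in>R. \<exists>y. (x, y) \<in> (r \<omega>)\<^sup>* \<and> n \<le> lev y"
      using E[of n] by blast
    have "S \<subseteq> A n"
    proof
      fix \<omega> assume w: "\<omega> \<in> S"
      then obtain x y where "x \<in> R" "(x, y) \<in> (r \<omega>)\<^sup>*" "n \<le> lev y" using S(3) by blast
      moreover have "y \<in> Zd d" using succ_in_Zd[OF r, of x \<omega>] calculation R(2) by blast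
      ultimately show "\<omega> \<in> A n" using sets.sets_into_space[OF S(1)] w unfolding A_def by blast
    qed
    then have "measure M S \<le> measure M (A n)" using As by (rule finite_measure_mono)
    then show ?thesis using S(2) by simp
  qed
  moreover have "(\<lambda>n. measure M (A n)) \<longlonglongrightarrow> measure M (\<Inter>n. A n)"
  proof (rule finite_Lim_measure_decseq)
    show "decseq A" unfolding decseq_def A_def by (intro allI impI subsetI) (auto, blast dest: order_trans)
  qed (use As in auto)
  ultimately have c': "c \<le> measure M (\<Inter>n. A n)"
    by (meson LIMSEQ_le_const)
  have "(\<Inter>n. A n) \<subseteq> {\<omega> \<in> space M. inf_comp d (r \<omega>)}"
  proof
    fix \<omega> assume w: "\<omega> \<in> (\<Inter>n. A n)"
    then have sp: "\<omega> \<in> space M" unfolding A_def by blast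
    have "\<exists>x\<in>R. infinite {y. (x, y) \<in> (r \<omega>)\<^sup>*}"
    proof (rule ccontr)
      assume "\<not> ?thesis"
      then have fin: "finite (\<Union>x\<in>R. {y. (x, y) \<in> (r \<omega>)\<^sup>*})" using R(1) by blast
      define N where "N = Suc (Max (lev ` (\<Union>x\<in>R. {y. (x, y) \<in> (r \<omega>)\<^sup>*})))"
      have "\<omega> \<in> A N" using w by blast
      then obtain x y where "x \<in> R" "(x, y) \<in> (r \<omega>)\<^sup>*" "N \<le> lev y" unfolding A_def by blast
      moreover have "lev y \<le> Max (lev ` (\<Union>x\<in>R. {y. (x, y) \<in> (r \<omega>)\<^sup>*}))"
        using calculation fin by (intro Max_ge) blast+
      ultimately show False by (simp add: N_def)
    qed
    then show "\<omega> \<in> {\<omega> \<in> space M. inf_comp d (r \<omega>)}" using sp R(2) unfolding inf_comp_def by blast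
  qed
  then have "measure M (\<Inter>n. A n) \<le> measure M {\<omega> \<in> space M. inf_comp d (r \<omega>)}"
    by (rule finite_measure_mono) (rule sets_inf_comp[OF r m])
  then show ?thesis using c c' by linarith
qed

section \<open>The second moment of a walk graded by levels\<close>

locale layered_walk =
  fixes C :: "'c set" and \<mu> :: "'c \<Rightarrow> real" and nxt :: "'s \<Rightarrow> 'c \<Rightarrow> 's"
    and It :: "'s \<Rightarrow> 'c \<Rightarrow> 'i set" and lev :: "'s \<Rightarrow> nat" and ilev :: "'i \<Rightarrow> nat"
  assumes finite_C: "finite C" and \<mu>_nonneg: "\<And>c. c \<in> C \<Longrightarrow> 0 \<le> \<mu> c" and sum_\<mu>: "(\<Sum>c\<in>C. \<mu> c) = 1"
    and lev_nxt: "\<And>s c. c \<in> C \<Longrightarrow> lev (nxt s c) = Suc (lev s)"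
    and finite_It: "\<And>s c. finite (It s c)"
    and ilev_It: "\<And>s c i. c \<in> C \<Longrightarrow> i \<in> It s c \<Longrightarrow> ilev i = lev s"
begin

primrec items :: "'s \<Rightarrow> 'c list \<Rightarrow> 'i set" where
  "items s [] = {}"
| "items s (c # cs) = It s c \<union> items (nxt s c) cs"

definition words :: "nat \<Rightarrow> 'c list set" where
  "words n = {xs. set xs \<subseteq> C \<and> length xs = n}"

definition wt :: "'c list \<Rightarrow> real" where
  "wt xs = prod_list (map \<mu> xs)"

text \<open>For starts of equal level this is the expectation of \<open>w\<close> to the number of
  common items of two independent n-step walks, written as a recursion on the first steps of
  both.\<close>

primrec H :: "real \<Rightarrow> nat \<Rightarrow> 's \<Rightarrow> 's \<Rightarrow> real" where
  "H w 0 s s' = 1"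
| "H w (Suc n) s s' = (\<Sum>c\<in>C. \<Sum>c'\<in>C. \<mu> c * \<mu> c' * (w ^ card (It s c \<inter> It s' c') * H w n (nxt s c) (nxt s' c')))"

lemma words_Suc: "words (Suc n) = (\<lambda>(c, xs). c # xs) ` (C \<times> words n)"
  by (auto simp: words_def image_iff length_Suc_conv)

lemma sum_words_Suc: "(\<Sum>xs\<in>words (Suc n). f xs) = (\<Sum>c\<in>C. \<Sum>xs\<in>words n. f (c # xs))"
  unfolding words_Suc by (subst sum.reindex) (auto simp: inj_on_def sum.cartesian_product intro!: sum.cong)

lemma finite_words: "finite (words n)"
  unfolding words_def using finite_lists_length_eq[OF finite_C] by simp

lemma sum_wt: "(\<Sum>xs\<in>words n. wt xs) = 1"
proof (induction n)
  case 0
  have "words 0 = {[]}" by (auto simp: words_def)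
  then show ?case by (simp add: wt_def)
next
  case (Suc n)
  have "(\<Sum>xs\<in>words (Suc n). wt xs) = (\<Sum>c\<in>C. \<mu> c * (\<Sum>xs\<in>words n. wt xs))"
    unfolding sum_words_Suc by (simp add: wt_def sum_distrib_left)
  then show ?case using Suc sum_\<mu> by simp
qed

lemma wt_nonneg: "xs \<in> words n \<Longrightarrow> 0 \<le> wt xs"
  unfolding wt_def words_def by (rule prod_list_nonneg) (use \<mu>_nonneg in auto)

lemma finite_items: "finite (items s xs)"
  by (induction xs arbitrary: s) (auto simp: finite_It)

lemma ilev_items: "i \<in> items s xs \<Longrightarrow> set xs \<subseteq> C \<Longrightarrow> lev s \<le> ilev i"
proof (induction xs arbitrary: s)
  case (Cons c cs)
  then show ?case using ilev_It[of c i s] lev_nxt[of c s] by fastforce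
qed simp

text \<open>An item carries the level at which it is used, so walks started at equal levels can
  share items only at the same step. The overlap is then a sum over steps, and the double sum
  satisfies the recursion of \<open>H\<close>.\<close>

lemma second_moment_eq_H:
  assumes "lev s = lev s'"
  shows "(\<Sum>xs\<in>words n. \<Sum>ys\<in>words n. wt xs * wt ys * w ^ card (items s xs \<inter> items s' ys)) = H w n s s'"
  using assms
proof (induction n arbitrary: s s')
  case 0
  have "words 0 = {[]}" by (auto simp: words_def)
  then show ?case by (simp add: wt_def)
next
  case (Suc n)
  have step: "card (items s (c # xs) \<inter> items s' (c' # ys))
      = card (It s c \<inter> It s' c') + card (items (nxt s c) xs \<inter> items (nxt s' c') ys)"
    if "c \<in> C" "c' \<in> C" "xs \<in> words n" "ys \<in> words n" for c c' xs ys
  proof -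
    have C: "set xs \<subseteq> C" "set ys \<subseteq> C" using that by (auto simp: words_def)
    have a: "ilev i = lev s" if "i \<in> It s c \<union> It s' c'" for i
      using that ilev_It \<open>c \<in> C\<close> \<open>c' \<in> C\<close> Suc.prems by auto
    have b: "Suc (lev s) \<le> ilev i" if "i \<in> items (nxt s c) xs \<union> items (nxt s' c') ys" for i
      using that ilev_items[OF _ C(1), of i "nxt s c"] ilev_items[OF _ C(2), of i "nxt s' c'"]
        lev_nxt[OF \<open>c \<in> C\<close>] lev_nxt[OF \<open>c' \<in> C\<close>] Suc.prems by auto
    have "i \<notin> items (nxt s c) xs \<union> items (nxt s' c') ys" if "i \<in> It s c \<union> It s' c'" for i
      using a[OF that] b[of i] by linarith
    then have "items s (c # xs) \<inter> items s' (c' # ys)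
        = (It s c \<inter> It s' c') \<union> (items (nxt s c) xs \<inter> items (nxt s' c') ys)"
      "(It s c \<inter> It s' c') \<inter> (items (nxt s c) xs \<inter> items (nxt s' c') ys) = {}"
      by auto
    then show ?thesis by (simp only:) (intro card_Un_disjoint finite_Int disjI1 finite_It finite_items, simp)
  qed
  have "(\<Sum>xs\<in>words (Suc n). \<Sum>ys\<in>words (Suc n). wt xs * wt ys * w ^ card (items s xs \<inter> items s' ys))
    = (\<Sum>c\<in>C. \<Sum>xs\<in>words n. \<Sum>c'\<in>C. \<Sum>ys\<in>words n.
        \<mu> c * \<mu> c' * w ^ card (It s c \<inter> It s' c') *
          (wt xs * wt ys * w ^ card (items (nxt s c) xs \<inter> items (nxt s' c') ys)))"
    unfolding sum_words_Suc
    by (intro sum.cong refl) (simp add: step power_add wt_def del: items.simps)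
  also have "\<dots> = (\<Sum>c\<in>C. \<Sum>c'\<in>C. \<Sum>xs\<in>words n. \<Sum>ys\<in>words n.
        \<mu> c * \<mu> c' * w ^ card (It s c \<inter> It s' c') *
          (wt xs * wt ys * w ^ card (items (nxt s c) xs \<inter> items (nxt s' c') ys)))"
    by (intro sum.cong refl sum.swap)
  also have "\<dots> = H w (Suc n) s s'"
    using Suc.IH[of "nxt s c" "nxt s' c'" for c c'] Suc.prems
    by (simp add: sum_distrib_left[symmetric] lev_nxt mult.assoc)
  finally show ?case .
qed

text \<open>\<open>\<phi>\<close> sends abstract items to percolation variables. Its injectivity
  preserves the sizes of overlaps, so a bound on \<open>H\<close> at \<open>1 / p\<close> is the
  second moment bound for open paths.\<close>

lemma prob_open_word:
  assumes p: "0 < p" "p \<le> 1" and X: "H (1 / p) n s s \<le> X" "0 < X"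
    and inj: "inj_on \<phi> (\<Union>xs\<in>words n. items s xs)"
    and sub: "\<And>xs. xs \<in> words n \<Longrightarrow> \<phi> ` items s xs \<subseteq> I"
  shows "1 / X \<le> measure (Pi\<^sub>M I (\<lambda>_. bern p))
     {\<omega> \<in> I \<rightarrow>\<^sub>E UNIV. \<exists>xs\<in>words n. \<forall>i\<in>items s xs. \<omega> (\<phi> i)}"
proof -
  have c: "card (\<phi> ` items s xs \<inter> \<phi> ` items s ys) = card (items s xs \<inter> items s ys)"
    if "xs \<in> words n" "ys \<in> words n" for xs ys
  proof -
    have "\<phi> ` items s xs \<inter> \<phi> ` items s ys = \<phi> ` (items s xs \<inter> items s ys)"
      using that by (intro inj_on_image_Int[OF inj, symmetric]) auto
    then show ?thesis using that by (simp add: card_image inj_on_subset[OF inj] le_infI1 UN_upper)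
  qed
  have "1 / X \<le> measure (Pi\<^sub>M I (\<lambda>_. bern p))
     {\<omega> \<in> I \<rightarrow>\<^sub>E UNIV. \<exists>xs\<in>words n. \<forall>i\<in>\<phi> ` items s xs. \<omega> i}"
  proof (rule second_moment_bound[where \<mu>=wt])
    show "(\<Sum>g\<in>words n. \<Sum>h\<in>words n. wt g * wt h * (1 / p) ^ card (\<phi> ` items s g \<inter> \<phi> ` items s h)) \<le> X"
      using X(1) second_moment_eq_H[of s s "1 / p" n] by (simp add: c cong: sum.cong)
  qed (use p X sub in \<open>auto simp: finite_words sum_wt wt_nonneg finite_items\<close>)
  then show ?thesis by simp
qed

lemma sets_open_word:
  assumes sub: "\<And>xs. xs \<in> words n \<Longrightarrow> \<phi> ` items s xs \<subseteq> I"
  shows "{\<omega> \<in> I \<rightarrow>\<^sub>E UNIV. \<exists>xs\<in>words n. \<forall>i\<in>items s xs. \<omega> (\<phi> i)} \<in> sets (Pi\<^sub>M I (\<lambda>_. bern p))"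
proof (rule sets_finitely_determined)
  show "finite (\<Union>xs\<in>words n. \<phi> ` items s xs)" using finite_words finite_items by blast
  show "(\<Union>xs\<in>words n. \<phi> ` items s xs) \<subseteq> I" using sub by blast
qed auto

end

section \<open>Walks with lateral steps\<close>

definition step :: "(nat \<Rightarrow> nat) \<Rightarrow> nat \<Rightarrow> (nat \<Rightarrow> nat)" where
  "step u i = u(i := Suc (u i))"

text \<open>The probability that two independent uniform oriented walks started at \<open>u\<close>
  and \<open>u'\<close> are at the same point after exactly h steps.\<close>

primrec Phi :: "nat \<Rightarrow> nat \<Rightarrow> (nat \<Rightarrow> nat) \<Rightarrow> (nat \<Rightarrow> nat) \<Rightarrow> real" where
  "Phi k 0 u u' = of_bool (u = u')"
| "Phi k (Suc h) u u' = (\<Sum>i<k. \<Sum>j<k. Phi k h (step u i) (step u' j)) / real k ^ 2"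

lemma step_neq [simp]: "step u i \<noteq> u" "u \<noteq> step u i"
  by (auto simp: step_def fun_eq_iff)

lemma step_inj [simp]: "step u i = step u j \<longleftrightarrow> i = j"
  by (auto simp: step_def fun_eq_iff split: if_splits)

lemma sum_step: "i < k \<Longrightarrow> sum (step u i) {..<k} = Suc (sum u {..<k})"
proof -
  assume "i < k"
  then have "sum (step u i) {..<k} = (\<Sum>j<k. u j + (if j = i then 1 else 0))"
    by (intro sum.cong) (auto simp: step_def)
  also have "\<dots> = Suc (sum u {..<k})" using \<open>i < k\<close> by (simp add: sum.distrib)
  finally show ?thesis .
qed

lemma Phi_Suc_shift: "(\<Sum>h=1..n. Phi k (Suc h) u u') \<le> (\<Sum>h=1..Suc n. Phi k h u u') - Phi k 1 u u'"
proof -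
  have "(\<Sum>h=1..Suc n. Phi k h u u') = Phi k 1 u u' + (\<Sum>h=Suc 1..Suc n. Phi k h u u')"
    by (subst sum.atLeast_Suc_atMost) auto
  also have "(\<Sum>h=Suc 1..Suc n. Phi k h u u') = (\<Sum>h=1..n. Phi k (Suc h) u u')"
    by (rule sum.shift_bounds_cl_Suc_ivl)
  finally show ?thesis by simp
qed

lemma sum_swap3:
  "(\<Sum>h\<in>A. \<Sum>i\<in>B. \<Sum>j\<in>C. f h i j) = (\<Sum>i\<in>B. \<Sum>j\<in>C. \<Sum>h\<in>A. f h i j)"
  by (subst sum.swap, intro sum.cong refl, rule sum.swap)

text \<open>One step draws a lateral move from \<open>L\<close>, with the move 0 meaning none, and
  then a uniform oriented direction. Drawing both at once makes the height grow by exactly one per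
  step although lateral edges do not raise it.\<close>

locale lateral_walk =
  fixes k :: nat and L :: "'y::ab_group_add set" and lam :: "'y \<Rightarrow> real"
  assumes k: "0 < k" and L: "finite L" "0 \<in> L" and lam: "\<And>e. 0 \<le> lam e" "(\<Sum>e\<in>L. lam e) = 1"
begin

definition nx :: "(nat \<Rightarrow> nat) \<times> 'y \<Rightarrow> nat \<times> 'y \<Rightarrow> (nat \<Rightarrow> nat) \<times> 'y" where
  "nx s c = (step (fst s) (fst c), snd s + snd c)"

definition prob_of :: "nat \<times> 'y \<Rightarrow> real" where
  "prob_of c = lam (snd c) / real k"

text \<open>Bonds are unordered pairs, so a lateral bond crossed by two walks in opposite directions
  counts as shared.\<close>

definition bonds :: "(nat \<Rightarrow> nat) \<times> 'y \<Rightarrow> nat \<times> 'y \<Rightarrow> ((nat \<Rightarrow> nat) \<times> 'y) set set" where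
  "bonds s c = insert {(fst s, snd s + snd c), nx s c}
     (if snd c = 0 then {} else {{s, (fst s, snd s + snd c)}})"

definition height :: "(nat \<Rightarrow> nat) \<times> 'y \<Rightarrow> nat" where
  "height s = sum (fst s) {..<k}"

text \<open>The lower endpoint is taken so that a lateral bond and the oriented bond following it
  carry the level of the same step.\<close>

definition bond_height :: "((nat \<Rightarrow> nat) \<times> 'y) set \<Rightarrow> nat" where
  "bond_height b = Min (height ` b)"

sublocale layered_walk "{..<k} \<times> L" prob_of nx bonds height bond_height
proof
  show "finite ({..<k} \<times> L)" using L by simp
  show "0 \<le> prob_of c" for c using lam by (simp add: prob_of_def)
  show "(\<Sum>c\<in>{..<k} \<times> L. prob_of c) = 1"
    using lam(2) k by (simp add: prob_of_def sum.cartesian_product' flip: sum_divide_distrib)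
  show "height (nx s c) = Suc (height s)" if "c \<in> {..<k} \<times> L" for s c
    using that by (auto simp: height_def nx_def sum_step)
  show "finite (bonds s c)" for s c by (simp add: bonds_def)
  show "bond_height b = height s" if "c \<in> {..<k} \<times> L" "b \<in> bonds s c" for s c b
  proof -
    have "height (nx s c) = Suc (height s)" using that by (auto simp: height_def nx_def sum_step)
    then show ?thesis using that
      by (auto simp: bonds_def bond_height_def height_def split: if_splits)
  qed
qed

lemma sum_pairs:
  "(\<Sum>c\<in>{..<k} \<times> L. \<Sum>c'\<in>{..<k} \<times> L. prob_of c * prob_of c' * F c c')
   = (\<Sum>i<k. \<Sum>j<k. \<Sum>e\<in>L. \<Sum>f\<in>L. lam e * lam f * F (i, e) (j, f)) / real k ^ 2"
proof -
  have "(\<Sum>c\<in>{..<k} \<times> L. \<Sum>c'\<in>{..<k} \<times> L. prob_of c * prob_of c' * F c c')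
    = (\<Sum>i<k. \<Sum>e\<in>L. \<Sum>j<k. \<Sum>f\<in>L. lam e * lam f * F (i, e) (j, f) / real k ^ 2)"
    by (simp add: sum.cartesian_product' prob_of_def power2_eq_square)
  also have "\<dots> = (\<Sum>i<k. \<Sum>j<k. \<Sum>e\<in>L. \<Sum>f\<in>L. lam e * lam f * F (i, e) (j, f) / real k ^ 2)"
    by (intro sum.cong refl sum.swap)
  finally show ?thesis by (simp add: sum_divide_distrib)
qed

text \<open>The probability that two walks at lateral displacement \<open>\<eta>\<close> are brought
  to the same lateral position by their next lateral moves.\<close>

definition coll :: "'y \<Rightarrow> real" where
  "coll \<eta> = (\<Sum>e\<in>L. \<Sum>f\<in>L. lam e * lam f * of_bool (e = \<eta> + f))"

text \<open>The probability that two walks at displacement \<open>\<eta>\<close> exchange their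
  lateral positions; for nonzero \<open>\<eta>\<close> they then cross one bond in opposite
  directions.\<close>

definition cross :: "'y \<Rightarrow> real" where
  "cross \<eta> = (\<Sum>e\<in>L. \<Sum>f\<in>L. lam e * lam f * of_bool (e = \<eta> \<and> f = - \<eta>))"

lemma sum_lam_pair: "(\<Sum>e\<in>L. \<Sum>f\<in>L. lam e * lam f) = 1"
  using lam(2) by (simp flip: sum_product)

text \<open>Every bond of this step has its lower endpoint over the current oriented coordinate, and
  equal heights prevent an upper endpoint of one walk from lying over the current coordinate of the
  other.\<close>

lemma bonds_disjoint:
  assumes "sum u {..<k} = sum u' {..<k}" "u \<noteq> u'" "i < k" "j < k"
  shows "bonds (u, y) (i, e) \<inter> bonds (u', y') (j, f) = {}"
proof -
  have "step u i \<noteq> u'" "step u' j \<noteq> u"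
    using sum_step[OF assms(3), of u] sum_step[OF assms(4), of u'] assms(1) by auto
  then show ?thesis using assms(2)
    by (auto simp: bonds_def nx_def doubleton_eq_iff)
qed

lemma card_bonds_same:
  "card (bonds (u, y) (i, e) \<inter> bonds (u, y) (j, f))
     \<le> (if e = f then of_bool (i = j) + of_bool (e \<noteq> 0) else 0)"
proof (cases "e = f")
  case False
  then have "bonds (u, y) (i, e) \<inter> bonds (u, y) (j, f) = {}"
    by (auto simp: bonds_def nx_def doubleton_eq_iff)
  then show ?thesis by simp
next
  case True
  have "bonds (u, y) (i, e) \<inter> bonds (u, y) (j, f)
     \<subseteq> (if i = j then {{(u, y + e), (step u i, y + e)}} else {}) \<union> (if e = 0 then {} else {{(u, y), (u, y + e)}})"
    using True by (auto simp: bonds_def nx_def doubleton_eq_iff)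
  then have "card (bonds (u, y) (i, e) \<inter> bonds (u, y) (j, f))
     \<le> card ((if i = j then {{(u, y + e), (step u i, y + e)}} else {}) \<union> (if e = 0 then {} else {{(u, y), (u, y + e)}}))"
    by (intro card_mono) auto
  also have "\<dots> \<le> of_bool (i = j) + of_bool (e \<noteq> 0)"
    by (rule order_trans[OF card_Un_le]) auto
  finally show ?thesis using True by simp
qed

text \<open>From different lateral positions the walks share either the upward bond, after meeting,
  or the lateral bond, by exchanging positions. Walks that exchange positions do not meet, so at
  most one bond is shared.\<close>

lemma card_bonds_diff:
  assumes "y \<noteq> y'"
  shows "card (bonds (u, y) (i, e) \<inter> bonds (u, y') (j, f))
     \<le> of_bool (i = j \<and> e = y' - y + f) + of_bool (e = y' - y \<and> f = - (y' - y))"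
    "card (bonds (u, y) (i, e) \<inter> bonds (u, y') (j, f)) \<le> 1"
proof -
  let ?U = "if i = j \<and> e = y' - y + f then {{(u, y + e), (step u i, y + e)}} else {}"
  let ?V = "if e = y' - y \<and> f = - (y' - y) then {{(u, y), (u, y + e)}} else {}"
  have sub: "bonds (u, y) (i, e) \<inter> bonds (u, y') (j, f) \<subseteq> ?U \<union> ?V"
    using assms by (auto simp: bonds_def nx_def doubleton_eq_iff algebra_simps)
  then have c: "card (bonds (u, y) (i, e) \<inter> bonds (u, y') (j, f)) \<le> card (?U \<union> ?V)"
    by (intro card_mono) auto
  also have "\<dots> \<le> of_bool (i = j \<and> e = y' - y + f) + of_bool (e = y' - y \<and> f = - (y' - y))"
    by (rule order_trans[OF card_Un_le]) auto
  finally show "card (bonds (u, y) (i, e) \<inter> bonds (u, y') (j, f))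
     \<le> of_bool (i = j \<and> e = y' - y + f) + of_bool (e = y' - y \<and> f = - (y' - y))" .
  have "\<not> (e = y' - y + f \<and> e = y' - y \<and> f = - (y' - y))" using assms by auto
  then have "card (?U \<union> ?V) \<le> 1" by auto
  with c show "card (bonds (u, y) (i, e) \<inter> bonds (u, y') (j, f)) \<le> 1" by linarith
qed

lemma sum_diag: "(\<Sum>i<k. \<Sum>j<k. if i = j then a else b) = real k * a + (real k ^ 2 - real k) * (b::real)"
proof -
  have "(\<Sum>j<k. if i = j then a else b) = a + (real k - 1) * b" if "i < k" for i
  proof -
    have "(\<Sum>j<k. if i = j then a else b) = (\<Sum>j<k. b + (if i = j then a - b else 0))"
      by (intro sum.cong) auto
    then show ?thesis using that by (simp add: sum.distrib algebra_simps)
  qed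
  then have "(\<Sum>i<k. \<Sum>j<k. if i = j then a else b) = (\<Sum>i<k. a + (real k - 1) * b)"
    by (intro sum.cong) auto
  then show ?thesis by (simp add: algebra_simps power2_eq_square)
qed

text \<open>D0 and D1 bound the excess that a single level contributes to H when the walks are at the same
  vertex and when only their oriented coordinates agree; X and Z are the bounds propagated for H in
  general and after the oriented coordinates have separated.\<close>

lemma H_bound:
  fixes w X Z D0 D1 Y1 z1 b2 Gu Gz :: real
  defines "\<kappa> \<equiv> D1 + (D0 - D1) * Y1"
  defines "S1 \<equiv> (\<Sum>e\<in>L - {0}. lam e ^ 2)"
  assumes w: "1 \<le> w" and XZ: "0 \<le> X" "0 \<le> Z" and D: "0 \<le> D1" "D1 \<le> D0"
    and coll: "\<And>\<eta>. coll \<eta> \<le> Y1" "\<And>\<eta>. \<eta> \<noteq> 0 \<Longrightarrow> coll \<eta> \<le> z1" and cross: "\<And>\<eta>. \<eta> \<noteq> 0 \<Longrightarrow> cross \<eta> \<le> b2"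
    and D0: "(lam 0 ^ 2 * (w - 1) + S1 * (w ^ 2 - 1)) * X / k + (1 - 1 / k) * S1 * (w - 1) * Z \<le> D0"
    and D1: "(w - 1) * X * (z1 / k + b2) \<le> D1"
    and Gu: "\<And>n u u'. (\<Sum>h=1..n. Phi k h u u') \<le> Gu"
    and Gz: "\<And>n u u'. u \<noteq> u' \<Longrightarrow> (\<Sum>h=1..n. Phi k h u u') \<le> Gz"
    and X: "1 + D0 + \<kappa> * Gu \<le> X" and Z: "1 + \<kappa> * Gz \<le> Z"
  shows "H w n s s \<le> X"
proof -
  \<comment> \<open>The excess charged to the current pair of states: \<open>D0\<close> at a common
    vertex, \<open>D1\<close> when only the oriented coordinates agree, and 0 otherwise.\<close>
  define g where "g u y u' y' = of_bool (u = u') * (D1 + of_bool (y = y') * (D0 - D1))"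
    for u u' :: "nat \<Rightarrow> nat" and y y' :: 'y
  have "coll 0 \<ge> 0" unfolding coll_def by (intro sum_nonneg mult_nonneg_nonneg lam) auto
  then have Y1: "0 \<le> Y1" using coll(1)[of 0] by linarith
  have \<kappa>: "0 \<le> \<kappa>" using D Y1 by (simp add: \<kappa>_def)
  have k1: "1 / real k \<le> 1" using k by simp
  \<comment> \<open>Averaged over the lateral moves that lead to it, the excess of a pair with equal
    oriented coordinates is at most \<open>\<kappa>\<close>: the lateral positions coincide with
    probability at most \<open>Y1\<close>, whatever they were before.\<close>
  have inner_g: "(\<Sum>e\<in>L. \<Sum>f\<in>L. lam e * lam f * g v (y + e) v' (y' + f)) \<le> of_bool (v = v') * \<kappa>" for v v' y y'
  proof -
    have c: "(y + e = y' + f) = (e = (y' - y) + f)" for e f :: 'y by (auto simp: algebra_simps)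
    have "(\<Sum>e\<in>L. \<Sum>f\<in>L. lam e * lam f * g v (y + e) v' (y' + f))
        = of_bool (v = v') * (D1 * (\<Sum>e\<in>L. \<Sum>f\<in>L. lam e * lam f) + (D0 - D1) * coll (y' - y))"
    proof (cases "v = v'")
      case True
      have "(\<Sum>e\<in>L. \<Sum>f\<in>L. lam e * lam f * g v (y + e) v' (y' + f))
         = (\<Sum>e\<in>L. \<Sum>f\<in>L. D1 * (lam e * lam f) + (D0 - D1) * (lam e * lam f * of_bool (e = (y' - y) + f)))"
        using True by (intro sum.cong refl) (simp add: g_def c algebra_simps)
      also have "\<dots> = D1 * (\<Sum>e\<in>L. \<Sum>f\<in>L. lam e * lam f) + (D0 - D1) * coll (y' - y)"
        unfolding sum.distrib coll_def sum_distrib_left by (rule refl)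
      finally show ?thesis using True by simp
    qed (simp add: g_def)
    also have "\<dots> \<le> of_bool (v = v') * \<kappa>"
      unfolding \<kappa>_def sum_lam_pair using coll(1)[of "y' - y"] D
      by (intro mult_left_mono) (auto intro!: mult_left_mono)
    finally show ?thesis .
  qed
  have Phi1: "Phi k 1 u u' = (\<Sum>i<k. \<Sum>j<k. of_bool (step u i = step u' j)) / real k ^ 2" for u u' by simp
  \<comment> \<open>The right side adds to 1 the excess of the current pair and
    \<open>\<kappa>\<close> for each expected later collision of the oriented coordinates. It is
    preserved by the recursion of \<open>H\<close>.\<close>
  have main: "H w n (u, y) (u', y') \<le> 1 + g u y u' y' + \<kappa> * (\<Sum>h=1..n. Phi k h u u')"
    if "sum u {..<k} = sum u' {..<k}" for u y u' y'
    using that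
  proof (induction n arbitrary: u y u' y')
    case 0
    then show ?case using D by (simp add: g_def)
  next
    case (Suc n)
    \<comment> \<open>The bootstrap: the induction hypothesis and the assumptions on
      \<open>X\<close> and \<open>Z\<close> bound \<open>H\<close> at time n uniformly, and these
      bounds control the factor behind the shared bonds in the next step.\<close>
    have HX: "H w n (v, z) (v', z') \<le> X" if "sum v {..<k} = sum v' {..<k}" for v z v' z'
    proof -
      have "g v z v' z' \<le> D0" using D by (auto simp: g_def)
      moreover have "\<kappa> * (\<Sum>h=1..n. Phi k h v v') \<le> \<kappa> * Gu" using Gu \<kappa> by (rule mult_left_mono)
      ultimately show ?thesis using Suc.IH[OF that, of z z'] X by linarith
    qed
    have HZ: "H w n (v, z) (v', z') \<le> Z" if "sum v {..<k} = sum v' {..<k}" "v \<noteq> v'" for v z v' z'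
    proof -
      have "g v z v' z' = 0" using that by (auto simp: g_def)
      moreover have "\<kappa> * (\<Sum>h=1..n. Phi k h v v') \<le> \<kappa> * Gz" using Gz[OF that(2)] \<kappa> by (rule mult_left_mono)
      ultimately show ?thesis using Suc.IH[OF that(1), of z z'] Z by linarith
    qed
    have ss: "sum (step u i) {..<k} = sum (step u' j) {..<k}" if "i < k" "j < k" for i j
      using that Suc.prems by (simp add: sum_step)
    define T where "T i j e f = w ^ card (bonds (u, y) (i, e) \<inter> bonds (u', y') (j, f)) - 1" for i j e f
    define h where "h i j e f = H w n (step u i, y + e) (step u' j, y' + f)" for i j e f
    have T0: "0 \<le> T i j e f" for i j e f unfolding T_def using w by simp
    \<comment> \<open>Writing \<open>w ^ c = 1 + T\<close>, the 1 gives the average of later values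
      and \<open>T\<close> the excess caused by the bonds shared in this step.\<close>
    have split: "H w (Suc n) (u, y) (u', y')
      = (\<Sum>i<k. \<Sum>j<k. \<Sum>e\<in>L. \<Sum>f\<in>L. lam e * lam f * h i j e f) / real k ^ 2
      + (\<Sum>i<k. \<Sum>j<k. \<Sum>e\<in>L. \<Sum>f\<in>L. lam e * lam f * (T i j e f * h i j e f)) / real k ^ 2"
      unfolding H.simps sum_pairs
      by (simp add: nx_def T_def h_def algebra_simps flip: sum.distrib add_divide_distrib)
    have "(\<Sum>i<k. \<Sum>j<k. \<Sum>e\<in>L. \<Sum>f\<in>L. lam e * lam f * h i j e f)
        \<le> (\<Sum>i<k. \<Sum>j<k. 1 + of_bool (step u i = step u' j) * \<kappa>
             + \<kappa> * (\<Sum>h=1..n. Phi k h (step u i) (step u' j)))"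
    proof (intro sum_mono)
      fix i j assume ij: "i \<in> {..<k}" "j \<in> {..<k}"
      let ?P = "\<Sum>h=1..n. Phi k h (step u i) (step u' j)"
      have "(\<Sum>e\<in>L. \<Sum>f\<in>L. lam e * lam f * h i j e f)
        \<le> (\<Sum>e\<in>L. \<Sum>f\<in>L. lam e * lam f * (1 + g (step u i) (y + e) (step u' j) (y' + f) + \<kappa> * ?P))"
        unfolding h_def using ij Suc.IH[OF ss] by (intro sum_mono mult_left_mono mult_nonneg_nonneg lam) auto
      also have "\<dots> = (\<Sum>e\<in>L. \<Sum>f\<in>L. lam e * lam f) * (1 + \<kappa> * ?P)
          + (\<Sum>e\<in>L. \<Sum>f\<in>L. lam e * lam f * g (step u i) (y + e) (step u' j) (y' + f))"
      proof -
        have "lam e * lam f * (1 + G + \<kappa> * ?P) = lam e * lam f * (1 + \<kappa> * ?P) + lam e * lam f * G" for e f G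
          by (simp add: algebra_simps)
        then show ?thesis by (simp only: sum.distrib sum_distrib_right[symmetric])
      qed
      also have "\<dots> \<le> 1 * (1 + \<kappa> * ?P) + of_bool (step u i = step u' j) * \<kappa>"
        unfolding sum_lam_pair using inner_g by (rule add_left_mono)
      finally show "(\<Sum>e\<in>L. \<Sum>f\<in>L. lam e * lam f * h i j e f)
        \<le> 1 + of_bool (step u i = step u' j) * \<kappa> + \<kappa> * ?P" by simp
    qed
    also have "\<dots> = real k ^ 2 + \<kappa> * (\<Sum>i<k. \<Sum>j<k. of_bool (step u i = step u' j))
        + \<kappa> * (\<Sum>h=1..n. \<Sum>i<k. \<Sum>j<k. Phi k h (step u i) (step u' j))"
      by (subst sum_swap3) (simp only: sum.distrib sum_distrib_left[symmetric] sum_distrib_right[symmetric],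
          simp add: power2_eq_square mult.commute)
    finally have first: "(\<Sum>i<k. \<Sum>j<k. \<Sum>e\<in>L. \<Sum>f\<in>L. lam e * lam f * h i j e f) / real k ^ 2
        \<le> 1 + \<kappa> * Phi k 1 u u' + \<kappa> * (\<Sum>h=1..n. Phi k (Suc h) u u')"
      using k unfolding Phi1 by (simp add: divide_right_mono field_simps sum_divide_distrib[symmetric])
    have second: "(\<Sum>i<k. \<Sum>j<k. \<Sum>e\<in>L. \<Sum>f\<in>L. lam e * lam f * (T i j e f * h i j e f)) / real k ^ 2
        \<le> g u y u' y'"
    proof -
      consider "u \<noteq> u'" | "u = u'" "y = y'" | "u = u'" "y \<noteq> y'" by blast
      then show ?thesis
      proof cases
        case 1
        have "T i j e f = 0" if "i < k" "j < k" for i j e f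
          unfolding T_def using bonds_disjoint[OF Suc.prems 1 that] by simp
        then show ?thesis using 1 by (simp add: g_def)
      next
        case 2
        have "(\<Sum>e\<in>L. \<Sum>f\<in>L. lam e * lam f * (T i j e f * h i j e f))
            \<le> (if i = j then (lam 0 ^ 2 * (w - 1) + S1 * (w ^ 2 - 1)) * X else S1 * (w - 1) * Z)"
          if ij: "i < k" "j < k" for i j
        proof -
          \<comment> \<open>Equal oriented directions leave the walks over a common coordinate,
            where the general bound \<open>X\<close> is used; different directions separate them, so
            \<open>Z\<close> applies.\<close>
          let ?Y = "if i = j then X else Z"
          have "T i j e f * h i j e f \<le> (if f = e then (w ^ (of_bool (i = j) + of_bool (e \<noteq> 0)) - 1) * ?Y else 0)" for e f
          proof -
            have "T i j e f \<le> w ^ (if e = f then of_bool (i = j) + of_bool (e \<noteq> 0) else 0) - 1"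
              unfolding T_def using card_bonds_same[of u y i e j f] 2 w
              by (simp add: power_increasing)
            then have "T i j e f * ?Y \<le> (w ^ (if e = f then of_bool (i = j) + of_bool (e \<noteq> 0) else 0) - 1) * ?Y"
              using XZ by (intro mult_right_mono) auto
            moreover have "h i j e f \<le> ?Y"
              unfolding h_def using HX[OF ss[OF ij]] HZ[OF ss[OF ij]] 2 by auto
            then have "T i j e f * h i j e f \<le> T i j e f * ?Y" using T0 by (rule mult_left_mono)
            ultimately have "T i j e f * h i j e f
               \<le> (w ^ (if e = f then of_bool (i = j) + of_bool (e \<noteq> 0) else 0) - 1) * ?Y"
              by linarith
            then show ?thesis by auto
          qed
          then have "(\<Sum>e\<in>L. \<Sum>f\<in>L. lam e * lam f * (T i j e f * h i j e f))
            \<le> (\<Sum>e\<in>L. \<Sum>f\<in>L. lam e * lam f * (if f = e then (w ^ (of_bool (i = j) + of_bool (e \<noteq> 0)) - 1) * ?Y else 0))"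
            by (intro sum_mono mult_left_mono mult_nonneg_nonneg lam) auto
          also have "\<dots> = (\<Sum>e\<in>L. lam e ^ 2 * (w ^ (of_bool (i = j) + of_bool (e \<noteq> 0)) - 1) * ?Y)"
            using L(1) by (simp add: if_distrib[of "\<lambda>x. _ * x"] power2_eq_square mult.assoc cong: if_cong)
          also have "\<dots> = lam 0 ^ 2 * (w ^ of_bool (i = j) - 1) * ?Y
              + (\<Sum>e\<in>L - {0}. lam e ^ 2 * (w ^ (of_bool (i = j) + 1) - 1) * ?Y)"
            by (subst sum.remove[OF L]) simp
          also have "\<dots> = (if i = j then (lam 0 ^ 2 * (w - 1) + S1 * (w ^ 2 - 1)) * X else S1 * (w - 1) * Z)"
            unfolding S1_def by (simp only: sum_distrib_right[symmetric]) (simp add: power2_eq_square algebra_simps)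
          finally show ?thesis .
        qed
        then have "(\<Sum>i<k. \<Sum>j<k. \<Sum>e\<in>L. \<Sum>f\<in>L. lam e * lam f * (T i j e f * h i j e f))
          \<le> (\<Sum>i<k. \<Sum>j<k. if i = j then (lam 0 ^ 2 * (w - 1) + S1 * (w ^ 2 - 1)) * X else S1 * (w - 1) * Z)"
          by (intro sum_mono) auto
        also have "\<dots> = ((lam 0 ^ 2 * (w - 1) + S1 * (w ^ 2 - 1)) * X / k + (1 - 1 / k) * S1 * (w - 1) * Z) * real k ^ 2"
          unfolding sum_diag using k by (simp add: field_simps power2_eq_square)
        also have "\<dots> \<le> D0 * real k ^ 2" using D0 by (intro mult_right_mono) auto
        finally show ?thesis using 2 k by (simp add: g_def field_simps)
      next
        case 3
        let ?\<eta> = "y' - y"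
        have \<eta>: "?\<eta> \<noteq> 0" using 3 by simp
        have t: "T i j e f * h i j e f
            \<le> (w - 1) * X * (of_bool (i = j) * of_bool (e = ?\<eta> + f) + of_bool (e = ?\<eta> \<and> f = - ?\<eta>))"
          if ij: "i < k" "j < k" for i j e f
        proof -
          let ?c = "card (bonds (u, y) (i, e) \<inter> bonds (u', y') (j, f))"
          have c: "?c \<le> of_bool (i = j \<and> e = ?\<eta> + f) + of_bool (e = ?\<eta> \<and> f = - ?\<eta>)" "?c \<le> 1"
            using card_bonds_diff[OF 3(2), of u i e j f] 3(1) by auto
          \<comment> \<open>With at most one shared bond the power of \<open>w\<close> is linear in
            the number of shared bonds.\<close>
          have "T i j e f = (w - 1) * real ?c" using c(2) unfolding T_def by (cases ?c) auto
          also have "\<dots> \<le> (w - 1) * (of_bool (i = j) * of_bool (e = ?\<eta> + f) + of_bool (e = ?\<eta> \<and> f = - ?\<eta>))"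
          proof (rule mult_left_mono)
            have "real ?c \<le> real (of_bool (i = j \<and> e = ?\<eta> + f) + of_bool (e = ?\<eta> \<and> f = - ?\<eta>))"
              using c(1) by (simp only: of_nat_le_iff)
            then show "real ?c \<le> of_bool (i = j) * of_bool (e = ?\<eta> + f) + of_bool (e = ?\<eta> \<and> f = - ?\<eta>)"
              by (simp only: of_nat_add of_nat_of_bool of_bool_conj of_nat_mult)
          qed (use w in simp)
          finally have a: "T i j e f \<le> (w - 1) * (of_bool (i = j) * of_bool (e = ?\<eta> + f) + of_bool (e = ?\<eta> \<and> f = - ?\<eta>))" .
          have "h i j e f \<le> X" unfolding h_def using HX[OF ss[OF ij]] .
          then have "T i j e f * h i j e f \<le> T i j e f * X" using T0 by (rule mult_left_mono)
          also have "\<dots> \<le> (w - 1) * (of_bool (i = j) * of_bool (e = ?\<eta> + f) + of_bool (e = ?\<eta> \<and> f = - ?\<eta>)) * X"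
            using a XZ(1) by (rule mult_right_mono)
          finally show ?thesis by (simp add: mult_ac)
        qed
        have "(\<Sum>e\<in>L. \<Sum>f\<in>L. lam e * lam f * (T i j e f * h i j e f))
            \<le> (w - 1) * X * (if i = j then z1 + b2 else b2)" if ij: "i < k" "j < k" for i j
        proof -
          have "(\<Sum>e\<in>L. \<Sum>f\<in>L. lam e * lam f * (T i j e f * h i j e f))
            \<le> (\<Sum>e\<in>L. \<Sum>f\<in>L. lam e * lam f *
               ((w - 1) * X * (of_bool (i = j) * of_bool (e = ?\<eta> + f) + of_bool (e = ?\<eta> \<and> f = - ?\<eta>))))"
            using t[OF ij] by (intro sum_mono mult_left_mono mult_nonneg_nonneg lam) auto
          also have "\<dots> = (w - 1) * X * (of_bool (i = j) * coll ?\<eta> + cross ?\<eta>)"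
          proof -
            have "lam e * lam f * ((w - 1) * X * (b * c + c')) = (w - 1) * X * (b * (lam e * lam f * c) + lam e * lam f * c')"
              for e f b c c' by (simp add: algebra_simps)
            then show ?thesis unfolding coll_def cross_def
              by (simp only: sum_distrib_left[symmetric] sum.distrib)
          qed
          also have "\<dots> \<le> (w - 1) * X * (if i = j then z1 + b2 else b2)"
            using coll(2)[OF \<eta>] cross[OF \<eta>] w XZ by (intro mult_left_mono) auto
          finally show ?thesis .
        qed
        then have "(\<Sum>i<k. \<Sum>j<k. \<Sum>e\<in>L. \<Sum>f\<in>L. lam e * lam f * (T i j e f * h i j e f))
          \<le> (\<Sum>i<k. \<Sum>j<k. (w - 1) * X * (if i = j then z1 + b2 else b2))"
          by (intro sum_mono) auto
        also have "\<dots> = (w - 1) * X * (\<Sum>i<k. \<Sum>j<k. if i = j then z1 + b2 else b2)"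
          by (simp add: sum_distrib_left)
        also have "\<dots> = ((w - 1) * X * (z1 / k + b2)) * real k ^ 2"
          unfolding sum_diag using k by (simp add: field_simps power2_eq_square)
        also have "\<dots> \<le> D1 * real k ^ 2" using D1 by (intro mult_right_mono) auto
        finally show ?thesis using 3 k by (simp add: g_def field_simps)
      qed
    qed
    have "\<kappa> * Phi k 1 u u' + \<kappa> * (\<Sum>h=1..n. Phi k (Suc h) u u') \<le> \<kappa> * (\<Sum>h=1..Suc n. Phi k h u u')"
      using mult_left_mono[OF Phi_Suc_shift[where n=n and k=k and u=u and u'=u'] \<kappa>] by (simp add: algebra_simps)
    then show ?case unfolding split using first second by linarith
  qed
  obtain u y where s: "s = (u, y)" by (cases s)
  have "\<kappa> * (\<Sum>h=1..n. Phi k h u u) \<le> \<kappa> * Gu" using Gu \<kappa> by (rule mult_left_mono)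
  then show ?thesis using main[of u u y y] X by (simp add: s g_def)
qed

end

section \<open>Purely oriented walks for site percolation\<close>

locale oriented_walk =
  fixes k :: nat
  assumes k: "0 < k"
begin

text \<open>The item of a step is the vertex entered, which lies one level above the state left;
  hence the subtraction in the level of an item. The starting vertex is not an item.\<close>

sublocale layered_walk "{..<k}" "\<lambda>_. 1 / real k" step "\<lambda>u i. {step u i}"
  "\<lambda>u. sum u {..<k}" "\<lambda>u. sum u {..<k} - 1"
  by unfold_locales (use k in \<open>auto simp: sum_step\<close>)

text \<open>The bond argument with one kind of collision: entering a common vertex adds
  \<open>w - 1\<close> times the remaining value, hence at most \<open>(w - 1) * X\<close>, and the
  expected number of collisions is at most \<open>Gu\<close>.\<close>

lemma H_bound:
  fixes w X Gu :: real
  assumes w: "1 \<le> w" and X: "0 \<le> X" "1 + (w - 1) * X * Gu \<le> X"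
    and Gu: "\<And>n u u'. (\<Sum>h=1..n. Phi k h u u') \<le> Gu"
  shows "H w n u u' \<le> X"
proof -
  have main: "H w n u u' \<le> 1 + (w - 1) * X * (\<Sum>h=1..n. Phi k h u u')" for u u'
  proof (induction n arbitrary: u u')
    case (Suc n)
    have HX: "H w n v v' \<le> X" for v v'
      using Suc[of v v'] mult_left_mono[OF Gu[of v v' n], of "(w - 1) * X"] w X by simp
    let ?P = "\<lambda>i j. \<Sum>h=1..n. Phi k h (step u i) (step u' j)"
    have term_le: "w ^ card ({step u i} \<inter> {step u' j}) * H w n (step u i) (step u' j)
       \<le> 1 + (w - 1) * X * ?P i j + (w - 1) * X * of_bool (step u i = step u' j)" for i j
    proof (cases "step u i = step u' j")
      case True
      have "w ^ card ({step u i} \<inter> {step u' j}) * H w n (step u i) (step u' j)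
          = H w n (step u i) (step u' j) + (w - 1) * H w n (step u i) (step u' j)"
        using True by (simp add: algebra_simps)
      also have "\<dots> \<le> (1 + (w - 1) * X * ?P i j) + (w - 1) * X"
        using Suc HX w by (intro add_mono mult_left_mono) auto
      finally show ?thesis using True by simp
    next
      case False
      then show ?thesis using Suc by simp
    qed
    have "H w (Suc n) u u' = (\<Sum>i<k. \<Sum>j<k. w ^ card ({step u i} \<inter> {step u' j}) * H w n (step u i) (step u' j)) / real k ^ 2"
      by (simp add: power2_eq_square sum_divide_distrib)
    also have "\<dots> \<le> (\<Sum>i<k. \<Sum>j<k. 1 + (w - 1) * X * ?P i j + (w - 1) * X * of_bool (step u i = step u' j)) / real k ^ 2"
      by (intro divide_right_mono sum_mono term_le) auto
    also have "(\<Sum>i<k. \<Sum>j<k. 1 + (w - 1) * X * ?P i j + (w - 1) * X * of_bool (step u i = step u' j))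
      = real k ^ 2 + (w - 1) * X * (\<Sum>h=1..n. \<Sum>i<k. \<Sum>j<k. Phi k h (step u i) (step u' j))
        + (w - 1) * X * (\<Sum>i<k. \<Sum>j<k. of_bool (step u i = step u' j))"
      by (subst sum_swap3) (simp only: sum.distrib sum_distrib_left[symmetric], simp add: power2_eq_square)
    also have "\<dots> / real k ^ 2 = 1 + (w - 1) * X * (\<Sum>h=1..n. Phi k (Suc h) u u') + (w - 1) * X * Phi k 1 u u'"
      using k by (simp add: field_simps sum_divide_distrib[symmetric])
    also have "\<dots> \<le> 1 + (w - 1) * X * (\<Sum>h=1..Suc n. Phi k h u u')"
    proof -
      have "0 \<le> (w - 1) * X" using w X(1) by simp
      from mult_left_mono[OF Phi_Suc_shift[where n=n and k=k and u=u and u'=u'] this]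
      show ?thesis unfolding right_diff_distrib by linarith
    qed
    finally show ?case .
  qed simp
  show ?thesis using main[of u u'] mult_left_mono[OF Gu[of u u' n], of "(w - 1) * X"] w X by simp
qed

end

section \<open>Collision probabilities of oriented walks\<close>

definition comps :: "nat \<Rightarrow> nat \<Rightarrow> (nat \<Rightarrow> nat) set" where
  "comps k h = {a. (\<forall>i\<ge>k. a i = 0) \<and> sum a {..<k} = h}"

definition multinom :: "nat \<Rightarrow> nat \<Rightarrow> (nat \<Rightarrow> nat) \<Rightarrow> real" where
  "multinom k h a = fact h / (\<Prod>i<k. fact (a i))"

definition mpmf :: "nat \<Rightarrow> nat \<Rightarrow> (nat \<Rightarrow> nat) \<Rightarrow> real" where
  "mpmf k h a = multinom k h a / real k ^ h"

text \<open>The collision probability at time h of two independent walks with a common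
  start.\<close>

definition meet :: "nat \<Rightarrow> nat \<Rightarrow> real" where
  "meet k h = (\<Sum>a\<in>comps k h. mpmf k h a ^ 2)"

lemma finite_comps: "finite (comps k h)"
proof (rule finite_subset)
  show "comps k h \<subseteq> {a. \<forall>i. (i \<in> {..<k} \<longrightarrow> a i \<in> {..h}) \<and> (i \<notin> {..<k} \<longrightarrow> a i = 0)}"
  proof (intro subsetI CollectI allI conjI impI)
    fix a i assume "a \<in> comps k h" "i \<in> {..<k}"
    then show "a i \<in> {..h}" using member_le_sum[of i "{..<k}" a] by (simp add: comps_def)
  qed (simp add: comps_def)
  show "finite {a :: nat \<Rightarrow> nat. \<forall>i. (i \<in> {..<k} \<longrightarrow> a i \<in> {..h}) \<and> (i \<notin> {..<k} \<longrightarrow> a i = 0)}"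
    by (rule finite_set_of_finite_funs) auto
qed

lemma mpmf_nonneg: "0 \<le> mpmf k h a"
  by (simp add: mpmf_def multinom_def prod_nonneg)

lemma step_in_comps: "a \<in> comps k h \<Longrightarrow> i < k \<Longrightarrow> step a i \<in> comps k (Suc h)"
  by (auto simp: comps_def sum_step) (simp add: step_def)

lemma prod_fact_step: "i < k \<Longrightarrow> (\<Prod>j<k. fact (step a i j) :: real) = real (Suc (a i)) * (\<Prod>j<k. fact (a j))"
proof -
  assume i: "i < k"
  have "(\<Prod>j<k. fact (step a i j) :: real) = (\<Prod>j<k. (if j = i then real (Suc (a i)) else 1) * fact (a j))"
    by (intro prod.cong) (auto simp: step_def)
  then show ?thesis using i by (simp add: prod.distrib)
qed

definition unstep :: "(nat \<Rightarrow> nat) \<Rightarrow> nat \<Rightarrow> (nat \<Rightarrow> nat)" where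
  "unstep b i = b(i := b i - 1)"

lemma step_unstep: "0 < b i \<Longrightarrow> step (unstep b i) i = b" and unstep_step: "unstep (step b i) i = b"
  by (auto simp: step_def unstep_def)

lemma unstep_in_comps:
  assumes "b \<in> comps k (Suc h)" "i < k" "0 < b i"
  shows "unstep b i \<in> comps k h"
  using assms sum_step[OF assms(2), of "unstep b i"] step_unstep[of b i]
  by (auto simp: comps_def) (auto simp: unstep_def)

text \<open>Decomposition by the last step. The new factor of the factorial is the sum of the
  coordinates of \<open>b\<close>, which distributes over the possible predecessors.\<close>

lemma mpmf_Suc:
  assumes b: "b \<in> comps k (Suc h)"
  shows "mpmf k (Suc h) b = (\<Sum>i | i < k \<and> 0 < b i. mpmf k h (unstep b i)) / real k"
proof -
  have t: "fact h / (\<Prod>j<k. fact (unstep b i j)) = fact h * real (b i) / (\<Prod>j<k. fact (b j))"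
    if "i < k" "0 < b i" for i
  proof -
    have "(\<Prod>j<k. fact (b j) :: real) = real (b i) * (\<Prod>j<k. fact (unstep b i j))"
      using prod_fact_step[OF that(1), of "unstep b i"] step_unstep[of b i] that(2)
      by (simp add: unstep_def)
    then show ?thesis using that(2) by simp
  qed
  have "(\<Sum>i | i < k \<and> 0 < b i. mpmf k h (unstep b i))
      = (\<Sum>i | i < k \<and> 0 < b i. fact h * real (b i) / (\<Prod>j<k. fact (b j)) / real k ^ h)"
    by (intro sum.cong refl) (simp add: mpmf_def multinom_def t)
  also have "\<dots> = (\<Sum>i<k. fact h * real (b i) / (\<Prod>j<k. fact (b j)) / real k ^ h)"
    by (intro sum.mono_neutral_left) auto
  also have "\<dots> = fact h * real (\<Sum>i<k. b i) / (\<Prod>j<k. fact (b j)) / real k ^ h"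
    by (simp add: sum_distrib_left sum_divide_distrib)
  also have "\<dots> = fact (Suc h) / (\<Prod>j<k. fact (b j)) / real k ^ h"
    using b by (simp add: comps_def algebra_simps)
  finally show ?thesis by (simp add: mpmf_def multinom_def mult.commute)
qed

lemma sum_comps_Suc:
  "(\<Sum>b\<in>comps k (Suc h). mpmf k (Suc h) b * \<psi> b) = (\<Sum>i<k. \<Sum>a\<in>comps k h. mpmf k h a * \<psi> (step a i)) / real k"
proof -
  have "(\<Sum>b\<in>comps k (Suc h). mpmf k (Suc h) b * \<psi> b)
      = (\<Sum>b\<in>comps k (Suc h). \<Sum>i | i < k \<and> 0 < b i. mpmf k h (unstep b i) * \<psi> b) / real k"
    by (simp add: mpmf_Suc sum_distrib_right sum_divide_distrib)
  also have "(\<Sum>b\<in>comps k (Suc h). \<Sum>i | i < k \<and> 0 < b i. mpmf k h (unstep b i) * \<psi> b)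
      = (\<Sum>(b, i)\<in>(SIGMA b:comps k (Suc h). {i. i < k \<and> 0 < b i}). mpmf k h (unstep b i) * \<psi> b)"
    by (rule sum.Sigma) (auto simp: finite_comps)
  also have "\<dots> = (\<Sum>(i, a)\<in>{..<k} \<times> comps k h. mpmf k h a * \<psi> (step a i))"
    by (rule sum.reindex_bij_witness[where i="\<lambda>(i, a). (step a i, i)" and j="\<lambda>(b, i). (i, unstep b i)"])
      (auto simp: unstep_step step_unstep step_in_comps unstep_in_comps, simp add: step_def)
  also have "\<dots> = (\<Sum>i<k. \<Sum>a\<in>comps k h. mpmf k h a * \<psi> (step a i))"
    by (rule sum.cartesian_product[symmetric])
  finally show ?thesis .
qed

lemma comps_0: "comps k 0 = {\<lambda>_. 0}"
  by (auto simp: comps_def fun_eq_iff) (meson lessThan_iff not_le_imp_less)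

lemma sum_mpmf: "0 < k \<Longrightarrow> (\<Sum>a\<in>comps k h. mpmf k h a) = 1"
proof (induction h)
  case 0
  then show ?case by (simp add: comps_0 mpmf_def multinom_def)
next
  case (Suc h)
  then show ?case using sum_comps_Suc[of k h "\<lambda>_. 1"] by simp
qed

definition shift :: "(nat \<Rightarrow> nat) \<Rightarrow> (nat \<Rightarrow> nat) \<Rightarrow> (nat \<Rightarrow> nat)" where
  "shift u a = (\<lambda>i. u i + a i)"

lemma shift_step: "shift (step u i) a = shift u (step a i)"
  by (auto simp: shift_def step_def)

lemma shift_inj: "shift u a = shift u b \<longleftrightarrow> a = b"
  by (auto simp: shift_def fun_eq_iff)

lemma Phi_eq_sum:
  "Phi k h u u' = (\<Sum>a\<in>comps k h. \<Sum>b\<in>comps k h. mpmf k h a * (mpmf k h b * of_bool (shift u a = shift u' b)))"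
proof (induction h arbitrary: u u')
  case 0
  then show ?case by (simp add: comps_0 mpmf_def multinom_def shift_def)
next
  case (Suc h)
  have "(\<Sum>a\<in>comps k (Suc h). \<Sum>b\<in>comps k (Suc h). mpmf k (Suc h) a * (mpmf k (Suc h) b * of_bool (shift u a = shift u' b)))
     = (\<Sum>a\<in>comps k (Suc h). mpmf k (Suc h) a * (\<Sum>b\<in>comps k (Suc h). mpmf k (Suc h) b * of_bool (shift u a = shift u' b)))"
    by (simp add: sum_distrib_left)
  also have "\<dots> = (\<Sum>i<k. \<Sum>a\<in>comps k h. mpmf k h a *
      ((\<Sum>j<k. \<Sum>b\<in>comps k h. mpmf k h b * of_bool (shift u (step a i) = shift u' (step b j))) / real k)) / real k"
    unfolding sum_comps_Suc by (rule refl)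
  also have "\<dots> = (\<Sum>i<k. \<Sum>a\<in>comps k h. \<Sum>j<k. \<Sum>b\<in>comps k h. mpmf k h a *
      (mpmf k h b * of_bool (shift u (step a i) = shift u' (step b j)))) / real k ^ 2"
    by (simp add: sum_distrib_left sum_divide_distrib power2_eq_square)
  also have "\<dots> = (\<Sum>i<k. \<Sum>j<k. \<Sum>a\<in>comps k h. \<Sum>b\<in>comps k h. mpmf k h a *
      (mpmf k h b * of_bool (shift u (step a i) = shift u' (step b j)))) / real k ^ 2"
    by (intro arg_cong2[where f="(/)"] refl sum.cong sum.swap)
  also have "\<dots> = Phi k (Suc h) u u'" by (simp add: Suc shift_step)
  finally show ?case by simp
qed

text \<open>Two walks collide most often when they start together, by the inequality of arithmetic and
  geometric means.\<close>

lemma Phi_le_meet: "Phi k h u u' \<le> meet k h"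
proof -
  have one: "(\<Sum>b\<in>comps k h. of_bool (shift u a = shift u' b)) \<le> (1 :: real)" for u u' a
  proof (cases "\<exists>b\<in>comps k h. shift u a = shift u' b")
    case True
    then obtain b where b: "b \<in> comps k h" "shift u a = shift u' b" by blast
    have "(\<Sum>c\<in>comps k h. of_bool (shift u a = shift u' c)) = (\<Sum>c\<in>comps k h. if c = b then 1 else 0 :: real)"
      using b(2) by (intro sum.cong) (auto simp: shift_inj)
    then show ?thesis using b(1) finite_comps by simp
  qed simp
  have "Phi k h u u' \<le> (\<Sum>a\<in>comps k h. \<Sum>b\<in>comps k h.
      (mpmf k h a ^ 2 / 2 + mpmf k h b ^ 2 / 2) * of_bool (shift u a = shift u' b))"
    unfolding Phi_eq_sum
  proof (intro sum_mono)
    fix a b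
    have "mpmf k h a * mpmf k h b \<le> mpmf k h a ^ 2 / 2 + mpmf k h b ^ 2 / 2"
      using sum_squares_bound[of "mpmf k h a" "mpmf k h b"] by simp
    then show "mpmf k h a * (mpmf k h b * of_bool (shift u a = shift u' b))
       \<le> (mpmf k h a ^ 2 / 2 + mpmf k h b ^ 2 / 2) * of_bool (shift u a = shift u' b)" by simp
  qed
  also have "\<dots> = (\<Sum>a\<in>comps k h. \<Sum>b\<in>comps k h. mpmf k h a ^ 2 / 2 * of_bool (shift u a = shift u' b))
      + (\<Sum>a\<in>comps k h. \<Sum>b\<in>comps k h. mpmf k h b ^ 2 / 2 * of_bool (shift u a = shift u' b))"
    by (simp only: distrib_right sum.distrib)
  also have "(\<Sum>a\<in>comps k h. \<Sum>b\<in>comps k h. mpmf k h b ^ 2 / 2 * of_bool (shift u a = shift u' b))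
      = (\<Sum>b\<in>comps k h. \<Sum>a\<in>comps k h. mpmf k h b ^ 2 / 2 * of_bool (shift u' b = shift u a))"
    by (subst sum.swap) (simp only: eq_commute[of "shift u _"])
  also have "(\<Sum>a\<in>comps k h. \<Sum>b\<in>comps k h. mpmf k h a ^ 2 / 2 * of_bool (shift u a = shift u' b)) + \<dots>
      \<le> (\<Sum>a\<in>comps k h. mpmf k h a ^ 2 / 2 * 1) + (\<Sum>a\<in>comps k h. mpmf k h a ^ 2 / 2 * 1)"
    unfolding sum_distrib_left[symmetric] using one
    by (intro add_mono sum_mono mult_left_mono) auto
  also have "\<dots> = meet k h" by (simp add: meet_def flip: sum_divide_distrib)
  finally show ?thesis .
qed

lemma meet_nonneg: "0 \<le> meet k h"
  by (simp add: meet_def sum_nonneg)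

text \<open>A sum of squares of probabilities is at most the largest probability times the total
  mass 1.\<close>

lemma meet_le:
  assumes "0 < k" "\<And>a. a \<in> comps k h \<Longrightarrow> mpmf k h a \<le> c"
  shows "meet k h \<le> c"
proof -
  have "meet k h \<le> (\<Sum>a\<in>comps k h. c * mpmf k h a)"
    unfolding meet_def power2_eq_square using assms(2) mpmf_nonneg by (intro sum_mono mult_right_mono) auto
  also have "\<dots> = c" using sum_mpmf[OF assms(1)] by (simp flip: sum_distrib_left)
  finally show ?thesis .
qed

section \<open>Peaks of the multinomial law and tails of collision sums\<close>

lemma mpmf_le_fact: "mpmf k h a \<le> fact h / real k ^ h"
proof -
  have "1 \<le> (\<Prod>i<k. fact (a i) :: real)" by (rule prod_ge_1) simp
  then have "(fact h :: real) / (\<Prod>i<k. fact (a i)) \<le> fact h" by (simp add: divide_le_eq mult_le_cancel_left1)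
  then show ?thesis unfolding mpmf_def multinom_def by (rule divide_right_mono) simp
qed

text \<open>The probability that after \<open>j * k\<close> steps every direction has been used
  exactly j times.\<close>

definition peak :: "nat \<Rightarrow> nat \<Rightarrow> real" where
  "peak k j = fact (j * k) / (fact j ^ k * real k ^ (j * k))"

text \<open>For fixed j the ratio of \<open>fact a\<close> to \<open>j ^ a\<close> does not increase
  up to \<open>a = j\<close> and does not decrease afterwards, so \<open>a = j\<close> is a
  minimum.\<close>

lemma fact_power_le: "fact j * j ^ a \<le> fact a * (j :: nat) ^ j"
proof (cases "a \<ge> j")
  case True
  then show ?thesis
  proof (induction a rule: dec_induct)
    case (step a)
    have "fact j * j ^ a * j \<le> fact a * j ^ j * Suc a"
      using step by (intro mult_le_mono[of "fact j * j ^ a" "fact a * j ^ j"]) auto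
    then show ?case by (simp add: algebra_simps)
  qed simp
next
  case False
  then have "a \<le> j" by simp
  then show ?thesis
  proof (induction a rule: inc_induct)
    case (step a)
    have "fact j * j ^ a * j \<le> fact a * j ^ j * Suc a" using step by (simp add: algebra_simps)
    also have "\<dots> \<le> fact a * j ^ j * j" using step by (intro mult_le_mono) auto
    finally show ?case using step by simp
  qed simp
qed

text \<open>Multiplying the coordinatewise inequalities, the powers of j cancel because the
  coordinates sum to \<open>j * k\<close>; so the balanced vector is a mode.\<close>

lemma mpmf_le_peak_exact:
  assumes a: "a \<in> comps k (j * k)" and j: "0 < j"
  shows "mpmf k (j * k) a \<le> peak k j"
proof -
  have "(\<Prod>i<k. fact j * j ^ a i) \<le> (\<Prod>i<k. fact (a i) * j ^ j)"
    by (intro prod_mono) (simp add: fact_power_le)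
  then have "fact j ^ k * j ^ (j * k) \<le> (\<Prod>i<k. fact (a i)) * j ^ (j * k)"
    using a by (simp add: prod.distrib comps_def power_mult flip: power_sum)
  then have "fact j ^ k \<le> (\<Prod>i<k. fact (a i) :: nat)" using j by simp
  then have "real (fact j ^ k) \<le> real (\<Prod>i<k. fact (a i))" by (simp only: of_nat_le_iff)
  then have le: "(fact j :: real) ^ k \<le> (\<Prod>i<k. fact (a i))" by simp
  then have "(fact (j * k) :: real) / (\<Prod>i<k. fact (a i)) \<le> fact (j * k) / fact j ^ k"
    by (intro divide_left_mono) (auto intro!: mult_pos_pos prod_pos)
  then have "mpmf k (j * k) a \<le> fact (j * k) / fact j ^ k / real k ^ (j * k)"
    unfolding mpmf_def multinom_def by (rule divide_right_mono) simp
  then show ?thesis by (simp add: peak_def)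
qed

text \<open>The largest probability does not increase with time: a later value is a sum of at most k
  earlier ones, divided by k.\<close>

lemma mpmf_le_peak:
  assumes j: "0 < j" and k: "0 < k" and n: "j * k \<le> n" and a: "a \<in> comps k n"
  shows "mpmf k n a \<le> peak k j"
  using n a
proof (induction n arbitrary: a rule: dec_induct)
  case base
  then show ?case using mpmf_le_peak_exact j by blast
next
  case (step n)
  have "0 \<le> peak k j" by (simp add: peak_def)
  then have "(\<Sum>i | i < k \<and> 0 < a i. mpmf k n (unstep a i)) \<le> (\<Sum>i<k. peak k j)"
    using step.IH[OF unstep_in_comps[OF step.prems]]
    by (intro order_trans[OF sum_mono[where g="\<lambda>_. peak k j"] sum_mono2]) auto
  then show ?case unfolding mpmf_Suc[OF step.prems] using k by (simp add: field_simps)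
qed

text \<open>The ratio of consecutive peaks is a product of k factors \<open>1 - x\<close>, each at
  most \<open>exp (- x)\<close>. The exponents add up to \<open>(k - 1) / (2 * (j + 1))\<close>,
  which is at least \<open>3 / (j + 1)\<close> once k is at least 7; this is the origin of the
  cube.\<close>

lemma peak_Suc_le:
  assumes k: "7 \<le> k"
  shows "peak k (Suc j) \<le> peak k j * ((real j + 1) / (real j + 2)) ^ 3"
proof -
  have k0: "0 < real k" using k by simp
  have "fact (Suc j * k) = fact (j * k) * (\<Prod>i<k. real (j * k + Suc i))"
  proof -
    have "fact (j * k + m) = fact (j * k) * (\<Prod>i<m. real (j * k + Suc i))" for m
      by (induction m) (simp_all add: algebra_simps)
    from this[of k] show ?thesis by (simp add: add.commute)
  qed
  then have eq: "peak k (Suc j) = peak k j * (\<Prod>i<k. real (j * k + Suc i) / (real (Suc j) * real k))"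
  proof -
    have "(\<Prod>i<k. real (j * k + Suc i) / (real (Suc j) * real k))
        = (\<Prod>i<k. real (j * k + Suc i)) / (real (Suc j) ^ k * real k ^ k)"
      by (simp only: prod_dividef prod_constant card_lessThan power_mult_distrib)
    moreover have "(fact (Suc j) :: real) ^ k = real (Suc j) ^ k * fact j ^ k"
      by (simp only: fact_Suc power_mult_distrib)
    moreover have "real k ^ (Suc j * k) = real k ^ k * real k ^ (j * k)" by (simp add: power_add)
    ultimately show ?thesis using \<open>fact (Suc j * k) = _\<close> unfolding peak_def
      by (simp only: times_divide_times_eq mult_ac)
  qed
  have "(\<Prod>i<k. real (j * k + Suc i) / (real (Suc j) * real k))
      \<le> (\<Prod>i<k. exp (- (real (k - Suc i) / (real (Suc j) * real k))))"
  proof (rule prod_mono)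
    fix i assume i: "i \<in> {..<k}"
    have "real (j * k + Suc i) = real (Suc j) * real k - real (k - Suc i)"
      using i by (simp add: of_nat_diff algebra_simps)
    then have "real (j * k + Suc i) / (real (Suc j) * real k) = 1 + - (real (k - Suc i) / (real (Suc j) * real k))"
      using k0 by (simp add: diff_divide_distrib)
    also have "\<dots> \<le> exp (- (real (k - Suc i) / (real (Suc j) * real k)))" by (rule exp_ge_add_one_self)
    finally show "0 \<le> real (j * k + Suc i) / (real (Suc j) * real k) \<and>
        real (j * k + Suc i) / (real (Suc j) * real k) \<le> exp (- (real (k - Suc i) / (real (Suc j) * real k)))"
      by simp
  qed
  also have "\<dots> = exp (- (\<Sum>i<k. real (k - Suc i)) / (real (Suc j) * real k))"
    by (simp add: exp_sum[symmetric] sum_negf sum_divide_distrib)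
  also have "(\<Sum>i<k. real (k - Suc i)) = real k * (real k - 1) / 2"
  proof -
    have "(\<Sum>i<k. real (k - Suc i)) = (\<Sum>i<k. real i)" by (rule sum.nat_diff_reindex)
    also have "\<dots> = real k * (real k - 1) / 2" by (induction k) (auto simp: field_simps)
    finally show ?thesis .
  qed
  also have "exp (- (real k * (real k - 1) / 2) / (real (Suc j) * real k)) \<le> exp (- (3 / (real j + 1)))"
  proof -
    have "(real k * (real k - 1) / 2) / (real (Suc j) * real k) = ((real k - 1) / 2) / (real j + 1)"
      using k0 by (simp add: add.commute)
    moreover have "3 / (real j + 1) \<le> ((real k - 1) / 2) / (real j + 1)"
      using k by (intro divide_right_mono) auto
    ultimately show ?thesis by simp
  qed
  also have "\<dots> = exp (- (1 / (real j + 1))) ^ 3"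
    by (simp add: exp_of_nat_mult[symmetric])
  also have "\<dots> \<le> ((real j + 1) / (real j + 2)) ^ 3"
  proof (rule power_mono)
    have "(real j + 2) / (real j + 1) = 1 + 1 / (real j + 1)" by (simp add: field_simps)
    also have "\<dots> \<le> exp (1 / (real j + 1))" by (rule exp_ge_add_one_self)
    finally show "exp (- (1 / (real j + 1))) \<le> (real j + 1) / (real j + 2)"
      by (simp add: exp_minus field_simps)
  qed simp
  finally have "(\<Prod>i<k. real (j * k + Suc i) / (real (Suc j) * real k)) \<le> ((real j + 1) / (real j + 2)) ^ 3" .
  then show ?thesis unfolding eq by (rule mult_left_mono) (simp add: peak_def)
qed

text \<open>By the cubic decay the sum is dominated by that of
  \<open>((j + 1) / (j + 1 + i)) ^ 3\<close>; the term \<open>(j + 1) / 2\<close> is the integral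
  bound for the summands after the first.\<close>

lemma sum_peak_le:
  assumes k: "7 \<le> k"
  shows "(\<Sum>i<n. peak k (j + i)) \<le> peak k j * (1 + (real j + 1) / 2)"
proof (induction n arbitrary: j)
  case 0
  then show ?case by (simp add: peak_def)
next
  case (Suc n)
  have "(\<Sum>i<Suc n. peak k (j + i)) = peak k j + (\<Sum>i<n. peak k (Suc j + i))"
    by (subst sum.lessThan_Suc_shift) simp
  also have "\<dots> \<le> peak k j + peak k (Suc j) * (1 + (real (Suc j) + 1) / 2)"
    using Suc[of "Suc j"] by simp
  also have "\<dots> \<le> peak k j + peak k j * ((real j + 1) / (real j + 2)) ^ 3 * (1 + (real (Suc j) + 1) / 2)"
    by (intro add_left_mono mult_right_mono peak_Suc_le k) auto
  also have "\<dots> = peak k j * (1 + ((real j + 1) / (real j + 2)) ^ 3 * ((real j + 4) / 2))"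
    by (simp add: algebra_simps)
  also have "\<dots> \<le> peak k j * (1 + (real j + 1) / 2)"
  proof (intro mult_left_mono add_left_mono)
    let ?x = "real j"
    have "(?x + 1) ^ 3 * (?x + 4) \<le> (?x + 1) * (?x + 2) ^ 3"
      by (simp add: power3_eq_cube algebra_simps)
    then show "((?x + 1) / (?x + 2)) ^ 3 * ((?x + 4) / 2) \<le> (?x + 1) / 2"
      by (simp add: power_divide divide_le_eq le_divide_eq)
  qed (simp add: peak_def)
  finally show ?case .
qed

lemma sum_blocks: "(\<Sum>n<m * k. f n) = (\<Sum>j<m. \<Sum>i<k. f (j * k + i))" for f :: "nat \<Rightarrow> real"
proof -
  have "(\<Sum>n<m * k. f n) = (\<Sum>j<m. \<Sum>n = j * k..<j * k + k. f n)"
    by (rule sum.nat_group[symmetric])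
  also have "\<dots> = (\<Sum>j<m. \<Sum>i<k. f (j * k + i))"
  proof (rule sum.cong[OF refl])
    fix j show "sum f {j * k..<j * k + k} = (\<Sum>i<k. f (j * k + i))"
      using sum.shift_bounds_nat_ivl[of f 0 "j * k" k] by (simp add: add.commute lessThan_atLeast0)
  qed
  finally show ?thesis .
qed

text \<open>Times are grouped into blocks of length k, and every collision probability in a block is
  at most the peak at its beginning.\<close>

lemma sum_meet_tail:
  assumes k: "7 \<le> k" and J: "0 < J"
  shows "(\<Sum>n<N. meet k (J * k + n)) \<le> real k * peak k J * (1 + (real J + 1) / 2)"
proof -
  have "(\<Sum>n<N. meet k (J * k + n)) \<le> (\<Sum>n<N * k. meet k (J * k + n))"
    using k by (intro sum_mono2) (auto simp: meet_nonneg intro: order_less_le_trans)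
  also have "\<dots> = (\<Sum>j<N. \<Sum>i<k. meet k (J * k + (j * k + i)))" by (rule sum_blocks)
  also have "\<dots> \<le> (\<Sum>j<N. \<Sum>i<k. peak k (J + j))"
  proof (intro sum_mono meet_le)
    fix i j a assume "a \<in> comps k (J * k + (j * k + i))"
    then show "mpmf k (J * k + (j * k + i)) a \<le> peak k (J + j)"
      using J k by (intro mpmf_le_peak) (auto simp: algebra_simps)
  qed (use k in auto)
  also have "\<dots> = real k * (\<Sum>j<N. peak k (J + j))" by (simp add: sum_distrib_left)
  also have "\<dots> \<le> real k * (peak k J * (1 + (real J + 1) / 2))"
    using sum_peak_le[OF k] by (intro mult_left_mono) auto
  finally show ?thesis by (simp add: mult.assoc)
qed

lemma sum_meet_le:
  assumes k: "7 \<le> k" and J: "0 < J"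
    and G: "(\<Sum>h=1..<J * k. meet k h) + real k * peak k J * (1 + (real J + 1) / 2) \<le> G"
  shows "(\<Sum>h=1..n. meet k h) \<le> G"
proof -
  have Jk: "1 \<le> J * k" using J k by (simp add: Suc_le_eq)
  have "(\<Sum>h=1..n. meet k h) \<le> (\<Sum>h=1..<J * k + n. meet k h)"
  proof (rule sum_mono2)
    show "{1..n} \<subseteq> {1..<J * k + n}"
    proof
      fix x assume "x \<in> {1..n}"
      then have "1 \<le> x" "x \<le> n" by simp_all
      then have "1 \<le> x" "x < J * k + n" using Jk by linarith+
      then show "x \<in> {1..<J * k + n}" unfolding atLeastLessThan_iff ..
    qed
  qed (simp_all add: meet_nonneg)
  also have "\<dots> = (\<Sum>h=1..<J * k. meet k h) + (\<Sum>h=J * k..<J * k + n. meet k h)"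
    using Jk by (simp add: sum.atLeastLessThan_concat)
  also have "(\<Sum>h=J * k..<J * k + n. meet k h) = (\<Sum>h<n. meet k (J * k + h))"
    using sum.shift_bounds_nat_ivl[of "meet k" 0 "J * k" n] by (simp add: add.commute lessThan_atLeast0)
  also have "\<dots> \<le> real k * peak k J * (1 + (real J + 1) / 2)"
    by (rule sum_meet_tail[OF k J])
  finally show ?thesis using G by linarith
qed

section \<open>Squared multinomial coefficients\<close>

definition sq_multinom :: "nat \<Rightarrow> nat \<Rightarrow> real" where
  "sq_multinom k n = (\<Sum>a\<in>comps k n. multinom k n a ^ 2)"

lemma meet_eq: "meet k n = sq_multinom k n / real k ^ (2 * n)"
  by (simp add: meet_def sq_multinom_def mpmf_def power_divide sum_divide_distrib power_mult[symmetric] mult.commute)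

lemma sq_multinom_0: "sq_multinom 0 n = of_bool (n = 0)"
proof -
  have "comps 0 n = (if n = 0 then {\<lambda>_. 0} else {})" by (auto simp: comps_def)
  then show ?thesis by (simp add: sq_multinom_def multinom_def)
qed

text \<open>Splitting off the count j of the new direction factors a multinomial coefficient into a
  binomial and a smaller multinomial. The recursion makes exact evaluation in integers
  feasible.\<close>

lemma sq_multinom_Suc:
  "sq_multinom (Suc k) n = (\<Sum>j\<le>n. real (n choose j) ^ 2 * sq_multinom k (n - j))"
proof -
  have m: "multinom (Suc k) n (a(k := j)) = real (n choose j) * multinom k (n - j) a"
    if "a \<in> comps k (n - j)" "j \<le> n" for a j
  proof -
    have "(\<Prod>i<k. fact ((a(k := j)) i) :: real) = (\<Prod>i<k. fact (a i))" by (intro prod.cong) auto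
    then show ?thesis using that(2) by (simp add: multinom_def binomial_fact)
  qed
  have "(\<Sum>j\<le>n. real (n choose j) ^ 2 * sq_multinom k (n - j))
     = (\<Sum>j\<le>n. \<Sum>a\<in>comps k (n - j). multinom (Suc k) n (a(k := j)) ^ 2)"
    by (simp add: sq_multinom_def sum_distrib_left m power_mult_distrib)
  also have "\<dots> = (\<Sum>(j, a)\<in>(SIGMA j:{..n}. comps k (n - j)). multinom (Suc k) n (a(k := j)) ^ 2)"
    by (rule sum.Sigma) (auto simp: finite_comps)
  also have "\<dots> = (\<Sum>b\<in>comps (Suc k) n. multinom (Suc k) n b ^ 2)"
  proof (rule sum.reindex_bij_witness[where i="\<lambda>b. (b k, b(k := 0))" and j="\<lambda>(j, a). a(k := j)"])
    fix b assume b: "b \<in> comps (Suc k) n"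
    have "(\<Sum>i<k. (b(k := 0)) i) = (\<Sum>i<k. b i)" by (intro sum.cong) auto
    then show "(b k, b(k := 0)) \<in> (SIGMA j:{..n}. comps k (n - j))"
      using b by (auto simp: comps_def)
  next
    fix z assume z: "z \<in> (SIGMA j:{..n}. comps k (n - j))"
    obtain j a where ja: "z = (j, a)" "j \<le> n" "a \<in> comps k (n - j)" using z by auto
    have "(\<Sum>i<k. (a(k := j)) i) = (\<Sum>i<k. a i)" by (intro sum.cong) auto
    then show "(case z of (j, a) \<Rightarrow> a(k := j)) \<in> comps (Suc k) n"
      using ja by (auto simp: comps_def)
    show "((case z of (j, a) \<Rightarrow> a(k := j)) k, (case z of (j, a) \<Rightarrow> a(k := j))(k := 0)) = z"
      using ja by (auto simp: comps_def fun_eq_iff)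
  qed auto
  finally show ?thesis by (simp add: sq_multinom_def)
qed

lemma sq_multinom_zero: "sq_multinom k 0 = 1"
  by (simp add: sq_multinom_def comps_0 multinom_def)

lemma meet_1: "0 < k \<Longrightarrow> meet k 1 = 1 / real k"
proof -
  assume k: "0 < k"
  have "sq_multinom k 1 = real k"
    by (induction k) (simp_all add: sq_multinom_0 sq_multinom_Suc sq_multinom_zero)
  then show ?thesis using k by (simp add: meet_eq power2_eq_square)
qed

text \<open>If steps in directions i and j bring distinct points together, then i is the only
  coordinate in which \<open>u'\<close> exceeds \<open>u\<close>, and it determines j. So one pair
  of directions out of the square of k can succeed, against k pairs for a common start.\<close>

lemma Phi_1_le:
  assumes "u \<noteq> u'"
  shows "Phi k 1 u u' \<le> 1 / real k ^ 2"
proof -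
  have "(\<Sum>i<k. \<Sum>j<k. of_bool (step u i = step u' j)) \<le> (1 :: real)"
  proof (cases "\<exists>i<k. \<exists>j<k. step u i = step u' j")
    case True
    then obtain i j where ij: "i < k" "j < k" "step u i = step u' j" by blast
    have uniq: "i' = i \<and> j' = j" if "step u i' = step u' j'" for i' j'
    proof -
      have "i \<noteq> j"
      proof
        assume "i = j"
        then have "u l = u' l" for l using fun_cong[OF ij(3), of l] by (cases "l = i") (simp_all add: step_def)
        then show False using assms by blast
      qed
      then have "Suc (u i) = u' i" using fun_cong[OF ij(3), of i] by (simp add: step_def)
      then have "i' = i" using fun_cong[OF that, of i] by (auto simp: step_def split: if_splits)
      then have "step u' j' = step u' j" using that ij(3) by simp
      then show ?thesis using \<open>i' = i\<close> by simp
    qed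
    have "(\<Sum>i'<k. \<Sum>j'<k. of_bool (step u i' = step u' j'))
        = (\<Sum>i'<k. \<Sum>j'<k. if i' = i then (if j' = j then 1 else 0) else 0 :: real)"
    proof -
      have "step u i' = step u' j' \<longleftrightarrow> i' = i \<and> j' = j" for i' j' using uniq ij(3) by blast
      then show ?thesis by (intro sum.cong refl) simp
    qed
    also have "\<dots> = (\<Sum>i'<k. if i' = i then (\<Sum>j'<k. if j' = j then 1 else 0) else 0)"
      by (intro sum.cong) auto
    also have "\<dots> = 1" using ij by simp
    finally show ?thesis by simp
  qed auto
  then show ?thesis by (simp add: divide_right_mono)
qed

section \<open>Percolation from collision estimates\<close>

text \<open>\<open>\<psi>\<close> embeds the states into the lattice. Its injectivity turns distinct
  bonds into distinct edges, so a bound on \<open>H\<close> uniform in n yields open paths to every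
  level with probability at least \<open>1 / X\<close>.\<close>

lemma (in lateral_walk) bond_percolates:
  assumes St: "s0 \<in> St" "\<And>s c. s \<in> St \<Longrightarrow> c \<in> {..<k} \<times> L \<Longrightarrow> nx s c \<in> St"
      "\<And>s c. s \<in> St \<Longrightarrow> c \<in> {..<k} \<times> L \<Longrightarrow> (fst s, snd s + snd c) \<in> St"
    and inj: "inj_on \<psi> St" and lev: "\<And>s. s \<in> St \<Longrightarrow> lev (\<psi> s) = height s"
    and lat: "\<And>s c. s \<in> St \<Longrightarrow> c \<in> {..<k} \<times> L \<Longrightarrow> snd c \<noteq> 0 \<Longrightarrow>
        (\<psi> s, \<psi> (fst s, snd s + snd c)) \<in> arcs d"
    and up: "\<And>s c. s \<in> St \<Longrightarrow> c \<in> {..<k} \<times> L \<Longrightarrow> (\<psi> (fst s, snd s + snd c), \<psi> (nx s c)) \<in> arcs d"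
    and p: "0 < p" "p \<le> 1" and X: "\<And>n. H (1 / p) n s0 s0 \<le> X"
  shows "0 < measure (bond_measure d p) {\<omega> \<in> space (bond_measure d p). \<exists>C\<in>bond_clusters d \<omega>. infinite C}"
proof -
  let ?idx = "\<lambda>(x, y). {x, y}"
  let ?M = "Pi\<^sub>M (Zd_edges d) (\<lambda>_. bern p)"
  let ?r = "rel ?idx (arcs d)"
  have X1: "1 \<le> X" using X[of 0] by simp
  have items_St: "b \<in> items s xs \<Longrightarrow> s \<in> St \<Longrightarrow> set xs \<subseteq> {..<k} \<times> L \<Longrightarrow> b \<subseteq> St \<and> \<psi> ` b \<in> Zd_edges d"
    for b s xs
  proof (induction xs arbitrary: s)
    case (Cons c cs)
    show ?case
    proof (cases "b \<in> bonds s c")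
      case True
      have c: "c \<in> {..<k} \<times> L" using Cons.prems by simp
      have "snd c \<noteq> 0 \<Longrightarrow> {\<psi> s, \<psi> (fst s, snd s + snd c)} \<in> Zd_edges d"
        "{\<psi> (fst s, snd s + snd c), \<psi> (nx s c)} \<in> Zd_edges d"
        using lat[OF Cons.prems(2) c] up[OF Cons.prems(2) c] by (simp_all add: arcs_def)
      moreover have "b = {(fst s, snd s + snd c), nx s c} \<or> snd c \<noteq> 0 \<and> b = {s, (fst s, snd s + snd c)}"
        using True by (auto simp: bonds_def split: if_splits)
      ultimately show ?thesis using Cons.prems(2) St(2,3)[OF Cons.prems(2) c] by auto
    next
      case False
      then show ?thesis using Cons St(2)[of s c] by auto
    qed
  qed simp
  have path: "\<exists>t\<in>St. (\<psi> s, \<psi> t) \<in> (?r \<omega>)\<^sup>* \<and> height t = height s + length xs"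
    if "s \<in> St" "set xs \<subseteq> {..<k} \<times> L" "\<forall>b\<in>items s xs. \<omega> (\<psi> ` b)" for s xs \<omega>
    using that
  proof (induction xs arbitrary: s)
    case (Cons c cs)
    have c: "c \<in> {..<k} \<times> L" using Cons.prems by simp
    have op: "\<omega> (\<psi> ` b)" if "b \<in> bonds s c" for b using Cons.prems(3) that by simp
    have 1: "(\<psi> s, \<psi> (fst s, snd s + snd c)) \<in> (?r \<omega>)\<^sup>*"
    proof (cases "snd c = 0")
      case False
      then have "(\<psi> s, \<psi> (fst s, snd s + snd c)) \<in> ?r \<omega>"
        using lat[OF Cons.prems(1) c] op[of "{s, (fst s, snd s + snd c)}"] by (simp add: rel_def bonds_def)
      then show ?thesis by blast
    qed simp
    have 2: "(\<psi> (fst s, snd s + snd c), \<psi> (nx s c)) \<in> ?r \<omega>"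
      using up[OF Cons.prems(1) c] op[of "{(fst s, snd s + snd c), nx s c}"] by (simp add: rel_def bonds_def)
    obtain t where t: "t \<in> St" "(\<psi> (nx s c), \<psi> t) \<in> (?r \<omega>)\<^sup>*" "height t = height (nx s c) + length cs"
      using Cons.IH[OF St(2)[OF Cons.prems(1) c]] Cons.prems(2,3) by auto
    have "(\<psi> s, \<psi> t) \<in> (?r \<omega>)\<^sup>*" using 1 2 t(2) by (meson rtrancl_into_rtrancl rtrancl_trans)
    then show ?case using t lev_nxt[OF c, of s] by (intro bexI[of _ t]) auto
  qed auto
  have "0 < measure ?M {\<omega> \<in> space ?M. inf_comp d (?r \<omega>)}"
  proof (rule inf_comp_prob_pos[where R="{\<psi> s0}" and c="1 / X" and lev=lev])
    show "?r \<omega> \<subseteq> arcs d" for \<omega> by (rule rel_subset)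
    show "{\<omega> \<in> space ?M. (u, v) \<in> ?r \<omega>} \<in> sets ?M" for u v
      using sets_rel[of ?idx "arcs d" "Zd_edges d"] by (simp add: edges_image)
    show "{\<psi> s0} \<subseteq> Zd d" using up[OF St(1), of "(0, 0)"] St(1) k L arcs_subset by auto
    show "\<exists>S\<in>sets ?M. 1 / X \<le> measure ?M S \<and>
       (\<forall>\<omega>\<in>S. \<exists>x\<in>{\<psi> s0}. \<exists>y. (x, y) \<in> (?r \<omega>)\<^sup>* \<and> n \<le> lev y)" for n
    proof (rule bexI[of _ "{\<omega> \<in> Zd_edges d \<rightarrow>\<^sub>E UNIV. \<exists>xs\<in>words n. \<forall>b\<in>items s0 xs. \<omega> (\<psi> ` b)}"],
        intro conjI ballI)
      let ?S = "{\<omega> \<in> Zd_edges d \<rightarrow>\<^sub>E UNIV. \<exists>xs\<in>words n. \<forall>b\<in>items s0 xs. \<omega> (\<psi> ` b)}"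
      have sub: "(\<lambda>b. \<psi> ` b) ` items s0 xs \<subseteq> Zd_edges d" if "xs \<in> words n" for xs
        using items_St[OF _ St(1)] that unfolding words_def by blast
      have "inj_on (\<lambda>b. \<psi> ` b) (\<Union>xs\<in>words n. items s0 xs)"
      proof (rule inj_on_subset[of _ "Pow St"])
        show "inj_on (\<lambda>b. \<psi> ` b) (Pow St)" using inj by (rule inj_on_image_Pow)
        show "(\<Union>xs\<in>words n. items s0 xs) \<subseteq> Pow St"
          using items_St[OF _ St(1)] unfolding words_def by blast
      qed
      then show "1 / X \<le> measure ?M ?S"
        using X1 by (intro prob_open_word[OF p X _ _ sub]) auto
      show "?S \<in> sets ?M" by (rule sets_open_word[OF sub])
      show "\<exists>x\<in>{\<psi> s0}. \<exists>y. (x, y) \<in> (?r \<omega>)\<^sup>* \<and> n \<le> lev y" if "\<omega> \<in> ?S" for \<omega>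
      proof -
        obtain xs where xs: "xs \<in> words n" "\<forall>b\<in>items s0 xs. \<omega> (\<psi> ` b)" using \<open>\<omega> \<in> ?S\<close> by blast
        then obtain t where "t \<in> St" "(\<psi> s0, \<psi> t) \<in> (?r \<omega>)\<^sup>*" "height t = height s0 + length xs"
          using path[OF St(1), of xs \<omega>] unfolding words_def by blast
        then show ?thesis using xs(1) lev[of t] by (intro bexI[of _ "\<psi> s0"] exI[of _ "\<psi> t"]) (auto simp: words_def)
      qed
    qed
  qed (use X1 prob_space_PiM_bern in auto)
  then show ?thesis by (simp add: bond_measure_def infinite_bond_cluster_iff)
qed

definition site_rel :: "nat \<Rightarrow> ((nat \<Rightarrow> int) \<Rightarrow> bool) \<Rightarrow> ((nat \<Rightarrow> int) \<times> (nat \<Rightarrow> int)) set" where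
  "site_rel d \<eta> = {(u, v) \<in> arcs d. \<eta> u \<and> \<eta> v}"

lemma infinite_site_component_iff:
  "(\<exists>C\<in>components_of {x \<in> Zd d. \<eta> x} (Zd_edges d). infinite C) \<longleftrightarrow> inf_comp d (site_rel d \<eta>)"
proof -
  have "{(u, v) \<in> arcs d. u \<in> {x \<in> Zd d. \<eta> x} \<and> v \<in> {x \<in> Zd d. \<eta> x}} = site_rel d \<eta>"
    by (auto simp: site_rel_def arcs_iff)
  then show ?thesis by (subst infinite_component_iff) auto
qed

lemma sets_site_rel:
  "{\<eta> \<in> Zd d \<rightarrow>\<^sub>E UNIV. (u, v) \<in> site_rel d \<eta>} \<in> sets (Pi\<^sub>M (Zd d) (\<lambda>_. bern p))"
proof (cases "(u, v) \<in> arcs d")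
  case True
  have eq: "{\<eta> \<in> Zd d \<rightarrow>\<^sub>E UNIV. (u, v) \<in> site_rel d \<eta>} = {\<eta> \<in> Zd d \<rightarrow>\<^sub>E UNIV. \<forall>x\<in>{u, v}. \<eta> x = True}"
    using True by (simp add: site_rel_def)
  show ?thesis unfolding eq by (rule sets_cylinder[where \<eta>="\<lambda>_. True"]) (use True in \<open>simp_all add: arcs_iff\<close>)
qed (simp add: site_rel_def)

lemma (in oriented_walk) site_percolates:
  assumes St: "u0 \<in> St" "\<And>u i. u \<in> St \<Longrightarrow> i < k \<Longrightarrow> step u i \<in> St"
    and inj: "inj_on \<psi> St" and lev: "\<And>u. u \<in> St \<Longrightarrow> lev (\<psi> u) = sum u {..<k}"
    and up: "\<And>u i. u \<in> St \<Longrightarrow> i < k \<Longrightarrow> (\<psi> u, \<psi> (step u i)) \<in> arcs d"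
    and p: "0 < p" "p \<le> 1" and X: "\<And>n. H (1 / p) n u0 u0 \<le> X"
  shows "0 < measure (site_measure d p) {\<eta> \<in> space (site_measure d p). \<exists>C\<in>site_clusters d \<eta>. infinite C}"
proof -
  let ?M = "Pi\<^sub>M (Zd d) (\<lambda>_. bern p)"
  have X1: "1 \<le> X" using X[of 0] by simp
  have Zd: "\<psi> u \<in> Zd d" if "u \<in> St" for u using up[OF that k] arcs_subset by auto
  have items_St: "v \<in> items u xs \<Longrightarrow> u \<in> St \<Longrightarrow> set xs \<subseteq> {..<k} \<Longrightarrow> v \<in> St" for v u xs
    by (induction xs arbitrary: u) (use St in auto)
  have path: "\<exists>t\<in>St. (\<psi> u, \<psi> t) \<in> (site_rel d \<eta>)\<^sup>* \<and> sum t {..<k} = sum u {..<k} + length xs"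
    if "u \<in> St" "set xs \<subseteq> {..<k}" "\<eta> (\<psi> u)" "\<forall>v\<in>items u xs. \<eta> (\<psi> v)" for u xs \<eta>
    using that
  proof (induction xs arbitrary: u)
    case (Cons i xs)
    have i: "i < k" using Cons.prems by simp
    have 1: "(\<psi> u, \<psi> (step u i)) \<in> site_rel d \<eta>"
      using up[OF Cons.prems(1) i] Cons.prems(3,4) by (simp add: site_rel_def)
    obtain t where t: "t \<in> St" "(\<psi> (step u i), \<psi> t) \<in> (site_rel d \<eta>)\<^sup>*"
        "sum t {..<k} = sum (step u i) {..<k} + length xs"
      using Cons.IH[OF St(2)[OF Cons.prems(1) i]] Cons.prems by auto
    have "(\<psi> u, \<psi> t) \<in> (site_rel d \<eta>)\<^sup>*" using 1 t(2) by (meson converse_rtrancl_into_rtrancl)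
    then show ?case using t i by (intro bexI[of _ t]) (auto simp: sum_step)
  qed auto
  have "0 < measure ?M {\<eta> \<in> space ?M. inf_comp d (site_rel d \<eta>)}"
  \<comment> \<open>The vertex \<open>u0\<close> is not an item and need not be open. The open paths
    are therefore started at its oriented neighbours, and words of length \<open>Suc n\<close>
    compensate for the first step.\<close>
  proof (rule inf_comp_prob_pos[where R="(\<lambda>i. \<psi> (step u0 i)) ` {..<k}" and c="1 / X" and lev=lev])
    show "site_rel d \<eta> \<subseteq> arcs d" for \<eta> by (auto simp: site_rel_def)
    show "{\<eta> \<in> space ?M. (u, v) \<in> site_rel d \<eta>} \<in> sets ?M" for u v
      using sets_site_rel by simp
    show "(\<lambda>i. \<psi> (step u0 i)) ` {..<k} \<subseteq> Zd d" using St Zd by auto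
    show "\<exists>S\<in>sets ?M. 1 / X \<le> measure ?M S \<and>
       (\<forall>\<omega>\<in>S. \<exists>x\<in>(\<lambda>i. \<psi> (step u0 i)) ` {..<k}. \<exists>y. (x, y) \<in> (site_rel d \<omega>)\<^sup>* \<and> n \<le> lev y)" for n
    proof (rule bexI[of _ "{\<omega> \<in> Zd d \<rightarrow>\<^sub>E UNIV. \<exists>xs\<in>words (Suc n). \<forall>v\<in>items u0 xs. \<omega> (\<psi> v)}"],
        intro conjI ballI)
      let ?S = "{\<omega> \<in> Zd d \<rightarrow>\<^sub>E UNIV. \<exists>xs\<in>words (Suc n). \<forall>v\<in>items u0 xs. \<omega> (\<psi> v)}"
      have sub: "\<psi> ` items u0 xs \<subseteq> Zd d" if "xs \<in> words (Suc n)" for xs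
        using items_St[OF _ St(1)] Zd that unfolding words_def by blast
      have "inj_on \<psi> (\<Union>xs\<in>words (Suc n). items u0 xs)"
        by (rule inj_on_subset[OF inj]) (use items_St[OF _ St(1)] in \<open>unfold words_def, blast\<close>)
      then show "1 / X \<le> measure ?M ?S"
        using X1 by (intro prob_open_word[OF p X _ _ sub]) auto
      show "?S \<in> sets ?M" by (rule sets_open_word[OF sub])
      show "\<exists>x\<in>(\<lambda>i. \<psi> (step u0 i)) ` {..<k}. \<exists>y. (x, y) \<in> (site_rel d \<omega>)\<^sup>* \<and> n \<le> lev y" if "\<omega> \<in> ?S" for \<omega>
      proof -
        obtain xs where xs: "xs \<in> words (Suc n)" "\<forall>v\<in>items u0 xs. \<omega> (\<psi> v)" using \<open>\<omega> \<in> ?S\<close> by blast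
        obtain i ys where ys: "xs = i # ys" using xs(1) by (cases xs) (auto simp: words_def)
        have i: "i < k" and l: "length ys = n" "set ys \<subseteq> {..<k}" using xs(1) ys by (auto simp: words_def)
        have o: "\<omega> (\<psi> (step u0 i))" "\<forall>v\<in>items (step u0 i) ys. \<omega> (\<psi> v)" using xs(2) ys by auto
        obtain t where "t \<in> St" "(\<psi> (step u0 i), \<psi> t) \<in> (site_rel d \<omega>)\<^sup>*"
            "sum t {..<k} = sum (step u0 i) {..<k} + length ys"
          using path[OF St(2)[OF St(1) i] l(2) o] by blast
        then show ?thesis using l lev[of t] i by (intro bexI[of _ "\<psi> (step u0 i)"] exI[of _ "\<psi> t"]) auto
      qed
    qed
  qed (use X1 prob_space_PiM_bern in auto)
  then show ?thesis by (simp add: site_measure_def site_clusters_def infinite_site_component_iff)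
qed

section \<open>Embedding the walks into the lattice\<close>

definition lattice_pt :: "nat \<Rightarrow> nat \<Rightarrow> (nat \<Rightarrow> nat) \<times> (int \<times> int) \<Rightarrow> (nat \<Rightarrow> int)" where
  "lattice_pt d k s = (\<lambda>i\<in>{..<d}. if i < k then int (fst s i) else if i = k then fst (snd s)
      else if i = Suc k then snd (snd s) else 0)"

lemma lattice_pt_in_Zd: "lattice_pt d k s \<in> Zd d"
  by (simp add: lattice_pt_def Zd_def)

lemma lattice_pt_level: "k \<le> d \<Longrightarrow> nat (\<Sum>i<k. lattice_pt d k s i) = sum (fst s) {..<k}"
proof -
  assume "k \<le> d"
  then have "(\<Sum>i<k. lattice_pt d k s i) = (\<Sum>i<k. int (fst s i))"
    by (intro sum.cong) (auto simp: lattice_pt_def)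
  then show ?thesis by (simp flip: of_nat_sum)
qed

lemma lattice_pt_up:
  assumes "i < k" "k \<le> d"
  shows "(lattice_pt d k (u, y), lattice_pt d k (step u i, y)) \<in> arcs d"
proof -
  have "(\<Sum>j<d. \<bar>lattice_pt d k (u, y) j - lattice_pt d k (step u i, y) j\<bar>) = (\<Sum>j<d. if j = i then 1 else 0)"
    using assms by (intro sum.cong) (auto simp: lattice_pt_def step_def)
  then show ?thesis using assms by (simp add: arcs_iff lattice_pt_in_Zd)
qed

lemma lattice_pt_lateral:
  assumes "Suc k < d" "\<bar>fst e\<bar> + \<bar>snd e\<bar> = 1"
  shows "(lattice_pt d k (u, y), lattice_pt d k (u, y + e)) \<in> arcs d"
proof -
  have "(\<Sum>j<d. \<bar>lattice_pt d k (u, y) j - lattice_pt d k (u, y + e) j\<bar>)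
      = (\<Sum>j<d. (if j = k then \<bar>fst e\<bar> else 0) + (if j = Suc k then \<bar>snd e\<bar> else 0))"
    using assms by (intro sum.cong) (auto simp: lattice_pt_def)
  also have "\<dots> = 1" using assms by (simp add: sum.distrib)
  finally show ?thesis by (simp add: arcs_iff lattice_pt_in_Zd)
qed

text \<open>Either both lateral coordinates exist in dimension d, or the lateral part is constantly
  zero; the second case allows all d coordinates to be oriented.\<close>

lemma lattice_pt_inj:
  assumes "k \<le> d" "Suc k < d \<or> G \<subseteq> {0}"
  shows "inj_on (lattice_pt d k) ({u. \<forall>i\<ge>k. u i = 0} \<times> G)"
proof (rule inj_onI)
  fix s s' assume s: "s \<in> ({u. \<forall>i\<ge>k. u i = 0} \<times> G)" "s' \<in> ({u. \<forall>i\<ge>k. u i = 0} \<times> G)"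
    and "lattice_pt d k s = lattice_pt d k s'"
  obtain u y1 y2 u' z1 z2 where ss: "s = (u, y1, y2)" "s' = (u', z1, z2)" by (cases s, cases s') auto
  have a: "\<forall>i\<ge>k. u i = 0" "\<forall>i\<ge>k. u' i = 0" "(y1, y2) \<in> G" "(z1, z2) \<in> G"
    and eq: "lattice_pt d k (u, y1, y2) = lattice_pt d k (u', z1, z2)"
    using s \<open>lattice_pt d k s = lattice_pt d k s'\<close> ss by auto
  have "u i = u' i" for i
    using fun_cong[OF eq, of i] a(1,2) assms(1) by (cases "i < k") (auto simp: lattice_pt_def)
  moreover have "y1 = z1 \<and> y2 = z2"
  proof (cases "Suc k < d")
    case True
    then show ?thesis using fun_cong[OF eq, of k] fun_cong[OF eq, of "Suc k"] by (simp add: lattice_pt_def)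
  next
    case False
    then show ?thesis using assms(2) a(3,4) by (auto simp: zero_prod_def)
  qed
  ultimately show "s = s'" using ss by auto
qed

lemma lattice_pt_site_inj: "k \<le> d \<Longrightarrow> inj_on (\<lambda>u. lattice_pt d k (u, 0)) {u. \<forall>i\<ge>k. u i = 0}"
  using lattice_pt_inj[of k d "{0}"] by (auto simp: inj_on_def)

lemma site_percolates_oriented:
  assumes kd: "0 < k" "k \<le> d" and p: "0 < p" "p \<le> 1" and G: "\<And>n. (\<Sum>h=1..n. meet k h) \<le> G"
    and pG: "(1 / p - 1) * G < 1"
  shows "0 < measure (site_measure d p) {\<eta> \<in> space (site_measure d p). \<exists>C\<in>site_clusters d \<eta>. infinite C}"
proof -
  interpret oriented_walk k by unfold_locales (rule kd)
  have G0: "0 \<le> G" using G[of 0] by simp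
  \<comment> \<open>The fixed point of \<open>X = 1 + (1 / p - 1) * X * G\<close>, positive exactly
    under the assumption on \<open>p\<close>.\<close>
  define X where "X = 1 / (1 - (1 / p - 1) * G)"
  have X: "0 \<le> X" "1 + (1 / p - 1) * X * G \<le> X"
  proof -
    have "X * (1 - (1 / p - 1) * G) = 1" using pG by (simp add: X_def)
    then show "1 + (1 / p - 1) * X * G \<le> X" by (simp add: algebra_simps)
    show "0 \<le> X" using pG by (simp add: X_def)
  qed
  have "H (1 / p) n u u' \<le> X" for n u u'
  proof (rule H_bound[OF _ X])
    show "1 \<le> 1 / p" using p by simp
    show "(\<Sum>h=1..n. Phi k h u u') \<le> G" for n u u'
      using sum_mono[of "{1..n}" "\<lambda>h. Phi k h u u'" "meet k"] Phi_le_meet G[of n] by (meson order_trans)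
  qed
  then show ?thesis
    using kd p
    by (intro site_percolates[where St="{u. \<forall>i\<ge>k. u i = 0}" and \<psi>="\<lambda>u. lattice_pt d k (u, 0)"
          and lev="\<lambda>x. nat (\<Sum>i<k. x i)" and ?u0.0="\<lambda>_. 0" and X=X])
       (auto simp: lattice_pt_site_inj lattice_pt_level lattice_pt_up, auto simp: step_def)
qed

text \<open>Two walks at a common vertex share the next bond with probability 1/k. The start is such
  a vertex and later collisions number at most \<open>G\<close> on average; hence
  \<open>1 + G\<close> in the condition, where sites have only \<open>G\<close>.\<close>

lemma bond_percolates_oriented:
  assumes kd: "0 < k" "k \<le> d" and p: "0 < p" "p \<le> 1" and G: "\<And>n. (\<Sum>h=1..n. meet k h) \<le> G"
    and pG: "(1 / p - 1) * (1 + G) < real k"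
  shows "0 < measure (bond_measure d p) {\<omega> \<in> space (bond_measure d p). \<exists>C\<in>bond_clusters d \<omega>. infinite C}"
proof -
  let ?L = "{0 :: int \<times> int}"
  interpret lateral_walk k ?L "\<lambda>e. of_bool (e = 0)" by unfold_locales (use kd in auto)
  have G0: "0 \<le> G" using G[of 0] by simp
  define w where "w = 1 / p"
  have w: "1 \<le> w" using p by (simp add: w_def)
  define t where "t = (w - 1) / real k"
  have t: "0 \<le> t" "t * (1 + G) < 1" using w pG kd by (auto simp: t_def w_def field_simps)
  define X where "X = 1 / (1 - t * (1 + G))"
  have X: "0 \<le> X" "1 + t * X + t * X * G = X"
  proof -
    have "X * (1 - t * (1 + G)) = 1" using t by (simp add: X_def)
    then show "1 + t * X + t * X * G = X" by (simp add: algebra_simps)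
    show "0 \<le> X" using t by (simp add: X_def)
  qed
  have PG: "(\<Sum>h=1..n. Phi k h u u') \<le> G" for n u u'
    using sum_mono[of "{1..n}" "\<lambda>h. Phi k h u u'" "meet k"] Phi_le_meet G[of n] by (meson order_trans)
  have "H w n s s \<le> X" for n s
  \<comment> \<open>With the zero move only, coincidence at a vertex costs \<open>t * X\<close> and
    different lateral positions never interact, so \<open>D1\<close> vanishes and
    \<open>\<kappa>\<close> is \<open>t * X\<close>.\<close>
  proof (rule H_bound[where Z=X and ?D0.0="t * X" and ?D1.0=0 and ?Y1.0=1 and ?z1.0=0 and ?b2.0=0 and Gu=G and Gz=G])
    show "coll \<eta> \<le> 1" for \<eta> by (cases "\<eta> = 0") (simp_all add: coll_def)
    show "coll \<eta> \<le> 0" if "\<eta> \<noteq> 0" for \<eta> using that by (simp add: coll_def)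
    show "cross \<eta> \<le> 0" if "\<eta> \<noteq> 0" for \<eta> using that by (simp add: cross_def)
    have "0 + (t * X - 0) * 1 = t * X" by simp
    with X(2) show "1 + t * X + (0 + (t * X - 0) * 1) * G \<le> X" by simp
    show "1 + (0 + (t * X - 0) * 1) * G \<le> X"
      using X(2) mult_nonneg_nonneg[OF t(1) X(1)] by simp
  qed (use w X t PG in \<open>auto simp: t_def\<close>)
  then show ?thesis unfolding w_def
    using kd p
    by (intro bond_percolates[where St="{u. \<forall>i\<ge>k. u i = 0} \<times> {0}" and \<psi>="lattice_pt d k"
          and lev="\<lambda>x. nat (\<Sum>i<k. x i)" and ?s0.0="(\<lambda>_. 0, 0)" and X=X])
       (auto simp: lattice_pt_inj lattice_pt_level lattice_pt_up height_def nx_def, auto simp: step_def)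
qed

section \<open>Exact collision sums in integer arithmetic\<close>

definition next_pascal :: "int list \<Rightarrow> int list" where
  "next_pascal r = map2 (+) (0 # r) (r @ [0])"

primrec pascal_row :: "nat \<Rightarrow> int list" where
  "pascal_row 0 = [1]"
| "pascal_row (Suc n) = next_pascal (pascal_row n)"

lemma pascal_row_eq: "pascal_row n = map (\<lambda>j. int (n choose j)) [0..<Suc n]"
proof (induction n)
  case (Suc n)
  have "pascal_row (Suc n) = map2 (+) (0 # map (\<lambda>j. int (n choose j)) [0..<Suc n])
      (map (\<lambda>j. int (n choose j)) [0..<Suc n] @ [0])"
    by (simp only: pascal_row.simps next_pascal_def Suc)
  also have "\<dots> = map (\<lambda>j. int (Suc n choose j)) [0..<Suc (Suc n)]"
  proof (rule nth_equalityI)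
    fix i assume "i < length (map2 (+) (0 # map (\<lambda>j. int (n choose j)) [0..<Suc n])
      (map (\<lambda>j. int (n choose j)) [0..<Suc n] @ [0]))"
    then have "i < Suc (Suc n)" by simp
    then show "map2 (+) (0 # map (\<lambda>j. int (n choose j)) [0..<Suc n])
      (map (\<lambda>j. int (n choose j)) [0..<Suc n] @ [0]) ! i = map (\<lambda>j. int (Suc n choose j)) [0..<Suc (Suc n)] ! i"
      by (cases i) (auto simp: nth_append nth_Cons' less_Suc_eq binomial_eq_0 simp del: upt_Suc)
  qed simp
  finally show ?case .
qed simp

definition dot :: "int list \<Rightarrow> int list \<Rightarrow> int" where
  "dot xs ys = sum_list (map2 (*) xs ys)"

text \<open>\<open>acc\<close> holds the entries already read, in reverse order, so each new
  coefficient is an inner product with one row of squared binomials.\<close>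

fun convolve :: "int list list \<Rightarrow> int list \<Rightarrow> int list \<Rightarrow> int list" where
  "convolve (p # ps) acc (x # xs) = dot p (x # acc) # convolve ps (x # acc) xs"
| "convolve _ _ _ = []"

definition next_row :: "nat \<Rightarrow> int list \<Rightarrow> int list" where
  "next_row N r = convolve (map (\<lambda>n. map (\<lambda>c. c * c) (pascal_row n)) [0..<N]) [] r"

text \<open>The values of \<open>sq_multinom k\<close> at all arguments below N; with no direction,
  only time 0 contributes.\<close>

primrec row :: "nat \<Rightarrow> nat \<Rightarrow> int list" where
  "row N 0 = 1 # replicate (N - 1) 0"
| "row N (Suc k) = next_row N (row N k)"

lemma length_convolve: "length (convolve ps acc xs) = min (length ps) (length xs)"
  by (induction ps acc xs rule: convolve.induct) auto

lemma convolve_nth: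
  "n < length ps \<Longrightarrow> n < length xs \<Longrightarrow>
     convolve ps acc xs ! n = dot (ps ! n) (rev (take (Suc n) xs) @ acc)"
proof (induction ps acc xs arbitrary: n rule: convolve.induct)
  case (1 p ps acc x xs)
  then show ?case by (cases n) auto
qed auto

lemma dot_eq:
  assumes "n < length r"
  shows "dot (map f [0..<Suc n]) (rev (take (Suc n) r)) = (\<Sum>j\<le>n. f j * r ! (n - j))"
proof -
  have "map2 (*) (map f [0..<Suc n]) (rev (take (Suc n) r)) = map (\<lambda>j. f j * r ! (n - j)) [0..<Suc n]"
    using assms by (intro nth_equalityI) (auto simp: rev_nth simp del: upt_Suc)
  then show ?thesis
    unfolding dot_def by (simp only:) (simp add: interv_sum_list_conv_sum_set_nat atLeast0LessThan lessThan_Suc_atMost del: upt_Suc)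
qed

lemma row_correct:
  assumes "0 < N"
  shows "length (row N k) = N \<and> (\<forall>n<N. of_int (row N k ! n) = sq_multinom k n)"
proof (induction k)
  case 0
  show ?case using assms by (auto simp: sq_multinom_0 nth_Cons')
next
  case (Suc k)
  have l: "length (row N (Suc k)) = N" using Suc by (simp add: next_row_def length_convolve)
  have "of_int (row N (Suc k) ! n) = sq_multinom (Suc k) n" if n: "n < N" for n
  proof -
    have "row N (Suc k) ! n = dot (map (\<lambda>j. int (n choose j) * int (n choose j)) [0..<Suc n]) (rev (take (Suc n) (row N k)))"
      using n Suc by (simp add: next_row_def convolve_nth pascal_row_eq o_def del: upt_Suc)
    also have "\<dots> = (\<Sum>j\<le>n. int (n choose j) * int (n choose j) * row N k ! (n - j))"
      using n Suc by (intro dot_eq) auto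
    finally have "real_of_int (row N (Suc k) ! n) = (\<Sum>j\<le>n. real (n choose j) ^ 2 * real_of_int (row N k ! (n - j)))"
      by (simp add: power2_eq_square)
    also have "\<dots> = sq_multinom (Suc k) n"
      unfolding sq_multinom_Suc using Suc n by (intro sum.cong) auto
    finally show ?thesis .
  qed
  then show ?case using l by blast
qed

text \<open>The first entry gets the highest power of b, so the value is the sum of the
  \<open>i\<close>th entries over \<open>b ^ i\<close> with the common denominator cleared.\<close>

definition horner :: "int \<Rightarrow> int list \<Rightarrow> int" where
  "horner b xs = foldl (\<lambda>s x. s * b + x) 0 xs"

lemma horner_eq:
  assumes "b \<noteq> 0" "xs \<noteq> []"
  shows "real_of_int (horner b xs) = (\<Sum>i<length xs. of_int (xs ! i) / of_int b ^ i) * of_int b ^ (length xs - 1)"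
  using assms(2)
proof (induction xs rule: rev_nonempty_induct)
  case (single x)
  then show ?case by (simp add: horner_def)
next
  case (snoc x xs)
  have "real_of_int (horner b (xs @ [x])) = real_of_int (horner b xs) * of_int b + of_int x"
    by (simp add: horner_def)
  also have "\<dots> = (\<Sum>i<length xs. of_int (xs ! i) / of_int b ^ i) * of_int b ^ length xs + of_int x"
    using snoc by (cases xs) (simp_all add: mult_ac)
  also have "\<dots> = (\<Sum>i<length (xs @ [x]). of_int ((xs @ [x]) ! i) / of_int b ^ i) * of_int b ^ (length (xs @ [x]) - 1)"
    using assms(1) by (simp add: nth_append distrib_right)
  finally show ?case .
qed

text \<open>Clearing the denominators \<open>D\<close> and \<open>(k ^ 2) ^ (N - 1)\<close> leaves
  an integer inequality decidable by evaluation. The summand \<open>D\<close> on its right accounts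
  for the collision probability 1 at time 0.\<close>

lemma sum_meet_horner:
  assumes N: "0 < N" and k: "0 < k"
    and c: "horner (int k ^ 2) (row N k) * D \<le> (D + c) * (int k ^ 2) ^ (N - 1)" and D: "0 < D"
  shows "(\<Sum>h=1..<N. meet k h) \<le> of_int c / of_int D"
proof -
  have row: "length (row N k) = N" "\<And>n. n < N \<Longrightarrow> real_of_int (row N k ! n) = sq_multinom k n"
    using row_correct[OF N] by auto
  let ?b = "(int k ^ 2)"
  have "real_of_int (horner ?b (row N k)) = (\<Sum>i<N. of_int (row N k ! i) / of_int ?b ^ i) * of_int ?b ^ (N - 1)"
    using horner_eq[of ?b "row N k"] k N row(1) by (cases "row N k") auto
  also have "(\<Sum>i<N. real_of_int (row N k ! i) / of_int ?b ^ i) = (\<Sum>i<N. meet k i)"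
    by (intro sum.cong) (auto simp: row meet_eq power_mult)
  also have "(\<Sum>i<N. meet k i) = 1 + (\<Sum>h=1..<N. meet k h)"
    using N by (simp add: lessThan_atLeast0 sum.atLeast_Suc_lessThan meet_eq sq_multinom_zero)
  finally have "real_of_int (horner ?b (row N k)) = (1 + (\<Sum>h=1..<N. meet k h)) * of_int ?b ^ (N - 1)" .
  moreover have "real_of_int (horner ?b (row N k)) * of_int D \<le> (of_int D + of_int c) * of_int ?b ^ (N - 1)"
    using c by (metis (mono_tags) of_int_le_iff of_int_mult of_int_add of_int_power)
  ultimately have "(1 + (\<Sum>h=1..<N. meet k h)) * of_int D * of_int ?b ^ (N - 1) \<le> (of_int D + of_int c) * of_int ?b ^ (N - 1)"
    by (simp add: mult_ac)
  then have "(1 + (\<Sum>h=1..<N. meet k h)) * of_int D \<le> of_int D + of_int c"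
    using k by (simp add: mult_le_cancel_right)
  then show ?thesis using D by (simp add: field_simps)
qed

text \<open>The lengths are \<open>J * k\<close> with J = 2 for 7, 9 and 10 directions and J = 1 for
  11, matching the point from which the tail estimate takes over. The bounds are in units of
  1/100000.\<close>

lemma row_checks:
  "horner (7 ^ 2) (row 14 7) * 100000 \<le> (100000 + 21032) * (7 ^ 2) ^ 13"
  "horner (9 ^ 2) (row 18 9) * 100000 \<le> (100000 + 14650) * (9 ^ 2) ^ 17"
  "horner (10 ^ 2) (row 20 10) * 100000 \<le> (100000 + 12737) * (10 ^ 2) ^ 19"
  "horner (11 ^ 2) (row 11 11) * 100000 \<le> (100000 + 11270) * (11 ^ 2) ^ 10"
  by code_simp+

lemma sum_meet_values:
  "(\<Sum>h=1..n. meet 7 h) \<le> 2280 / 10000"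
  "(\<Sum>h=1..n. meet 9 h) \<le> 1485 / 10000"
  "(\<Sum>h=1..n. meet 10 h) \<le> 1280 / 10000"
  "(\<Sum>h=1..n. meet 11 h) \<le> 1158 / 10000"
proof -
  have 7: "(\<Sum>h=1..<2 * 7. meet 7 h) \<le> of_int 21032 / of_int 100000"
    by (rule sum_meet_horner) (use row_checks(1) in simp_all)
  have 9: "(\<Sum>h=1..<2 * 9. meet 9 h) \<le> of_int 14650 / of_int 100000"
    by (rule sum_meet_horner) (use row_checks(2) in simp_all)
  have 10: "(\<Sum>h=1..<2 * 10. meet 10 h) \<le> of_int 12737 / of_int 100000"
    by (rule sum_meet_horner) (use row_checks(3) in simp_all)
  have 11: "(\<Sum>h=1..<1 * 11. meet 11 h) \<le> of_int 11270 / of_int 100000"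
    by (rule sum_meet_horner) (use row_checks(4) in simp_all)
  have peaks: "real 7 * peak 7 2 * (1 + (real 2 + 1) / 2) \<le> 1758 / 100000"
    "real 9 * peak 9 2 * (1 + (real 2 + 1) / 2) \<le> 188 / 100000"
    "real 10 * peak 10 2 * (1 + (real 2 + 1) / 2) \<le> 60 / 100000"
    "real 11 * peak 11 1 * (1 + (real 1 + 1) / 2) \<le> 308 / 100000"
    by (simp_all add: peak_def fact_numeral)
  \<comment> \<open>Each total is the evaluated initial sum plus the tail bound; here 0.21032 +
    0.01758 = 0.22790.\<close>
  show "(\<Sum>h=1..n. meet 7 h) \<le> 2280 / 10000"
    by (rule sum_meet_le[where J=2]) (use 7 peaks(1) in simp_all)
  show "(\<Sum>h=1..n. meet 9 h) \<le> 1485 / 10000"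
    by (rule sum_meet_le[where J=2]) (use 9 peaks(2) in simp_all)
  show "(\<Sum>h=1..n. meet 10 h) \<le> 1280 / 10000"
    by (rule sum_meet_le[where J=2]) (use 10 peaks(3) in simp_all)
  show "(\<Sum>h=1..n. meet 11 h) \<le> 1158 / 10000"
    by (rule sum_meet_le[where J=1]) (use 11 peaks(4) in simp_all)
qed

text \<open>The collision probability at time h is at most \<open>fact h / k ^ h\<close>. Up to h =
  9 the worst case k = 11 is summed; from 10 up to k this quotient does not increase in h, so the
  rest of the first block and the peak at time k are controlled by its value at 10.\<close>

lemma sum_meet_le_generic:
  assumes k: "11 \<le> k"
  shows "(\<Sum>h=1..n. meet k h) \<le> 12 / 100"
proof -
  have k0: "0 < k" using k by simp
  have m: "meet k h \<le> fact h / 11 ^ h" for h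
  proof -
    have "meet k h \<le> fact h / real k ^ h" using meet_le[OF k0] mpmf_le_fact by blast
    also have "\<dots> \<le> fact h / 11 ^ h" using k by (intro divide_left_mono power_mono) auto
    finally show ?thesis .
  qed
  have small: "fact (10 + i) / real k ^ (10 + i) \<le> fact 10 / real k ^ 10" if "10 + i \<le> k" for i
    using that
  proof (induction i)
    case (Suc i)
    have "fact (10 + Suc i) / real k ^ (10 + Suc i)
        = fact (10 + i) / real k ^ (10 + i) * (real (Suc (10 + i)) / real k)"
      by (simp only: add_Suc_right fact_Suc power_Suc times_divide_times_eq mult_ac)
    also have "\<dots> \<le> fact (10 + i) / real k ^ (10 + i) * 1"
      using Suc.prems k0 by (intro mult_left_mono) auto
    finally show ?case using Suc by simp
  qed simp
  have sm: "fact h / real k ^ h \<le> fact 10 / real k ^ 10" if "10 \<le> h" "h \<le> k" for h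
    using small[of "h - 10"] that by simp
  have "(\<Sum>h=1..<1 * k. meet k h) = (\<Sum>h=1..<10. meet k h) + (\<Sum>h=10..<k. meet k h)"
    using k by (simp add: sum.atLeastLessThan_concat)
  also have "(\<Sum>h=10..<k. meet k h) \<le> (\<Sum>h=10..<k. fact 10 / real k ^ 10)"
  proof (rule sum_mono)
    fix h assume h: "h \<in> {10..<k}"
    have "meet k h \<le> fact h / real k ^ h" using meet_le[OF k0] mpmf_le_fact by blast
    also have "\<dots> \<le> fact 10 / real k ^ 10" using h by (intro sm) auto
    finally show "meet k h \<le> fact 10 / real k ^ 10" .
  qed
  also have "(\<Sum>h=10..<k. fact 10 / real k ^ 10) \<le> real k * (fact 10 / real k ^ 10)"
  proof -
    have "real (k - 10) * (fact 10 / real k ^ 10) \<le> real k * (fact 10 / real k ^ 10)"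
      by (rule mult_right_mono) simp_all
    then show ?thesis by simp
  qed
  also have "(\<Sum>h=1..<10. meet k h) \<le> (\<Sum>h=1..<10. fact h / 11 ^ h)" by (intro sum_mono m)
  also have "(\<Sum>h=1..<10. fact h / 11 ^ h :: real) \<le> 11534 / 100000"
    by (simp add: eval_nat_numeral)
  finally have 1: "(\<Sum>h=1..<1 * k. meet k h) \<le> 11534 / 100000 + real k * (fact 10 / real k ^ 10)" by simp
  have "peak k 1 \<le> fact 10 / real k ^ 10" using sm[of k] k by (simp add: peak_def)
  then have 2: "real k * peak k 1 * 2 \<le> real k * (fact 10 / real k ^ 10) * 2"
    using k0 by (intro mult_right_mono mult_left_mono) auto
  have "real k * (fact 10 / real k ^ 10) = fact 10 / real k ^ 9"
    using k0 by (simp add: eval_nat_numeral)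
  also have "\<dots> \<le> fact 10 / 11 ^ 9" using k by (intro divide_left_mono power_mono) auto
  also have "\<dots> \<le> 154 / 100000" by (simp add: fact_numeral)
  finally have 3: "real k * (fact 10 / real k ^ 10) \<le> 154 / 100000" .
  show ?thesis
  proof (rule sum_meet_le[where J=1])
    \<comment> \<open>The quantity \<open>c = k * (fact 10 / k ^ 10)\<close> enters once from the
      first block and twice from the tail: 0.11534 + 3 * 0.00154 = 0.11996.\<close>
    have add_three: "A + B * 2 \<le> 12 / 100"
      if "A \<le> 11534 / 100000 + c" "B * 2 \<le> c * 2" "c \<le> 154 / 100000" for A B c :: real
      using that by linarith
    have two: "1 + (real 1 + 1) / 2 = 2" by simp
    show "(\<Sum>h=1..<1 * k. meet k h) + real k * peak k 1 * (1 + (real 1 + 1) / 2) \<le> 12 / 100"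
      unfolding two by (rule add_three[OF 1 2 3])
  qed (use k in auto)
qed

section \<open>The thresholds in dimension nine and above\<close>

definition lat_steps :: "(int \<times> int) set" where
  "lat_steps = {(0, 0), (1, 0), (- 1, 0), (0, 1), (0, - 1)}"

text \<open>The weight 3/40 is close to \<open>p / (1 + 4 * p)\<close> for p = 107/1000, which balances lateral steps
  against the cost p of the additional edge.\<close>

definition lat_weight :: "int \<times> int \<Rightarrow> real" where
  "lat_weight e = (if e = 0 then 7 / 10 else if e \<in> lat_steps then 3 / 40 else 0)"

interpretation lat9: lateral_walk 7 lat_steps lat_weight
  by unfold_locales (auto simp: lat_steps_def lat_weight_def zero_prod_def)

lemma coll_eq: "lat9.coll \<eta> = (\<Sum>f\<in>lat_steps. lat_weight f * lat_weight (\<eta> + f))"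
proof -
  have fin: "finite lat_steps" by (simp add: lat_steps_def)
  have "lat9.coll \<eta> = (\<Sum>f\<in>lat_steps. \<Sum>e\<in>lat_steps. lat_weight e * lat_weight f * of_bool (e = \<eta> + f))"
    unfolding lat9.coll_def by (rule sum.swap)
  also have "\<dots> = (\<Sum>f\<in>lat_steps. lat_weight f * lat_weight (\<eta> + f))"
  proof (rule sum.cong[OF refl])
    fix f
    have "(\<Sum>e\<in>lat_steps. lat_weight e * lat_weight f * of_bool (e = \<eta> + f))
        = (\<Sum>e\<in>lat_steps. if e = \<eta> + f then lat_weight f * lat_weight (\<eta> + f) else 0)"
      by (intro sum.cong) auto
    also have "\<dots> = lat_weight f * lat_weight (\<eta> + f)"
      using fin by (auto simp: lat_weight_def lat_steps_def zero_prod_def)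
    finally show "(\<Sum>e\<in>lat_steps. lat_weight e * lat_weight f * of_bool (e = \<eta> + f))
        = lat_weight f * lat_weight (\<eta> + f)" .
  qed
  finally show ?thesis .
qed

lemma lat_weight_simp:
  "lat_weight (a, b) = (if a = 0 \<and> b = 0 then 7 / 10 else if \<bar>a\<bar> + \<bar>b\<bar> = 1 then 3 / 40 else 0)"
  unfolding lat_weight_def lat_steps_def zero_prod_def by auto

lemma coll_expand:
  "lat9.coll (a, b) = 7 / 10 * lat_weight (a, b)
     + 3 / 40 * (lat_weight (a + 1, b) + lat_weight (a - 1, b) + lat_weight (a, b + 1) + lat_weight (a, b - 1))"
  unfolding coll_eq by (simp add: lat_steps_def lat_weight_simp[of 0] lat_weight_simp[of 1] lat_weight_simp[of "-1"])

text \<open>The value 0.105 belongs to unit displacements: one walk rests and the other moves, in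
  two ways, 2 * (7/10) * (3/40). At larger displacements both must move, giving at most 4 * (3/40) ^
  2. At displacement 0 the value is (7/10) ^ 2 + 4 * (3/40) ^ 2 = 0.5125.\<close>

lemma coll_le: "\<eta> \<noteq> 0 \<Longrightarrow> lat9.coll \<eta> \<le> 105 / 1000" "lat9.coll \<eta> \<le> 5125 / 10000"
proof -
  obtain a b where \<eta>: "\<eta> = (a, b)" by (cases \<eta>)
  have le: "lat_weight (x, y) \<le> 3 / 40" if "\<not> (x = 0 \<and> y = 0)" for x y
    using that by (auto simp: lat_weight_simp)
  have *: "lat9.coll (a, b) \<le> 105 / 1000" if "\<not> (a = 0 \<and> b = 0)"
  proof (cases "\<bar>a\<bar> + \<bar>b\<bar> = 1")
    case True
    then consider "a = 1" "b = 0" | "a = - 1" "b = 0" | "a = 0" "b = 1" | "a = 0" "b = - 1" by linarith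
    then show ?thesis by cases (simp_all add: coll_expand lat_weight_simp)
  next
    case False
    then have "lat_weight (a + 1, b) \<le> 3 / 40" "lat_weight (a - 1, b) \<le> 3 / 40"
      "lat_weight (a, b + 1) \<le> 3 / 40" "lat_weight (a, b - 1) \<le> 3 / 40"
      by (intro le; linarith)+
    moreover have "lat_weight (a, b) = 0" using False that by (auto simp: lat_weight_simp)
    moreover have "7 / 10 * z + 3 / 40 * (x1 + x2 + x3 + x4) \<le> 105 / 1000"
      if "x1 \<le> 3 / 40" "x2 \<le> 3 / 40" "x3 \<le> 3 / 40" "x4 \<le> 3 / 40" "z = 0" for x1 x2 x3 x4 z :: real
      using that by (simp add: field_simps)
    ultimately show ?thesis unfolding coll_expand by blast
  qed
  then show "\<eta> \<noteq> 0 \<Longrightarrow> lat9.coll \<eta> \<le> 105 / 1000" by (auto simp: \<eta> zero_prod_def)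
  show "lat9.coll \<eta> \<le> 5125 / 10000"
  proof (cases "a = 0 \<and> b = 0")
    case True
    then show ?thesis by (simp add: \<eta> coll_expand lat_weight_simp)
  next
    case False
    from *[OF this] show ?thesis unfolding \<eta> by simp
  qed
qed

lemma cross_le: "\<eta> \<noteq> 0 \<Longrightarrow> lat9.cross \<eta> \<le> 9 / 1600"
proof -
  assume \<eta>: "\<eta> \<noteq> 0"
  have fin: "finite lat_steps" by (simp add: lat_steps_def)
  have one: "(\<Sum>e\<in>lat_steps. lat_weight e * of_bool (e = z)) \<le> 3 / 40" if "z \<noteq> 0" for z
  proof -
    have "(\<Sum>e\<in>lat_steps. lat_weight e * of_bool (e = z)) = (\<Sum>e\<in>lat_steps. if e = z then lat_weight z else 0)"
      by (intro sum.cong) auto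
    then show ?thesis using fin that by (auto simp: lat_weight_def)
  qed
  have "lat9.cross \<eta> = (\<Sum>e\<in>lat_steps. lat_weight e * of_bool (e = \<eta>)) * (\<Sum>f\<in>lat_steps. lat_weight f * of_bool (f = - \<eta>))"
    unfolding lat9.cross_def sum_product by (intro sum.cong refl) simp
  also have "\<dots> \<le> 3 / 40 * (3 / 40)"
    using \<eta> by (intro mult_mono one sum_nonneg) (auto simp: lat9.lam)
  finally show ?thesis by simp
qed

lemma bond_percolates_9:
  "0 < measure (bond_measure 9 (107 / 1000)) {\<omega> \<in> space (bond_measure 9 (107 / 1000)). \<exists>C\<in>bond_clusters 9 \<omega>. infinite C}"
proof -
  have Phi_sum: "(\<Sum>h=1..n. Phi 7 h u u') \<le> 2280 / 10000" for n u u'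
    using sum_mono[of "{1..n}" "\<lambda>h. Phi 7 h u u'" "meet 7"] Phi_le_meet sum_meet_values(1)[of n]
    by (meson order_trans)
  \<comment> \<open>From distinct points the collision at time 1 has probability at most 1/49
    instead of 1/7, so the bound drops to 0.228 - 1/7 + 1/49. This gain is what makes the bound for
    separated walks small.\<close>
  have Phi_sum_neq: "(\<Sum>h=1..n. Phi 7 h u u') \<le> 10556 / 100000" if "u \<noteq> u'" for n u u'
  proof (cases n)
    case (Suc m)
    have "(\<Sum>h=1..n. Phi 7 h u u') = Phi 7 1 u u' + (\<Sum>h=2..n. Phi 7 h u u')"
      unfolding Suc by (subst sum.atLeast_Suc_atMost) (auto simp: numeral_2_eq_2)
    also have "\<dots> \<le> 1 / 49 + (\<Sum>h=2..n. meet 7 h)"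
      using Phi_1_le[OF that, of 7] by (intro add_mono sum_mono Phi_le_meet) simp
    also have "(\<Sum>h=2..n. meet 7 h) = (\<Sum>h=1..n. meet 7 h) - 1 / 7"
      unfolding Suc using meet_1[of 7] by (subst sum.atLeast_Suc_atMost[of 1]) (auto simp: numeral_2_eq_2)
    also have "1 / 49 + ((\<Sum>h=1..n. meet 7 h) - 1 / 7) \<le> 10556 / 100000"
      using sum_meet_values(1)[of n] by simp
    finally show ?thesis .
  qed simp
  have S1: "(\<Sum>e\<in>lat_steps - {0}. lat_weight e ^ 2) = 225 / 10000"
    by (simp add: lat_steps_def zero_prod_def lat_weight_simp power2_eq_square insert_Diff_if)
  have l0: "lat_weight 0 = 7 / 10" by (simp add: lat_weight_def)
  have "lat9.H (1 / (107 / 1000)) n s s \<le> 250" for n s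
  \<comment> \<open>The constants solve the coupled inequalities of the bootstrap with a small
    margin: \<open>\<kappa>\<close> is about 132.71, so the required lower bounds are about 217.9
    for \<open>D0\<close>, 43.03 for \<open>D1\<close>, 249.3 for \<open>X\<close> and 15.01 for
    \<open>Z\<close>.\<close>
  proof (rule lat9.H_bound[where Z="1505 / 100" and ?D0.0=218 and ?D1.0="4304 / 100" and ?Y1.0="5125 / 10000"
        and ?z1.0="105 / 1000" and ?b2.0="9 / 1600" and Gu="2280 / 10000" and Gz="10556 / 100000"])
    show "lat9.coll \<eta> \<le> 5125 / 10000" for \<eta> by (rule coll_le(2))
    show "lat9.coll \<eta> \<le> 105 / 1000" if "\<eta> \<noteq> 0" for \<eta> by (rule coll_le(1)[OF that])
    show "lat9.cross \<eta> \<le> 9 / 1600" if "\<eta> \<noteq> 0" for \<eta> by (rule cross_le[OF that])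
    show "(\<Sum>h=1..n. Phi 7 h u u') \<le> 2280 / 10000" for n u u' by (rule Phi_sum)
    show "(\<Sum>h=1..n. Phi 7 h u u') \<le> 10556 / 100000" if "u \<noteq> u'" for n u u' by (rule Phi_sum_neq[OF that])
  qed (simp_all add: S1[unfolded power2_eq_square] l0 power2_eq_square)
  then have H: "lat9.H (1 / (107 / 1000)) n (\<lambda>_. 0, 0) (\<lambda>_. 0, 0) \<le> 250" for n .
  let ?St = "{u. \<forall>i\<ge>7. u i = 0} \<times> (UNIV :: (int \<times> int) set)"
  show ?thesis
  proof (rule lat9.bond_percolates[OF _ _ _ _ _ _ _ _ _ H, where St="?St" and \<psi>="lattice_pt 9 7"
        and lev="\<lambda>x. nat (\<Sum>i<7. x i)"])
    show "inj_on (lattice_pt 9 7) ?St" by (rule lattice_pt_inj) auto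
    show "nat (\<Sum>i<7. lattice_pt 9 7 s i) = lat9.height s" for s
      by (simp add: lattice_pt_level lat9.height_def)
    show "(lattice_pt 9 7 s, lattice_pt 9 7 (fst s, snd s + snd c)) \<in> arcs 9"
      if "c \<in> {..<7} \<times> lat_steps" "snd c \<noteq> 0" for s c
      using lattice_pt_lateral[of 7 9 "snd c" "fst s" "snd s"] that
      by (cases s) (auto simp: lat_steps_def zero_prod_def)
    show "(lattice_pt 9 7 (fst s, snd s + snd c), lattice_pt 9 7 (lat9.nx s c)) \<in> arcs 9"
      if "c \<in> {..<7} \<times> lat_steps" for s c
      unfolding lat9.nx_def using that by (intro lattice_pt_up) auto
  qed (auto simp: lat9.nx_def step_def)
qed

section \<open>From separated threshold bounds to the conclusion\<close>

lemma conclusion_if_thresholds_separated: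
  fixes d :: nat and b s :: real
  assumes b: "0 < b" "b < 1"
    and bond: "0 < measure (bond_measure d b) {\<omega> \<in> space (bond_measure d b). \<exists>C\<in>bond_clusters d \<omega>. infinite C}"
    and site: "\<And>q. s < q \<Longrightarrow> q \<le> 1 \<Longrightarrow>
       0 < measure (site_measure d q) {\<eta> \<in> space (site_measure d q). \<exists>C\<in>site_clusters d \<eta>. infinite C}"
    and s: "0 \<le> s" "s < (1 - b) ^ (2 * d)"
  shows "(\<exists>\<epsilon>>0. \<forall>p. pc_bond d < p \<and> p < pc_bond d + \<epsilon> \<longrightarrow>
            (\<exists>q\<in>{0..1}. q > pc_site d \<and>
               stochastically_dominates (Zd d)
                 (bond_measure d p) (\<lambda>x \<omega>. x \<in> X_verts d \<omega>)
                 (site_measure d q) (\<lambda>x \<eta>. \<eta> x)))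
         \<and> pfin_bond d > pc_bond d"
proof -
  let ?B = "{p \<in> {0..1}. measure (bond_measure d p)
       {\<omega> \<in> space (bond_measure d p). \<exists>C \<in> bond_clusters d \<omega>. infinite C} > 0}"
  let ?S = "{p \<in> {0..1}. measure (site_measure d p)
       {\<eta> \<in> space (site_measure d p). \<exists>C \<in> site_clusters d \<eta>. infinite C} > 0}"
  let ?F = "{p \<in> {0..1}. measure (bond_measure d p) {\<omega> \<in> space (bond_measure d p).
          \<exists>C \<in> components_of (X_verts d \<omega>) (Zd_edges d). infinite C} > 0}"
  have bB: "b \<in> ?B" using b bond by simp
  have pcb: "pc_bond d \<le> b" unfolding pc_bond_def
    by (rule cInf_lower[OF bB]) (auto intro!: bdd_belowI[of _ 0])
  have pcb0: "0 \<le> pc_bond d" unfolding pc_bond_def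
    using bB by (intro cInf_greatest) auto
  have s1: "s < 1" using s(2) power_le_one[of "1 - b" "2 * d"] b by linarith
  \<comment> \<open>Percolation of sites is assumed only strictly above \<open>s\<close>, hence the
    approximation from above; the minimum with 1 keeps the parameter admissible.\<close>
  have pcs: "pc_site d \<le> s"
  proof (rule dense_ge)
    fix q assume q: "s < q"
    have "min q 1 \<in> ?S" using site[of "min q 1"] q s s1 by auto
    then have "pc_site d \<le> min q 1" unfolding pc_site_def
      by (rule cInf_lower) (auto intro!: bdd_belowI[of _ 0])
    then show "pc_site d \<le> q" by simp
  qed
  have "isCont (\<lambda>p. (1 - p) ^ (2 * d)) b" by (intro continuous_intros)
  then have "\<forall>\<^sub>F p in at b. s < (1 - p) ^ (2 * d)"
    using s(2) by (auto simp: isCont_def intro: order_tendstoD(1))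
  then obtain \<delta> where \<delta>: "0 < \<delta>" "\<And>p. p \<noteq> b \<Longrightarrow> dist p b < \<delta> \<Longrightarrow> s < (1 - p) ^ (2 * d)"
    unfolding eventually_at by blast
  \<comment> \<open>The bond threshold is known only to be at most \<open>b\<close>. Parameters up
    to \<open>b\<close> are covered by monotonicity of \<open>(1 - p) ^ (2 * d)\<close>, and those
    beyond \<open>b\<close> by continuity within \<open>\<delta>\<close>; the second entry of the
    minimum keeps p below 1.\<close>
  define \<epsilon> where "\<epsilon> = min \<delta> (1 - b)"
  have \<epsilon>: "0 < \<epsilon>" using \<delta> b by (simp add: \<epsilon>_def)
  have main: "0 \<le> p \<and> p \<le> 1 \<and> s < (1 - p) ^ (2 * d) \<and> (1 - p) ^ (2 * d) \<le> 1"
    if p: "pc_bond d < p" "p < pc_bond d + \<epsilon>" for p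
  proof -
    have 01: "0 \<le> p" "p \<le> 1" using p pcb pcb0 by (auto simp: \<epsilon>_def)
    have "s < (1 - p) ^ (2 * d)"
    proof (cases "p \<le> b")
      case True
      then have "(1 - b) ^ (2 * d) \<le> (1 - p) ^ (2 * d)" using b by (intro power_mono) auto
      then show ?thesis using s by linarith
    next
      case False
      then show ?thesis using p pcb by (intro \<delta>(2)) (auto simp: \<epsilon>_def dist_real_def)
    qed
    then show ?thesis using 01 by (auto intro: power_le_one)
  qed
  have first: "\<exists>q\<in>{0..1}. q > pc_site d \<and> stochastically_dominates (Zd d)
       (bond_measure d p) (\<lambda>x \<omega>. x \<in> X_verts d \<omega>) (site_measure d q) (\<lambda>x \<eta>. \<eta> x)"
    if p: "pc_bond d < p" "p < pc_bond d + \<epsilon>" for p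
    using main[OF p] pcs X_dominates_site[of p d] s(1) by (intro bexI[of _ "(1 - p) ^ (2 * d)"]) auto
  \<comment> \<open>One parameter strictly above the bond threshold suffices for the second claim:
    if X percolates there, the supremum defining \<open>pfin_bond\<close> is at least that
    large.\<close>
  define p where "p = pc_bond d + \<epsilon> / 2"
  have p: "pc_bond d < p" "p < pc_bond d + \<epsilon>" using \<epsilon> by (auto simp: p_def)
  define q where "q = (1 - p) ^ (2 * d)"
  have pq: "0 \<le> p" "p \<le> 1" "s < q" "q \<le> 1" using main[OF p] by (auto simp: q_def)
  let ?P = "Pi\<^sub>M (Zd d) (\<lambda>_. count_space (UNIV :: bool set))"
  let ?I = "\<lambda>\<eta>. inf_comp d (site_rel d \<eta>)"
  have sets_I: "{\<eta> \<in> space ?P. ?I \<eta>} \<in> sets ?P"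
  proof (rule sets_inf_comp)
    show "site_rel d \<eta> \<subseteq> arcs d" for \<eta> by (auto simp: site_rel_def)
    show "{\<eta> \<in> space ?P. (u, v) \<in> site_rel d \<eta>} \<in> sets ?P" for u v
      using sets_site_rel[of d u v] unfolding sets_PiM_bern by (simp add: space_PiM)
  qed
  \<comment> \<open>Domination is applied to the indicator of an infinite component, which is
    increasing because opening sites only enlarges the open subgraph.\<close>
  have dom: "(\<integral>\<eta>. of_bool (?I (\<lambda>x\<in>Zd d. \<eta> x)) \<partial>site_measure d q)
     \<le> (\<integral>\<omega>. (of_bool (?I (\<lambda>x\<in>Zd d. x \<in> X_verts d \<omega>)) :: real) \<partial>bond_measure d p)"
  proof -
    have "(\<lambda>\<eta>. of_bool (?I \<eta>) :: real) \<in> borel_measurable ?P"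
    proof -
      have "(\<lambda>\<eta>. indicator {\<eta> \<in> space ?P. ?I \<eta>} \<eta> :: real) \<in> borel_measurable ?P"
        using sets_I by (rule borel_measurable_indicator)
      then show ?thesis by (rule measurable_cong[THEN iffD1, rotated]) (simp add: indicator_def)
    qed
    moreover have "bounded ((\<lambda>\<eta>. of_bool (?I \<eta>) :: real) ` (Zd d \<rightarrow>\<^sub>E UNIV))"
      by (rule boundedI[of _ 1]) auto
    moreover have "mono_on (Zd d \<rightarrow>\<^sub>E UNIV) (\<lambda>\<eta>. of_bool (?I \<eta>) :: real)"
    proof (rule mono_onI)
      fix \<eta> \<eta>' :: "(nat \<Rightarrow> int) \<Rightarrow> bool" assume "\<eta> \<le> \<eta>'"
      then have "site_rel d \<eta> \<subseteq> site_rel d \<eta>'" by (auto simp: site_rel_def le_fun_def)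
      then show "(of_bool (?I \<eta>) :: real) \<le> of_bool (?I \<eta>')" using inf_comp_mono by auto
    qed
    ultimately show ?thesis
      using X_dominates_site[OF pq(1,2), of d] unfolding stochastically_dominates_def q_def by blast
  qed
  have eqX: "?I (\<lambda>x\<in>Zd d. x \<in> X_verts d \<omega>)
      \<longleftrightarrow> (\<exists>C \<in> components_of (X_verts d \<omega>) (Zd_edges d). infinite C)" for \<omega>
  proof -
    have "{x \<in> Zd d. (\<lambda>x\<in>Zd d. x \<in> X_verts d \<omega>) x} = X_verts d \<omega>" by (auto simp: X_verts_def)
    then show ?thesis using infinite_site_component_iff[of d "\<lambda>x\<in>Zd d. x \<in> X_verts d \<omega>"] by simp
  qed
  have "0 < measure (site_measure d q) {\<eta> \<in> space (site_measure d q). ?I \<eta>}"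
    using site[OF pq(3,4)] by (simp add: site_clusters_def infinite_site_component_iff)
  also have "\<dots> = (\<integral>\<eta>. of_bool (?I (\<lambda>x\<in>Zd d. \<eta> x)) \<partial>site_measure d q)"
  proof -
    have "(\<integral>\<eta>. (of_bool (?I (\<lambda>x\<in>Zd d. \<eta> x)) :: real) \<partial>site_measure d q)
       = (\<integral>\<eta>. indicator {\<eta> \<in> space (site_measure d q). ?I \<eta>} \<eta> \<partial>site_measure d q)"
      by (intro Bochner_Integration.integral_cong refl) (auto simp: site_measure_def indicator_def PiE_restrict)
    then show ?thesis by (simp add: Int_def conj_commute cong: conj_cong)
  qed
  also have "\<dots> \<le> (\<integral>\<omega>. (of_bool (?I (\<lambda>x\<in>Zd d. x \<in> X_verts d \<omega>)) :: real) \<partial>bond_measure d p)"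
    by (rule dom)
  also have "\<dots> = measure (bond_measure d p) {\<omega> \<in> space (bond_measure d p).
          \<exists>C \<in> components_of (X_verts d \<omega>) (Zd_edges d). infinite C}"
  proof -
    have "(\<integral>\<omega>. (of_bool (?I (\<lambda>x\<in>Zd d. x \<in> X_verts d \<omega>)) :: real) \<partial>bond_measure d p)
       = (\<integral>\<omega>. indicator {\<omega> \<in> space (bond_measure d p).
          \<exists>C \<in> components_of (X_verts d \<omega>) (Zd_edges d). infinite C} \<omega> \<partial>bond_measure d p)"
      unfolding eqX by (intro Bochner_Integration.integral_cong refl) (auto simp: indicator_def)
    then show ?thesis by (simp add: Int_def conj_commute cong: conj_cong)
  qed
  finally have "p \<in> ?F" using pq by simp
  then have "p \<le> pfin_bond d" unfolding pfin_bond_def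
    by (rule cSup_upper) (auto intro!: bdd_aboveI[of _ 1])
  then have "pc_bond d < pfin_bond d" using p(1) by linarith
  then show ?thesis using \<epsilon> first by blast
qed

lemma site_percolates_above:
  assumes "0 < k" "k \<le> d" "\<And>n. (\<Sum>h=1..n. meet k h) \<le> G" "G / (1 + G) < q" "q \<le> 1"
  shows "0 < measure (site_measure d q) {\<eta> \<in> space (site_measure d q). \<exists>C\<in>site_clusters d \<eta>. infinite C}"
proof (rule site_percolates_oriented[OF assms(1,2) _ assms(5,3)])
  have G: "0 \<le> G" using assms(3)[of 0] by simp
  then have "0 \<le> G / (1 + G)" by simp
  then show q: "0 < q" using assms(4) by linarith
  have "G < q * (1 + G)" using assms(4) G by (simp add: divide_less_eq)
  then have "(1 - q) * G < q" by (simp add: algebra_simps)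
  then show "(1 / q - 1) * G < 1" using q by (simp add: field_simps)
qed

theorem theorem1:
  fixes d :: nat
  assumes "d \<ge> 9"
  shows "(\<exists>\<epsilon>>0. \<forall>p. pc_bond d < p \<and> p < pc_bond d + \<epsilon> \<longrightarrow>
            (\<exists>q\<in>{0..1}. q > pc_site d \<and>
               stochastically_dominates (Zd d)
                 (bond_measure d p) (\<lambda>x \<omega>. x \<in> X_verts d \<omega>)
                 (site_measure d q) (\<lambda>x \<eta>. \<eta> x)))
         \<and> pfin_bond d > pc_bond d"
proof -
  consider "d = 9" | "d = 10" | "11 \<le> d" using assms by linarith
  then show ?thesis
  proof cases
    case 1
    show ?thesis unfolding 1
    \<comment> \<open>The margin is narrow: \<open>(893 / 1000) ^ 18\<close> is about 0.1304 and the
      site bound about 0.1293.\<close>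
    proof (rule conclusion_if_thresholds_separated[where b="107 / 1000" and s="(1485 / 10000) / (1 + 1485 / 10000)"])
      show "0 < measure (site_measure 9 q) {\<eta> \<in> space (site_measure 9 q). \<exists>C\<in>site_clusters 9 \<eta>. infinite C}"
        if "(1485 / 10000) / (1 + 1485 / 10000) < q" "q \<le> 1" for q
        by (rule site_percolates_above[of 9, OF _ _ sum_meet_values(2) that]) simp_all
    qed (use bond_percolates_9 in \<open>simp_all add: power_divide\<close>)
  next
    case 2
    show ?thesis unfolding 2
    \<comment> \<open>With ten directions the oriented bound suffices: \<open>(1 - b) ^ 20\<close>
      is about 0.1176 and the site bound about 0.1135.\<close>
    proof (rule conclusion_if_thresholds_separated[where b="1015 / 10000" and s="(1280 / 10000) / (1 + 1280 / 10000)"])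
      show "0 < measure (site_measure 10 q) {\<eta> \<in> space (site_measure 10 q). \<exists>C\<in>site_clusters 10 \<eta>. infinite C}"
        if "(1280 / 10000) / (1 + 1280 / 10000) < q" "q \<le> 1" for q
        by (rule site_percolates_above[of 10, OF _ _ sum_meet_values(3) that]) simp_all
      show "0 < measure (bond_measure 10 (1015 / 10000))
         {\<omega> \<in> space (bond_measure 10 (1015 / 10000)). \<exists>C\<in>bond_clusters 10 \<omega>. infinite C}"
        by (rule bond_percolates_oriented[of 10, OF _ _ _ _ sum_meet_values(3)]) simp_all
    qed (simp_all add: power_divide)
  next
    case 3
    \<comment> \<open>Slightly more than 1 + 12/100, as the strict bond condition requires. For
      \<open>p = c / (d + c)\<close> one has \<open>1 / p - 1 = d / c\<close>, so the condition
      reads 1.12 < c in every dimension.\<close>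
    let ?c = "1121 / 1000 :: real"
    show ?thesis
    proof (rule conclusion_if_thresholds_separated[where b="?c / (d + ?c)" and s="(1158 / 10000) / (1 + 1158 / 10000)"])
      show "0 < measure (site_measure d q) {\<eta> \<in> space (site_measure d q). \<exists>C\<in>site_clusters d \<eta>. infinite C}"
        if "(1158 / 10000) / (1 + 1158 / 10000) < q" "q \<le> 1" for q
        \<comment> \<open>Eleven oriented directions give a site bound valid in all these
          dimensions, so the sharper sum for k = 11 replaces the generic one.\<close>
        by (rule site_percolates_above[of 11, OF _ _ sum_meet_values(4) that]) (use 3 in simp_all)
      show "0 < measure (bond_measure d (?c / (d + ?c)))
         {\<omega> \<in> space (bond_measure d (?c / (d + ?c))). \<exists>C\<in>bond_clusters d \<omega>. infinite C}"
      proof (rule bond_percolates_oriented[of d, OF _ _ _ _ sum_meet_le_generic[OF 3]])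
        have inv: "1 / (?c / (real d + ?c)) - 1 = real d / ?c" by (simp add: field_simps)
        show "(1 / (?c / (real d + ?c)) - 1) * (1 + 12 / 100) < real d"
          unfolding inv using 3 by simp
      qed (use 3 in \<open>auto simp: field_simps\<close>)
      show "(1158 / 10000) / (1 + 1158 / 10000) < (1 - ?c / (real d + ?c)) ^ (2 * d)"
      proof -
        have d0: "0 < real d" using 3 by simp
        \<comment> \<open>Since \<open>1 - p = 1 / (1 + c / d)\<close>, the power
          \<open>(1 - p) ^ (2 * d)\<close> is at least \<open>exp (- 2 * c)\<close> uniformly in d.
          The bound 9.6 for \<open>exp (2 * c)\<close> gives 0.1041 against the site bound
          0.1038.\<close>
        have "(1 + ?c / real d) ^ (2 * d) \<le> exp (?c / real d) ^ (2 * d)"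
          using d0 by (intro power_mono exp_ge_add_one_self) auto
        also have "\<dots> = exp (2 * ?c)" using d0 by (simp flip: exp_of_nat_mult)
        also have "\<dots> = exp 1 ^ 2 * exp (121 / 1000) ^ 2"
          by (simp flip: exp_of_nat_mult exp_add)
        also have "\<dots> \<le> (272 / 100) ^ 2 * (1 + 121 / 1000 + (121 / 1000) ^ 2) ^ 2"
          using exp_bound[of "121 / 1000"] e_less_272
          by (intro mult_mono power_mono) auto
        also have "\<dots> \<le> 96 / 10" by (simp add: power2_eq_square)
        finally have le: "(1 + ?c / real d) ^ (2 * d) \<le> 96 / 10" .
        have eq: "1 - ?c / (real d + ?c) = 1 / (1 + ?c / real d)" using d0 by (simp add: field_simps)
        have "1 / (96 / 10) \<le> 1 / (1 + ?c / real d) ^ (2 * d)"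
          using le d0 by (intro divide_left_mono mult_pos_pos zero_less_power add_pos_nonneg) auto
        then show ?thesis unfolding eq power_one_over[symmetric] power_divide by simp
      qed
    qed (use 3 in \<open>auto simp: field_simps\<close>)
  qed
qed

end
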